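(* Let $S$ be any of the following sets of prime numbers: $S=\{p_1,\dots,p_n\}$, the set of the first $n$ successive prime numbers, for some $n\ge 2$; or $S$ is one of $\{2,3,7\}$, $\{2,3,11\}$, $\{2,3,5,11\}$, $\{2,3,13\}$, $\{2,3,7,13\}$, $\{2,3,17\}$, $\{2,3,5,19\}$. Let $\mathbb{Z}_S=\mathbb{Z}[\{1/p\}_{p\in S}]$. Then the natural map $$H_2(SL_2(\mathbb{Z}_S),\mathbb{Z})\to K_2(2,\mathbb{Z}_S)$$ is an isomorphism, and $$1\to K_2(2,\mathbb{Z}_S)\to St(2,\mathbb{Z}_S)\to SL_2(\mathbb{Z}_S)\to1$$ is the universal central extension of $SL_2(\mathbb{Z}_S)$.
   Context: For a commutative ring $A$, $St(2,A)$ is the group with generators $x_{12}(t),x_{21}(t)$ ($t\in A$) and relations, for $i\ne j\in\{1,2\}$: $x_{ij}(s)x_{ij}(t)=x_{ij}(s+t)$, and $w_{ij}(u)x_{ij}(t)w_{ij}(-u)=x_{ji}(-u^{-2}t)$ for $u\in A^\times,t\in A$, where $w_{ij}(u)=x_{ij}(u)x_{ji}(-u^{-1})x_{ij}(u)$. The homomorphism $\phi:St(2,A)\to SL_2(A)$ sends $x_{ij}(t)$ to the elementary matrix $E_{ij}(t)$ (it is surjective for $A=\mathbb{Z}_S$), and $K_2(2,A)=\ker\phi$. For the sets $S$ listed, a theorem of J. Morita states that $K_2(2,\mathbb{Z}_S)$ is central in $St(2,\mathbb{Z}_S)$ and that the map $K_2(2,\mathbb{Z}_S)\to K_2(2,\mathbb{Q})$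 induced by $\mathbb{Z}_S\subset\mathbb{Q}$ is injective with image the kernel of the tame symbols $K_2(2,\mathbb{Q})\to\bigoplus_{p\notin S}\mathbb{F}_p^\times$. The group $SL_2(\mathbb{Z}_S)$ is perfect. The natural map $H_2(SL_2(\mathbb{Z}_S),\mathbb{Z})\to K_2(2,\mathbb{Z}_S)$ is the one determined by the class of this central extension via $H^2(G,M)\cong\mathrm{Hom}(H_2(G,\mathbb{Z}),M)$ for $G$ perfect: for a set-theoretic section $s$ of $\phi$, it is induced on the bar complex by $[X|Y]\mapsto s(X)s(Y)s(XY)^{-1}$. *)

theory Defs
  imports
    "HOL-Analysis.Determinants"
    "HOL-Algebra.Generated_Rings"
    "HOL-Algebra.Free_Abelian_Groups"
    "HOL-Algebra.Algebraic_Closure_Type"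
    "HOL-Computational_Algebra.Primes"
    "HOL-Library.Infinite_Set"
begin

subsection \<open>Groups given by generators and relations\<close>

text \<open>
  A letter \<open>(True, g)\<close> stands for the generator \<open>g\<close> and \<open>(False, g)\<close> for its formal inverse.
  A pair \<open>(r, s)\<close> of words in \<open>R\<close> is the relation \<open>r = s\<close>.
\<close>

type_synonym 'g word = "(bool \<times> 'g) list"

abbreviation words_over :: "'g set \<Rightarrow> 'g word set" where
  "words_over B \<equiv> lists (UNIV \<times> B)"

inductive word_equiv :: "'g set \<Rightarrow> ('g word \<times> 'g word) set \<Rightarrow> 'g word \<Rightarrow> 'g word \<Rightarrow> bool"
  for B R where
  refl: "u \<in> words_over B \<Longrightarrow> word_equiv B R u u"
| sym: "word_equiv B R u v \<Longrightarrow> word_equiv B R v u"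
| trans: "word_equiv B R u v \<Longrightarrow> word_equiv B R v w \<Longrightarrow> word_equiv B R u w"
| cong: "word_equiv B R u u' \<Longrightarrow> word_equiv B R v v' \<Longrightarrow> word_equiv B R (u @ v) (u' @ v')"
| cancel: "g \<in> B \<Longrightarrow> word_equiv B R [(b, g), (\<not> b, g)] []"
| rel: "(r, s) \<in> R \<Longrightarrow> r \<in> words_over B \<Longrightarrow> s \<in> words_over B \<Longrightarrow> word_equiv B R r s"

definition word_class :: "'g set \<Rightarrow> ('g word \<times> 'g word) set \<Rightarrow> 'g word \<Rightarrow> 'g word set" where
  "word_class B R u = {v. word_equiv B R u v}"

definition presented_group :: "'g set \<Rightarrow> ('g word \<times> 'g word) set \<Rightarrow> 'g word set monoid" where
  "presented_group B R =
     \<lparr>carrier = word_class B R ` words_over B,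
      monoid.mult = (\<lambda>P Q. \<Union>u\<in>P. \<Union>v\<in>Q. word_class B R (u @ v)),
      one = word_class B R []\<rparr>"

definition word_value :: "('a, 'm) monoid_scheme \<Rightarrow> ('g \<Rightarrow> 'a) \<Rightarrow> 'g word \<Rightarrow> 'a" where
  "word_value G f w =
     foldr (\<lambda>(b, g) y. (if b then f g else inv\<^bsub>G\<^esub> (f g)) \<otimes>\<^bsub>G\<^esub> y) w \<one>\<^bsub>G\<^esub>"

text \<open>
  The homomorphism out of \<^term>\<open>presented_group B R\<close> given by \<open>f\<close> on generators, assuming \<open>f\<close>
  respects the relations (so that all words in a class have the same value).
\<close>

definition presented_hom :: "('a, 'm) monoid_scheme \<Rightarrow> ('g \<Rightarrow> 'a) \<Rightarrow> 'g word set \<Rightarrow> 'a" where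
  "presented_hom G f P = the_elem (word_value G f ` P)"

subsection \<open>The Steinberg group of rank one\<close>

text \<open>
  The commutative ring \<open>A\<close> is a subring of a type of class \<^class>\<open>comm_ring_1\<close>, given by its
  underlying set. Indices \<open>i, j\<close> range over the two-element type \<^typ>\<open>2\<close>, whose elements are
  \<open>1\<close> and \<open>2\<close>.
\<close>

type_synonym 'a steinberg_gen = "2 \<times> 2 \<times> 'a"

definition steinberg_gens :: "'a set \<Rightarrow> 'a steinberg_gen set" where
  "steinberg_gens A = {(i, j, t). i \<noteq> j \<and> t \<in> A}"

definition x_word :: "2 \<Rightarrow> 2 \<Rightarrow> 'a \<Rightarrow> 'a steinberg_gen word" where
  "x_word i j t = [(True, (i, j, t))]"

text \<open>\<open>w_word i j u v\<close> is $w_{ij}(u)$, where \<open>v\<close> is the inverse of the unit \<open>u\<close>.\<close>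

definition w_word :: "2 \<Rightarrow> 2 \<Rightarrow> 'a::comm_ring_1 \<Rightarrow> 'a \<Rightarrow> 'a steinberg_gen word" where
  "w_word i j u v = x_word i j u @ x_word j i (- v) @ x_word i j u"

definition steinberg_rels ::
  "'a::comm_ring_1 set \<Rightarrow> ('a steinberg_gen word \<times> 'a steinberg_gen word) set" where
  "steinberg_rels A =
     {(x_word i j s @ x_word i j t, x_word i j (s + t)) | i j s t.
        i \<noteq> j \<and> s \<in> A \<and> t \<in> A} \<union>
     {(w_word i j u v @ x_word i j t @ w_word i j (- u) (- v), x_word j i (- (v\<^sup>2 * t))) | i j u v t.
        i \<noteq> j \<and> u \<in> A \<and> v \<in> A \<and> u * v = 1 \<and> t \<in> A}"

definition St2 :: "'a::comm_ring_1 set \<Rightarrow> 'a steinberg_gen word set monoid" where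
  "St2 A = presented_group (steinberg_gens A) (steinberg_rels A)"

definition SL2 :: "'a::comm_ring_1 set \<Rightarrow> ('a^2^2) monoid" where
  "SL2 A = \<lparr>carrier = {M. (\<forall>i j. M $ i $ j \<in> A) \<and> det M = 1}, monoid.mult = (**), one = mat 1\<rparr>"

definition elem_matrix :: "2 \<Rightarrow> 2 \<Rightarrow> 'a::comm_ring_1 \<Rightarrow> 'a^2^2" where
  "elem_matrix i j t = (\<chi> k l. if k = i \<and> l = j then t else if k = l then 1 else 0)"

definition steinberg_map :: "'a::comm_ring_1 set \<Rightarrow> 'a steinberg_gen word set \<Rightarrow> 'a^2^2" where
  "steinberg_map A = presented_hom (SL2 A) (\<lambda>(i, j, t). elem_matrix i j t)"

definition kernel_group ::
  "('a, 'm) monoid_scheme \<Rightarrow> ('b, 'n) monoid_scheme \<Rightarrow> ('a \<Rightarrow> 'b) \<Rightarrow> ('a, 'm) monoid_scheme" where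
  "kernel_group E G \<pi> = E\<lparr>carrier := kernel E G \<pi>\<rparr>"

definition K2_2 :: "'a::comm_ring_1 set \<Rightarrow> 'a steinberg_gen word set monoid" where
  "K2_2 A = kernel_group (St2 A) (SL2 A) (steinberg_map A)"

subsection \<open>Integral group homology via the bar complex\<close>

text \<open>
  The (unnormalised, inhomogeneous) bar complex with trivial coefficients: the list
  \<open>[g\<^sub>1, \<dots>, g\<^sub>n]\<close> is the basis element $[g_1|\cdots|g_n]$.
\<close>

definition bar_chains :: "('a, 'm) monoid_scheme \<Rightarrow> nat \<Rightarrow> ('a list \<Rightarrow>\<^sub>0 int) monoid" where
  "bar_chains G n = free_Abelian_group {xs. length xs = n \<and> set xs \<subseteq> carrier G}"

definition bar_boundary ::
  "('a, 'm) monoid_scheme \<Rightarrow> ('a list \<Rightarrow>\<^sub>0 int) \<Rightarrow> ('a list \<Rightarrow>\<^sub>0 int)" where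
  "bar_boundary G = frag_extend (\<lambda>xs. if xs = [] then 0 else
     frag_of (tl xs)
     + (\<Sum>k<length xs - 1. frag_cmul ((-1) ^ (k + 1))
          (frag_of (take k xs @ [xs ! k \<otimes>\<^bsub>G\<^esub> xs ! (k + 1)] @ drop (k + 2) xs)))
     + frag_cmul ((-1) ^ length xs) (frag_of (butlast xs)))"

definition bar_cycles :: "('a, 'm) monoid_scheme \<Rightarrow> nat \<Rightarrow> ('a list \<Rightarrow>\<^sub>0 int) set" where
  "bar_cycles G n = {c \<in> carrier (bar_chains G n). bar_boundary G c = 0}"

definition bar_boundaries :: "('a, 'm) monoid_scheme \<Rightarrow> nat \<Rightarrow> ('a list \<Rightarrow>\<^sub>0 int) set" where
  "bar_boundaries G n = bar_boundary G ` carrier (bar_chains G (Suc n))"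

definition group_homology :: "nat \<Rightarrow> ('a, 'm) monoid_scheme \<Rightarrow> ('a list \<Rightarrow>\<^sub>0 int) set monoid" where
  "group_homology n G = (bar_chains G n)\<lparr>carrier := bar_cycles G n\<rparr> Mod bar_boundaries G n"

subsection \<open>Central extensions\<close>

text \<open>
  \<open>\<pi> : E \<rightarrow> G\<close> stands for the extension \<open>1 \<rightarrow> ker \<pi> \<rightarrow> E \<rightarrow> G \<rightarrow> 1\<close>.
\<close>

definition central_extension ::
  "('e, 'm) monoid_scheme \<Rightarrow> ('a, 'n) monoid_scheme \<Rightarrow> ('e \<Rightarrow> 'a) \<Rightarrow> bool" where
  "central_extension E G \<pi> \<longleftrightarrow>
     group E \<and> group G \<and> \<pi> \<in> epi E G \<and>
     (\<forall>z\<in>kernel E G \<pi>. \<forall>x\<in>carrier E. z \<otimes>\<^bsub>E\<^esub> x = x \<otimes>\<^bsub>E\<^esub> z)"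

text \<open>
  The type argument is the carrier type of the extensions to which \<open>E\<close> is compared; universality
  proper means that the predicate holds for every such type. Homomorphisms are taken
  \<^const>\<open>extensional\<close> so that uniqueness concerns their values on the carrier only.
\<close>

definition universal_central_extension ::
  "'f itself \<Rightarrow> ('e, 'm) monoid_scheme \<Rightarrow> ('a, 'n) monoid_scheme \<Rightarrow> ('e \<Rightarrow> 'a) \<Rightarrow> bool" where
  "universal_central_extension _ E G \<pi> \<longleftrightarrow>
     central_extension E G \<pi> \<and>
     (\<forall>(F :: 'f monoid) \<rho>. central_extension F G \<rho> \<longrightarrow>
        (\<exists>!h. h \<in> hom E F \<inter> extensional (carrier E) \<and> (\<forall>x\<in>carrier E. \<rho> (h x) = \<pi> x)))"

text \<open>
  The homomorphism from 2-chains to the kernel with $[X|Y] \mapsto s(X)s(Y)s(XY)^{-1}$, and the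
  map it induces on $H_2$. The product is taken in the (commutative) kernel.
\<close>

definition section_chain_map ::
  "('e, 'm) monoid_scheme \<Rightarrow> ('a, 'n) monoid_scheme \<Rightarrow> ('e \<Rightarrow> 'a) \<Rightarrow> ('a \<Rightarrow> 'e) \<Rightarrow>
   ('a list \<Rightarrow>\<^sub>0 int) \<Rightarrow> 'e" where
  "section_chain_map E G \<pi> s c =
     finprod (kernel_group E G \<pi>)
       (\<lambda>xs. (s (xs ! 0) \<otimes>\<^bsub>E\<^esub> s (xs ! 1) \<otimes>\<^bsub>E\<^esub> inv\<^bsub>E\<^esub> s (xs ! 0 \<otimes>\<^bsub>G\<^esub> xs ! 1))
               [^]\<^bsub>E\<^esub> Poly_Mapping.lookup c xs)
       (Poly_Mapping.keys c)"

definition H2_natural_map ::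
  "('e, 'm) monoid_scheme \<Rightarrow> ('a, 'n) monoid_scheme \<Rightarrow> ('e \<Rightarrow> 'a) \<Rightarrow> ('a \<Rightarrow> 'e) \<Rightarrow>
   ('a list \<Rightarrow>\<^sub>0 int) set \<Rightarrow> 'e" where
  "H2_natural_map E G \<pi> s Q = the_elem (section_chain_map E G \<pi> s ` Q)"

definition set_section ::
  "('e, 'm) monoid_scheme \<Rightarrow> ('a, 'n) monoid_scheme \<Rightarrow> ('e \<Rightarrow> 'a) \<Rightarrow> ('a \<Rightarrow> 'e) \<Rightarrow> bool" where
  "set_section E G \<pi> s \<longleftrightarrow> (\<forall>g\<in>carrier G. s g \<in> carrier E \<and> \<pi> (s g) = g)"

subsection \<open>The ring of S-integers in the rationals\<close>

definition Z_loc :: "nat set \<Rightarrow> rat set" where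
  "Z_loc S = generate_ring ring_of_type_algebra {1 / of_nat p | p. p \<in> S}"

definition first_primes :: "nat \<Rightarrow> nat set" where
  "first_primes n = enumerate {p::nat. prime p} ` {..<n}"

end

theory Submission
  imports Defs "HOL-Library.Product_Plus"
begin

text \<open>
  The symbols $c(u,v) = h(u)h(v)h(uv)^{-1}$ are central in every Steinberg group, so the centrality of
  $K_2(2, A)$ follows once it is generated by symbols. For $A = \mathbb{Z}$ this is the normal form in
  the braid group on three strands. It passes from $B$ to $B[1/p]$: the group $SL_2(B[1/p])$ is the
  amalgam of $SL_2(B)$ and its conjugate by $\mathrm{diag}(1,p)$ over $\Gamma_0(p)$ (a ping-pong
  argument on columns), and modulo symbols the two corresponding subgroups of the Steinberg group
  meet in the preimage of $\Gamma_0(p)$, provided that $\Gamma_0(p) \subseteq SL_2(B)$ is generated by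
  elementary and diagonal matrices. The latter holds when $1, \dots, K$ are units of $B$ and
  $p < (K+1)^2$, by two Dirichlet approximations in a row; this covers all the sets $S$ in question.

  Since $2$ and $2^2 - 1 = 3$ are units, $x_{ij}(t)$ is a commutator with $h(2)$. In a central extension
  of $SL_2(A)$ commutators of lifts are canonical, which gives canonical lifts of the elementary
  matrices satisfying the Steinberg relations. Hence $St(2, A)$ is perfect and universal. The
  statement on $H_2$ is then formal: injectivity follows by mapping $St(2, A)$ to the extension of
  $SL_2(A)$ by the 2-chains modulo boundaries that is defined by the tautological cocycle.
\<close>

subsection \<open>Subgroups of additively written groups\<close>

text \<open>The induction over primes cannot run on Steinberg groups themselves, because St(2, B) ->
  St(2, B[1/p]) is not known to be injective. The statement carried along concerns any maps x, y
  from B to any group that satisfy the Steinberg relations: a word in their values whose matrix is 1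
  has a product of symbols as its value. Inside the group for B[1/p] it applies twice, to x, y
  restricted to B and to their conjugate by diag(1,p). Words and their matrices are treated together
  by working in subgroups generated by pairs of a value and a matrix, whether or not the value
  determines the matrix. Groups are types, written additively, so that such products are again
  groups; a group given by a carrier enters through its left translations. Symbols over the larger
  ring are adjoined to both subgroups from the start, since the lifts of a diagonal matrix in the
  two subsystems agree only up to a symbol c(u, 1/p).\<close>

lemmas grp = diff_conv_add_uminus add.assoc minus_add

inductive_set sgp :: "'c::group_add set \<Rightarrow> 'c set" for V where
  zero: "0 \<in> sgp V"
| incl: "g \<in> V \<Longrightarrow> g \<in> sgp V"
| add: "g \<in> sgp V \<Longrightarrow> h \<in> sgp V \<Longrightarrow> g + h \<in> sgp V"
| neg: "g \<in> sgp V \<Longrightarrow> - g \<in> sgp V"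

lemma sgp_diff: "g \<in> sgp V \<Longrightarrow> h \<in> sgp V \<Longrightarrow> g - h \<in> sgp V"
  by (metis sgp.add sgp.neg diff_conv_add_uminus)

lemma sgp_least:
  assumes "V \<subseteq> sgp Y" shows "sgp V \<subseteq> sgp Y"
proof
  fix g assume "g \<in> sgp V"
  then show "g \<in> sgp Y"
    by induction (use assms in \<open>auto intro: sgp.intros\<close>)
qed

lemma sgp_mono: "V \<subseteq> Y \<Longrightarrow> sgp V \<subseteq> sgp Y"
  by (rule sgp_least) (auto intro: sgp.incl)

lemma additive_zero:
  fixes f :: "'c::group_add \<Rightarrow> 'd::group_add"
  assumes f: "\<And>g h. f (g + h) = f g + f h"
  shows "f 0 = 0"
  using f[of 0 0] by (metis add_0_right add_left_cancel)

lemma additive_uminus: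
  fixes f :: "'c::group_add \<Rightarrow> 'd::group_add"
  assumes f: "\<And>g h. f (g + h) = f g + f h"
  shows "f (- g) = - f g"
  using f[of g "- g"] additive_zero[of f, OF f] by (metis add.right_inverse minus_unique)

text \<open>Lifts a word letter by letter. This is how a matrix written in generators of Gamma_0(p)
  acquires a lift made of prescribed letters.\<close>

lemma sgp_image_preimage:
  fixes f :: "'c::group_add \<Rightarrow> 'd::group_add"
  assumes f: "\<And>g h. f (g + h) = f g + f h" and "h \<in> sgp (f ` V)"
  shows "\<exists>g\<in>sgp V. f g = h"
proof -
  note f0 = additive_zero[of f, OF f] and fn = additive_uminus[of f, OF f]
  from assms(2) show ?thesis
  proof induction
    case zero
    show ?case using f0 by (intro bexI[of _ 0] sgp.zero)
  next
    case (incl h)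
    then show ?case by (auto intro: sgp.incl)
  next
    case (add h k)
    then obtain a b where "a \<in> sgp V" "b \<in> sgp V" "f a = h" "f b = k" by blast
    then show ?case using f by (intro bexI[of _ "a + b"] sgp.add) auto
  next
    case (neg h)
    then obtain a where "a \<in> sgp V" "f a = h" by blast
    then show ?case using fn by (intro bexI[of _ "- a"] sgp.neg) auto
  qed
qed

lemma sgp_image:
  fixes f :: "'c::group_add \<Rightarrow> 'd::group_add"
  assumes f: "\<And>g h. f (g + h) = f g + f h" and "g \<in> sgp V"
  shows "f g \<in> sgp (f ` V)"
proof -
  note f0 = additive_zero[of f, OF f] and fn = additive_uminus[of f, OF f]
  from assms(2) show ?thesis
    by induction (auto simp: f f0 fn intro: sgp.intros)
qed

lemma commutes_neg:
  fixes z g :: "'c::group_add"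
  assumes "z + g = g + z" shows "z + - g = - g + z"
proof -
  have "- g + (z + g) + - g = - g + (g + z) + - g" using assms by simp
  \<comment> \<open>\<open>grp\<close> spells a group word out as a right-nested sum of letters and
    negated letters; \<open>add_uminus_conv_diff\<close> would fold it back and is switched
    off.\<close>
  then show ?thesis by (simp add: grp del: add_uminus_conv_diff)
qed

lemma sgp_commutes:
  assumes "\<And>g. g \<in> V \<Longrightarrow> z + g = g + z" and "g \<in> sgp V"
  shows "z + g = g + z"
  using assms(2)
proof induction
  case (add g h)
  then show ?case by (metis add.assoc)
next
  case (neg g)
  then show ?case using commutes_neg[of z g] by simp
qed (auto simp: assms(1))

subsection \<open>The group \<open>SL\<^sub>2(\<rat>)\<close>, written additively\<close>

text \<open>Matrices over the whole field serve all subrings at once, so that passing from B to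
  B[1/p] changes no type. As a type of class \<open>group_add\<close> it can be paired with any
  Steinberg system.\<close>

typedef rsl2 = "{q :: rat \<times> rat \<times> rat \<times> rat. case q of (a, b, c, d) \<Rightarrow> a * d - b * c = 1}"
  by (rule exI[of _ "(1, 0, 0, 1)"]) simp

setup_lifting type_definition_rsl2

lift_definition ent_a :: "rsl2 \<Rightarrow> rat" is "\<lambda>(a, b, c, d). a" .
lift_definition ent_b :: "rsl2 \<Rightarrow> rat" is "\<lambda>(a, b, c, d). b" .
lift_definition ent_c :: "rsl2 \<Rightarrow> rat" is "\<lambda>(a, b, c, d). c" .
lift_definition ent_d :: "rsl2 \<Rightarrow> rat" is "\<lambda>(a, b, c, d). d" .

lemma rsl2_eq_iff:
  "M = N \<longleftrightarrow> ent_a M = ent_a N \<and> ent_b M = ent_b N \<and> ent_c M = ent_c N \<and> ent_d M = ent_d N"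
  by transfer auto

lemma rsl2_det: "ent_a M * ent_d M - ent_b M * ent_c M = 1"
  by transfer auto

instantiation rsl2 :: group_add
begin

lift_definition zero_rsl2 :: rsl2 is "(1, 0, 0, 1)" by simp

lift_definition plus_rsl2 :: "rsl2 \<Rightarrow> rsl2 \<Rightarrow> rsl2" is
  "\<lambda>(a, b, c, d) (a', b', c', d'). (a * a' + b * c', a * b' + b * d', c * a' + d * c', c * b' + d * d')"
proof clarsimp
  fix a b c d a' b' c' d' :: rat
  assume 1: "a * d - b * c = 1" "a' * d' - b' * c' = 1"
  have "(a * a' + b * c') * (c * b' + d * d') - (a * b' + b * d') * (c * a' + d * c')
    = (a * d - b * c) * (a' * d' - b' * c')" by (simp add: algebra_simps)
  then show "(a * a' + b * c') * (c * b' + d * d') - (a * b' + b * d') * (c * a' + d * c') = 1"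
    using 1 by simp
qed

lift_definition uminus_rsl2 :: "rsl2 \<Rightarrow> rsl2" is "\<lambda>(a, b, c, d). (d, - b, - c, a)"
  by (auto simp: algebra_simps)

definition minus_rsl2 :: "rsl2 \<Rightarrow> rsl2 \<Rightarrow> rsl2" where "minus_rsl2 M N = M + - N"

instance
proof
  fix M N K :: rsl2
  show "M + N + K = M + (N + K)" by transfer (auto simp: algebra_simps)
  show "0 + M = M" by transfer auto
  show "M + 0 = M" by transfer auto
  show "- M + M = 0" by transfer (auto simp: algebra_simps)
  show "M + - N = M - N" by (simp add: minus_rsl2_def)
qed

end

lift_definition upper :: "rat \<Rightarrow> rsl2" is "\<lambda>t. (1, t, 0, 1)" by simp
lift_definition lower :: "rat \<Rightarrow> rsl2" is "\<lambda>t. (1, 0, t, 1)" by simp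
text \<open>The value at \<open>0\<close> is junk.\<close>
lift_definition diagm :: "rat \<Rightarrow> rsl2" is "\<lambda>u. if u = 0 then (1, 0, 0, 1) else (u, 0, 0, 1 / u)" by simp

lemma entries [simp]:
  "ent_a 0 = 1" "ent_b 0 = 0" "ent_c 0 = 0" "ent_d 0 = 1"
  "ent_a (upper t) = 1" "ent_b (upper t) = t" "ent_c (upper t) = 0" "ent_d (upper t) = 1"
  "ent_a (lower t) = 1" "ent_b (lower t) = 0" "ent_c (lower t) = t" "ent_d (lower t) = 1"
  by (transfer; simp)+

lemma entries_diagm [simp]:
  "u \<noteq> 0 \<Longrightarrow> ent_a (diagm u) = u" "ent_b (diagm u) = 0" "ent_c (diagm u) = 0"
  "u \<noteq> 0 \<Longrightarrow> ent_d (diagm u) = 1 / u"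
  by (transfer; simp)+

lemma entries_plus [simp]:
  "ent_a (M + N) = ent_a M * ent_a N + ent_b M * ent_c N"
  "ent_b (M + N) = ent_a M * ent_b N + ent_b M * ent_d N"
  "ent_c (M + N) = ent_c M * ent_a N + ent_d M * ent_c N"
  "ent_d (M + N) = ent_c M * ent_b N + ent_d M * ent_d N"
  by (transfer; auto)+

lemma entries_uminus [simp]:
  "ent_a (- M) = ent_d M" "ent_b (- M) = - ent_b M" "ent_c (- M) = - ent_c M" "ent_d (- M) = ent_a M"
  by (transfer; auto)+

lemma entries_minus [simp]:
  "ent_a (M - N) = ent_a M * ent_d N - ent_b M * ent_c N"
  "ent_b (M - N) = - ent_a M * ent_b N + ent_b M * ent_a N"
  "ent_c (M - N) = ent_c M * ent_d N - ent_d M * ent_c N"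
  "ent_d (M - N) = - ent_c M * ent_b N + ent_d M * ent_a N"
  unfolding minus_rsl2_def entries_plus entries_uminus by simp_all

subsection \<open>Steinberg systems\<close>

locale rat_subring =
  fixes B :: "rat set"
  assumes one_mem: "1 \<in> B"
    and diff_mem: "s \<in> B \<Longrightarrow> t \<in> B \<Longrightarrow> s - t \<in> B"
    and mult_mem: "s \<in> B \<Longrightarrow> t \<in> B \<Longrightarrow> s * t \<in> B"
begin

lemma zero_mem: "0 \<in> B"
  using diff_mem[OF one_mem one_mem] by simp

lemma uminus_mem: "t \<in> B \<Longrightarrow> - t \<in> B"
  using diff_mem[OF zero_mem] by simp

lemma add_mem: "s \<in> B \<Longrightarrow> t \<in> B \<Longrightarrow> s + t \<in> B"
  using diff_mem[OF _ uminus_mem] by simp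

lemma nat_mem: "of_nat n \<in> B"
  by (induction n) (auto intro: zero_mem one_mem add_mem)

lemma int_mem: "of_int k \<in> B"
  by (cases k rule: int_diff_cases) (auto intro: nat_mem diff_mem)

lemma power_mem: "t \<in> B \<Longrightarrow> t ^ n \<in> B"
  by (induction n) (auto intro: one_mem mult_mem)

definition units :: "rat set" where
  "units = {u \<in> B. u \<noteq> 0 \<and> 1 / u \<in> B}"

lemma unitsD: "u \<in> units \<Longrightarrow> u \<in> B" "u \<in> units \<Longrightarrow> u \<noteq> 0" "u \<in> units \<Longrightarrow> 1 / u \<in> B"
  by (auto simp: units_def)

lemma units_mult: "u \<in> units \<Longrightarrow> v \<in> units \<Longrightarrow> u * v \<in> units"
  using mult_mem by (auto simp: units_def) (metis divide_divide_eq_left mult.right_neutral times_divide_eq_right)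

lemma units_uminus: "u \<in> units \<Longrightarrow> - u \<in> units"
  using uminus_mem[of u] uminus_mem[of "1/u"] by (auto simp: units_def)

lemma units_one: "1 \<in> units"
  by (simp add: units_def one_mem)

lemma units_inverse: "u \<in> units \<Longrightarrow> 1 / u \<in> units"
  by (simp add: units_def)

lemma units_divide: "u \<in> units \<Longrightarrow> v \<in> units \<Longrightarrow> u / v \<in> units"
  using units_mult[OF _ units_inverse] by simp

lemma divide_mem: "t \<in> B \<Longrightarrow> u \<in> units \<Longrightarrow> t / u \<in> B"
  using mult_mem[of t "1/u"] by (auto simp: units_def)

end

text \<open>The conjugation relation is demanded for one ordered pair of indices; the one for the
  other pair follows, see \<open>y_conj\<close>. The maps need be neither injective nor generating,
  so restrictions and conjugates inside a larger system are again systems.\<close>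

locale steinberg_system = rat_subring B for B :: "rat set" +
  fixes x y :: "rat \<Rightarrow> 'b::group_add"
  assumes x_add: "s \<in> B \<Longrightarrow> t \<in> B \<Longrightarrow> x s + x t = x (s + t)"
    and y_add: "s \<in> B \<Longrightarrow> t \<in> B \<Longrightarrow> y s + y t = y (s + t)"
    and w_conj: "u \<in> units \<Longrightarrow> t \<in> B \<Longrightarrow>
      (x u + y (- (1 / u)) + x u) + x t + (x (- u) + y (1 / u) + x (- u)) = y (- (t / u\<^sup>2))"
begin

definition w :: "rat \<Rightarrow> 'b" where "w u = x u + y (- (1 / u)) + x u"

definition h :: "rat \<Rightarrow> 'b" where "h u = w u + w (- 1)"

definition sym :: "rat \<Rightarrow> rat \<Rightarrow> 'b" where "sym u v = h u + h v - h (u * v)"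

definition syms :: "'b set" where "syms = sgp {sym u v | u v. u \<in> units \<and> v \<in> units}"

text \<open>Generators paired with their matrices. \<open>(g, 0) \<in> sgp gens\<close> says that
  some word with value \<open>g\<close> has trivial matrix, which makes sense although the value
  need not determine the matrix.\<close>

definition gens :: "('b \<times> rsl2) set" where
  "gens = {(x t, upper t) | t. t \<in> B} \<union> {(y t, lower t) | t. t \<in> B}"

lemma x_zero: "x 0 = 0"
  using x_add[OF zero_mem zero_mem] by (metis add_0_right add_left_cancel)

lemma y_zero: "y 0 = 0"
  using y_add[OF zero_mem zero_mem] by (metis add_0_right add_left_cancel)

lemma x_uminus: "t \<in> B \<Longrightarrow> x (- t) = - x t"
  using x_add[of t "- t"] by (metis add.right_inverse minus_unique uminus_mem x_zero)

lemma y_uminus: "t \<in> B \<Longrightarrow> y (- t) = - y t"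
  using y_add[of t "- t"] by (metis add.right_inverse minus_unique uminus_mem y_zero)

lemma w_uminus: "u \<in> units \<Longrightarrow> w (- u) = - w u"
  using x_uminus[of u] y_uminus[of "1/u"]
  by (simp add: w_def unitsD grp del: add_uminus_conv_diff)

lemma w_x: "u \<in> units \<Longrightarrow> t \<in> B \<Longrightarrow> w u + x t = y (- (t / u\<^sup>2)) + w u"
proof -
  assume u: "u \<in> units" and t: "t \<in> B"
  have "w u + x t + w (- u) = y (- (t / u\<^sup>2))"
    using w_conj[OF u t] by (simp add: w_def)
  then have "w u + x t + - w u + w u = y (- (t / u\<^sup>2)) + w u"
    using w_uminus[OF u] by simp
  then show ?thesis by (simp add: grp del: add_uminus_conv_diff)
qed

text \<open>This is \<open>w_x\<close> for \<open>- u\<close>, whose w-element is the inverse of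
  \<open>w u\<close>, solved for \<open>y t\<close>.\<close>

lemma w_y: "u \<in> units \<Longrightarrow> t \<in> B \<Longrightarrow> w u + y t = x (- (t * u\<^sup>2)) + w u"
proof -
  assume u: "u \<in> units" and t: "t \<in> B"
  have m: "- (t * u\<^sup>2) \<in> B" using u t by (simp add: uminus_mem mult_mem power_mem unitsD)
  have "w (- u) + x (- (t * u\<^sup>2)) = y (- (- (t * u\<^sup>2) / (- u)\<^sup>2)) + w (- u)"
    using w_x[OF units_uminus[OF u] m] by simp
  then have "- w u + x (- (t * u\<^sup>2)) = y t - w u"
    using u by (simp add: w_uminus unitsD)
  then have "w u + (- w u + x (- (t * u\<^sup>2))) + w u = w u + (y t - w u) + w u"
    by simp
  then show ?thesis by (simp add: grp del: add_uminus_conv_diff)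
qed

lemma h_x: "u \<in> units \<Longrightarrow> t \<in> B \<Longrightarrow> h u + x t = x (u\<^sup>2 * t) + h u"
proof -
  assume u: "u \<in> units" and t: "t \<in> B"
  have "h u + x t = w u + (w (- 1) + x t)" by (simp only: h_def add.assoc)
  also have "\<dots> = (w u + y (- t)) + w (- 1)"
    using w_x[OF units_uminus[OF units_one] t] by (simp add: add.assoc)
  also have "\<dots> = x (u\<^sup>2 * t) + (w u + w (- 1))"
    using w_y[OF u uminus_mem[OF t]] by (simp add: add.assoc mult.commute)
  finally show ?thesis by (simp only: h_def)
qed

lemma h_y: "u \<in> units \<Longrightarrow> t \<in> B \<Longrightarrow> h u + y t = y (t / u\<^sup>2) + h u"
proof -
  assume u: "u \<in> units" and t: "t \<in> B"
  have "h u + y t = w u + (w (- 1) + y t)" by (simp only: h_def add.assoc)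
  also have "\<dots> = (w u + x (- t)) + w (- 1)"
    using w_y[OF units_uminus[OF units_one] t] by (simp add: add.assoc)
  also have "\<dots> = y (t / u\<^sup>2) + (w u + w (- 1))"
    using w_x[OF u uminus_mem[OF t]] by (simp add: add.assoc)
  finally show ?thesis by (simp only: h_def)
qed

lemma h_neg_x: "u \<in> units \<Longrightarrow> t \<in> B \<Longrightarrow> - h u + x t = x (t / u\<^sup>2) + - h u"
proof -
  assume u: "u \<in> units" and t: "t \<in> B"
  have "t / u\<^sup>2 \<in> B" using u t by (metis divide_mem units_mult power2_eq_square)
  from h_x[OF u this] have "h u + x (t / u\<^sup>2) = x t + h u" using u by (simp add: unitsD)
  then have "- h u + (h u + x (t / u\<^sup>2)) + - h u = - h u + (x t + h u) + - h u" by simp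
  then show ?thesis by (simp add: grp del: add_uminus_conv_diff)
qed

lemma h_neg_y: "u \<in> units \<Longrightarrow> t \<in> B \<Longrightarrow> - h u + y t = y (t * u\<^sup>2) + - h u"
proof -
  assume u: "u \<in> units" and t: "t \<in> B"
  have "t * u\<^sup>2 \<in> B" using u t by (simp add: mult_mem power_mem unitsD)
  from h_y[OF u this] have "h u + y (t * u\<^sup>2) = y t + h u" using u by (simp add: unitsD)
  then have "- h u + (h u + y (t * u\<^sup>2)) + - h u = - h u + (y t + h u) + - h u" by simp
  then show ?thesis by (simp add: grp del: add_uminus_conv_diff)
qed

text \<open>Moving \<open>x t\<close> past \<open>h a\<close> multiplies its argument by a^2, past
  \<open>- h a\<close> by a^-2; over the three factors of a symbol these squares cancel.\<close>

lemma sym_x: "u \<in> units \<Longrightarrow> v \<in> units \<Longrightarrow> t \<in> B \<Longrightarrow> sym u v + x t = x t + sym u v"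
proof -
  assume u: "u \<in> units" and v: "v \<in> units" and t: "t \<in> B"
  let ?s = "t / (u * v)\<^sup>2"
  have s: "?s \<in> B" "v\<^sup>2 * ?s \<in> B"
    using u v t by (metis divide_mem units_mult power2_eq_square)
      (use u v t in \<open>metis divide_mem units_mult power2_eq_square mult_mem unitsD(1)\<close>)
  have "sym u v + x t = h u + (h v + (- h (u * v) + x t))"
    by (simp only: sym_def add.assoc diff_conv_add_uminus)
  also have "\<dots> = h u + (h v + (x ?s + - h (u * v)))" using h_neg_x u v t units_mult by simp
  also have "\<dots> = h u + ((h v + x ?s) + - h (u * v))" by (simp only: add.assoc)
  also have "\<dots> = (h u + x (v\<^sup>2 * ?s)) + (h v + - h (u * v))" using h_x v s by (simp only: add.assoc)
  also have "\<dots> = x (u\<^sup>2 * (v\<^sup>2 * ?s)) + (h u + (h v + - h (u * v)))"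
    using h_x u s by (simp only: add.assoc)
  also have "u\<^sup>2 * (v\<^sup>2 * ?s) = t" using u v by (simp add: unitsD power_mult_distrib)
  finally show ?thesis by (simp only: sym_def add.assoc diff_conv_add_uminus)
qed

lemma sym_y: "u \<in> units \<Longrightarrow> v \<in> units \<Longrightarrow> t \<in> B \<Longrightarrow> sym u v + y t = y t + sym u v"
proof -
  assume u: "u \<in> units" and v: "v \<in> units" and t: "t \<in> B"
  let ?s = "t * (u * v)\<^sup>2"
  have s: "?s \<in> B" using u v t by (simp add: mult_mem power_mem unitsD)
  have s': "?s / v\<^sup>2 \<in> B" using s v by (metis divide_mem units_mult power2_eq_square)
  have "sym u v + y t = h u + (h v + (- h (u * v) + y t))"
    by (simp only: sym_def add.assoc diff_conv_add_uminus)
  also have "\<dots> = h u + (h v + (y ?s + - h (u * v)))" using h_neg_y u v t units_mult by simp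
  also have "\<dots> = h u + ((h v + y ?s) + - h (u * v))" by (simp only: add.assoc)
  also have "\<dots> = (h u + y (?s / v\<^sup>2)) + (h v + - h (u * v))" using h_y v s by (simp only: add.assoc)
  also have "\<dots> = y (?s / v\<^sup>2 / u\<^sup>2) + (h u + (h v + - h (u * v)))"
    using h_y u s' by (simp only: add.assoc)
  also have "?s / v\<^sup>2 / u\<^sup>2 = t" using u v by (simp add: unitsD power_mult_distrib)
  finally show ?thesis by (simp only: sym_def add.assoc diff_conv_add_uminus)
qed

lemma gens_fst_commutes:
  assumes z: "z \<in> syms" and g: "(g, M) \<in> sgp gens"
  shows "z + g = g + z"
proof -
  have "fst (g, M) \<in> sgp (fst ` gens)" by (rule sgp_image[OF _ g]) simp
  moreover have "g' + z = z + g'" if "g' \<in> fst ` gens" for g'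
    using z unfolding syms_def
    by (rule sgp_commutes[rotated])
      (use that in \<open>auto simp: gens_def sym_x sym_y\<close>)
  ultimately show ?thesis using sgp_commutes[of "fst ` gens" z g] by force
qed

lemma x_gens: "t \<in> B \<Longrightarrow> (x t, upper t) \<in> sgp gens"
  by (auto simp: gens_def intro: sgp.incl)

lemma y_gens: "t \<in> B \<Longrightarrow> (y t, lower t) \<in> sgp gens"
  by (auto simp: gens_def intro: sgp.incl)

lemma h_gens:
  assumes u: "u \<in> units" shows "(h u, diagm u) \<in> sgp gens"
proof -
  have *: "(w u, upper u + lower (- (1 / u)) + upper u) \<in> sgp gens" if "u \<in> units" for u
  proof -
    have "(x u, upper u) + (y (- (1 / u)), lower (- (1 / u))) + (x u, upper u) \<in> sgp gens"
      by (intro sgp.add x_gens y_gens unitsD uminus_mem that)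
    then show ?thesis by (simp add: w_def)
  qed
  have "(h u, (upper u + lower (- (1 / u)) + upper u) + (upper (-1) + lower (- (1 / (-1))) + upper (-1))) \<in> sgp gens"
    using sgp.add[OF *[OF u] *[OF units_uminus[OF units_one]]] by (simp add: h_def)
  also have "(upper u + lower (- (1 / u)) + upper u) + (upper (-1) + lower (- (1 / (-1))) + upper (-1)) = diagm u"
    using u by (simp add: rsl2_eq_iff unitsD)
  finally show ?thesis .
qed

end

subsection \<open>The ring of integers\<close>

text \<open>Words without inverses: for the elementary matrices \<open>upper 1\<close> and
  \<open>lower 1\<close> such products have nonnegative entries, so that a trivial one can be
  recognised.\<close>

inductive_set monoid_span :: "'c::monoid_add \<Rightarrow> 'c \<Rightarrow> 'c set" for U L where
  zero: "0 \<in> monoid_span U L"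
| left: "m \<in> monoid_span U L \<Longrightarrow> U + m \<in> monoid_span U L"
| right: "m \<in> monoid_span U L \<Longrightarrow> L + m \<in> monoid_span U L"

text \<open>
  These are the relations of the braid group on three strands, with \<open>w\<close> the half twist and \<open>w + w\<close> central.
\<close>

lemma braid_normal_form:
  fixes U L w :: "'c::group_add"
  assumes wU: "w + U = - L + w" and wL: "w + L = - U + w" and w: "w = U - L + U"
    and g: "g \<in> sgp {U, L}"
  shows "\<exists>\<zeta>\<in>sgp {w + w}. \<exists>\<alpha>\<in>{0, w}. \<exists>m\<in>monoid_span U L. \<exists>\<beta>\<in>{0, w}. g = \<zeta> + \<alpha> + m + \<beta>"
proof -
  define z where "z = w + w"
  \<comment> \<open>The set of normal forms contains 0; what has to be seen is that left
    multiplication by \<open>U\<close>, \<open>L\<close> and their inverses preserves it.\<close>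
  define N where "N = {\<zeta> + \<alpha> + m + \<beta> | \<zeta> \<alpha> m \<beta>. \<zeta> \<in> sgp {z} \<and> \<alpha> \<in> {0, w} \<and> m \<in> monoid_span U L \<and> \<beta> \<in> {0, w}}"
  note [simp del] = add_uminus_conv_diff
  have zU: "z + U = U + z"
  proof -
    have "w + (w + U) = w + (- L + w)" using wU by simp
    moreover have "w + - L = U + w"
    proof -
      have "U + (w + L) + - L = U + (- U + w) + - L" using wL by simp
      then show ?thesis by (simp add: grp)
    qed
    ultimately show ?thesis by (simp add: z_def add.assoc[symmetric])
  qed
  have zL: "z + L = L + z"
  proof -
    have "w + (w + L) = w + (- U + w)" using wL by simp
    moreover have "w + - U = L + w"
    proof -
      have "L + (w + U) + - U = L + (- L + w) + - U" using wU by simp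
      then show ?thesis by (simp add: grp)
    qed
    ultimately show ?thesis by (simp add: z_def add.assoc[symmetric])
  qed
  have zw: "z + w = w + z" by (simp add: z_def add.assoc)
  have cU: "U + \<zeta> = \<zeta> + U" and cL: "L + \<zeta> = \<zeta> + L" and cw: "w + \<zeta> = \<zeta> + w"
    if "\<zeta> \<in> sgp {z}" for \<zeta>
    using that by (rule sgp_commutes[rotated], use zU zL zw in simp)+
  \<comment> \<open>This and the next three equations dispose of a letter in front of
    \<open>w\<close> followed by a positive word: letter, \<open>w\<close> and the first letter of
    the word collapse to \<open>w\<close> or to a single letter, possibly with the central factor
    \<open>z\<close>.\<close>
  have UwU: "U + w + U = z + L"
  proof -
    have "w + - U = U + - L" using w by (metis add.assoc add.right_inverse add_0_right diff_conv_add_uminus)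
    then have "w + (w + L) = U + - L + w" using wL by (metis add.assoc)
    then show ?thesis using wU by (simp add: z_def grp)
  qed
  have UwL: "U + w + L = w" using wL by (simp add: grp)
  have LwU: "L + w + U = w" using wU by (simp add: grp)
  have w': "w = - L + U + - L"
  proof -
    have "- L + w + - U = w" using wU by (metis add.assoc add.right_inverse add_0_right)
    moreover have "w + - U = U + - L" using w by (metis add.assoc add.right_inverse add_0_right diff_conv_add_uminus)
    ultimately show ?thesis by (simp add: grp)
  qed
  have LwL: "L + w + L = U" using w' by (simp add: grp)
  have Nz: "\<zeta> + n \<in> N" if "\<zeta> \<in> sgp {z}" "n \<in> N" for \<zeta> n
  proof -
    from that(2) obtain \<zeta>' \<alpha> m \<beta> where *: "n = \<zeta>' + \<alpha> + m + \<beta>" "\<zeta>' \<in> sgp {z}"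
      "\<alpha> \<in> {0, w}" "m \<in> monoid_span U L" "\<beta> \<in> {0, w}" unfolding N_def by auto
    have "\<zeta> + n = (\<zeta> + \<zeta>') + \<alpha> + m + \<beta>" using * by (simp only: add.assoc)
    with * that(1) show ?thesis unfolding N_def by (blast intro: sgp.add)
  qed
  have N0: "\<alpha> + m + \<beta> \<in> N" if "\<alpha> \<in> {0, w}" "m \<in> monoid_span U L" "\<beta> \<in> {0, w}" for \<alpha> m \<beta>
  proof -
    have "\<alpha> + m + \<beta> = 0 + \<alpha> + m + \<beta>" by simp
    then show ?thesis unfolding N_def using that sgp.zero by blast
  qed
  have zz: "z \<in> sgp {z}" by (simp add: sgp.incl)
  have Nw: "w + n \<in> N" if "n \<in> N" for n
  proof -
    from that obtain \<zeta> \<alpha> m \<beta> where *: "n = \<zeta> + \<alpha> + m + \<beta>" "\<zeta> \<in> sgp {z}"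
      "\<alpha> \<in> {0, w}" "m \<in> monoid_span U L" "\<beta> \<in> {0, w}" unfolding N_def by auto
    have "w + n = \<zeta> + (w + \<alpha> + m + \<beta>)" using cw[OF *(2)] * by (metis add.assoc)
    moreover have "w + \<alpha> + m + \<beta> \<in> N"
    proof (cases "\<alpha> = 0")
      case True
      then show ?thesis using N0[of w m \<beta>] * by simp
    next
      case False
      then have "w + \<alpha> + m + \<beta> = z + (0 + m + \<beta>)" using * by (simp add: z_def add.assoc)
      then show ?thesis using N0[of 0 m \<beta>] * Nz zz by simp
    qed
    ultimately show ?thesis using Nz *(2) by simp
  qed
  have step: "V + n \<in> N" if "n \<in> N" and V: "V = U \<or> V = L" for n V
  proof -
    have Vc: "V + \<zeta> = \<zeta> + V" if "\<zeta> \<in> sgp {z}" for \<zeta> using cU cL V that by auto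
    from that obtain \<zeta> \<alpha> m \<beta> where *: "n = \<zeta> + \<alpha> + m + \<beta>" "\<zeta> \<in> sgp {z}"
      "\<alpha> \<in> {0, w}" "m \<in> monoid_span U L" "\<beta> \<in> {0, w}" unfolding N_def by auto
    have "V + n = \<zeta> + (V + \<alpha> + m + \<beta>)" using Vc[OF *(2)] * by (metis add.assoc)
    moreover have "V + \<alpha> + m + \<beta> \<in> N"
    proof (cases "\<alpha> = 0")
      case True
      have "V + m \<in> monoid_span U L" using V * by (auto intro: monoid_span.intros)
      then show ?thesis using N0[of 0 "V + m" \<beta>] True * by (simp add: add.assoc)
    next
      case False
      with * have \<alpha>: "\<alpha> = w" by simp
      from *(4) show ?thesis
      proof cases
        case zero
        have "V + \<alpha> + m + \<beta> = 0 + V + (w + \<beta>)" using \<alpha> zero by (simp add: add.assoc)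
        moreover have "V + 0 \<in> monoid_span U L" using V by (blast intro: monoid_span.intros)
        ultimately show ?thesis
        proof (cases "\<beta> = 0")
          case True
          then show ?thesis using N0[of 0 "V + 0" w] \<alpha> zero \<open>V + 0 \<in> monoid_span U L\<close> by simp
        next
          case False
          then have "V + \<alpha> + m + \<beta> = z + (0 + (V + 0) + 0)"
            using \<alpha> zero * Vc[OF zz] by (simp add: z_def add.assoc)
          then show ?thesis using Nz[OF zz] N0[of 0 "V + 0" 0] \<open>V + 0 \<in> monoid_span U L\<close> by simp
        qed
      next
        case (left m')
        show ?thesis
        proof (cases "V = U")
          case True
          have "V + \<alpha> + m + \<beta> = (U + w + U) + m' + \<beta>" using \<alpha> left True by (simp only: add.assoc)
          also have "\<dots> = z + (0 + (L + m') + \<beta>)" using UwU by (simp add: add.assoc)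
          finally show ?thesis using Nz[OF zz] N0[of 0 "L + m'" \<beta>] left * by (simp add: monoid_span.right)
        next
          case False
          have "V + \<alpha> + m + \<beta> = L + w + (U + m') + \<beta>" using \<alpha> left False V by simp
          also have "\<dots> = (L + w + U) + m' + \<beta>" by (simp only: add.assoc)
          also have "\<dots> = w + m' + \<beta>" using LwU by simp
          finally show ?thesis using N0[of w m' \<beta>] left * by simp
        qed
      next
        case (right m')
        show ?thesis
        proof (cases "V = U")
          case True
          have "V + \<alpha> + m + \<beta> = (U + w + L) + m' + \<beta>" using \<alpha> right True by (simp only: add.assoc)
          also have "\<dots> = w + m' + \<beta>" using UwL by simp
          finally show ?thesis using N0[of w m' \<beta>] right * by simp
        next
          case False
          have "V + \<alpha> + m + \<beta> = L + w + (L + m') + \<beta>" using \<alpha> right False V by simp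
          also have "\<dots> = (L + w + L) + m' + \<beta>" by (simp only: add.assoc)
          also have "\<dots> = 0 + (U + m') + \<beta>" using LwL by (simp add: add.assoc)
          finally show ?thesis using N0[of 0 "U + m'" \<beta>] right * by (simp add: monoid_span.left)
        qed
      qed
    qed
    ultimately show ?thesis using Nz *(2) by simp
  qed
  have neg: "- V + n \<in> N" if n: "n \<in> N" and V: "V = U \<or> V = L" for n V
  proof -
    \<comment> \<open>Conjugation by \<open>w\<close> takes either generator to the inverse of the
      other, so inverses cost only factors \<open>w\<close> and the central
      \<open>z\<close>.\<close>
    define V' where "V' = (if V = U then L else U)"
    have "w + V' = - V + w" using V wU wL by (auto simp: V'_def)
    then have "- V = w + V' + - w" by (simp add: grp)
    also have "- w = - z + w" by (simp add: z_def grp)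
    finally have "- V + n = w + (V' + (- z + (w + n)))" by (simp only: add.assoc)
    moreover have "- z \<in> sgp {z}" by (simp add: sgp.incl sgp.neg)
    ultimately show ?thesis using Nw[OF step[OF Nz[OF _ Nw[OF n]]]] V by (auto simp: V'_def)
  qed
  have both: "g + n \<in> N \<and> - g + n \<in> N" if "n \<in> N" for n
    using g that
  proof (induction arbitrary: n)
    case (add g h)
    then show ?case by (simp add: grp)
  qed (use step neg in auto)
  have "0 + 0 + 0 \<in> N" by (rule N0) (auto intro: monoid_span.zero)
  from both[OF this] have "g \<in> N" by simp
  then show ?thesis unfolding N_def z_def by blast
qed

lemma int_mult_x:
  fixes x :: "rat \<Rightarrow> 'c::group_add"
  assumes add: "\<And>s t. s \<in> \<int> \<Longrightarrow> t \<in> \<int> \<Longrightarrow> x s + x t = x (s + t)" and t: "t \<in> \<int>"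
  shows "x t \<in> sgp {x 1}"
proof -
  have x0: "x 0 = 0" using add[of 0 0] by (metis Ints_0 add_0_right add_left_cancel)
  have nat: "x (of_nat n) \<in> sgp {x 1}" for n
  proof (induction n)
    case 0
    then show ?case using x0 by (simp add: sgp.zero)
  next
    case (Suc n)
    have "x (of_nat (Suc n)) = x 1 + x (of_nat n)" using add[of 1 "of_nat n"] by simp
    then show ?case using Suc by (auto intro: sgp.intros)
  qed
  from t obtain k where k: "t = of_int k" by (auto elim: Ints_cases)
  obtain m n where "k = int m - int n" using int_diff_cases by blast
  then have "x t + x (of_nat n) = x (of_nat m)" using add[of t "of_nat n"] k by simp
  then have "x t = x (of_nat m) - x (of_nat n)" by (simp add: eq_diff_eq)
  then show ?thesis using nat by (auto intro: sgp_diff)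
qed

text \<open>If the matrix is trivial, the positive part of the normal form has, up to sign, the
  matrix 1 or that of w(1). Nonnegative entries with diagonal at least 1 leave only the empty word.
  What remains is a power of w(1)^2, whose matrix is -1, hence a power of w(1)^4, and w(1)^4 is the
  inverse of the symbol c(-1,-1).\<close>

lemma (in steinberg_system) kernel_symbols_Ints:
  assumes B: "B = \<int>" and g: "(g, 0) \<in> sgp gens"
  shows "g \<in> syms"
proof -
  define U L W where "U = (x 1, upper 1)" and "L = (y 1, lower 1)"
    and "W = (w 1, upper 1 + lower (- 1) + upper 1)"
  note u1 = units_one
  have "gens \<subseteq> sgp {U, L}"
  proof -
    have "(x t, upper t) \<in> sgp {U, L}" if "t \<in> \<int>" for t
      using int_mult_x[of "\<lambda>t. (x t, upper t)" t] that sgp_mono[of "{U}" "{U, L}"]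
      by (auto simp: x_add B U_def rsl2_eq_iff)
    moreover have "(y t, lower t) \<in> sgp {U, L}" if "t \<in> \<int>" for t
      using int_mult_x[of "\<lambda>t. (y t, lower t)" t] that sgp_mono[of "{L}" "{U, L}"]
      by (auto simp: y_add B L_def rsl2_eq_iff)
    ultimately show ?thesis unfolding gens_def using B by auto
  qed
  with g have gUL: "(g, 0) \<in> sgp {U, L}" using sgp_least by blast
  have WU: "W + U = - L + W"
    using w_x[OF u1 one_mem] by (simp add: W_def U_def L_def rsl2_eq_iff y_uminus one_mem)
  have WL: "W + L = - U + W"
    using w_y[OF u1 one_mem] by (simp add: W_def U_def L_def rsl2_eq_iff x_uminus one_mem)
  have W: "W = U - L + U"
    by (simp add: W_def U_def L_def rsl2_eq_iff w_def y_uminus one_mem)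
  from braid_normal_form[OF WU WL W gUL] obtain \<zeta> \<alpha> m \<beta> where
    n: "\<zeta> \<in> sgp {W + W}" "\<alpha> \<in> {0, W}" "m \<in> monoid_span U L" "\<beta> \<in> {0, W}" "(g, 0) = \<zeta> + \<alpha> + m + \<beta>"
    by blast
  let ?z = "W + W"
  \<comment> \<open>Powers of w(1)^2 sorted by parity: the even ones have trivial matrix, the odd
    ones have matrix -1.\<close>
  have Z: "\<zeta> \<in> sgp {?z + ?z} \<or> (\<exists>\<eta>\<in>sgp {?z + ?z}. \<zeta> = ?z + \<eta>)" if "\<zeta> \<in> sgp {?z}" for \<zeta>
    using that
  proof induction
    case zero
    then show ?case by (simp add: sgp.zero)
  next
    case (incl g)
    then show ?case using sgp.zero by force
  next
    case (add a b)
    have comm: "\<eta> + ?z = ?z + \<eta>" if "\<eta> \<in> sgp {?z + ?z}" for \<eta>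
      using sgp_commutes[of "{?z + ?z}" ?z \<eta>] that by (simp add: add.assoc)
    from add.IH show ?case
    proof (elim disjE bexE)
      fix \<eta> \<theta> assume "\<eta> \<in> sgp {?z + ?z}" "a = ?z + \<eta>" "\<theta> \<in> sgp {?z + ?z}" "b = ?z + \<theta>"
      moreover from this have "a + b = (?z + ?z) + (\<eta> + \<theta>)" using comm by (metis add.assoc)
      ultimately show ?thesis by (auto intro: sgp.intros)
    next
      fix \<theta> assume "a \<in> sgp {?z + ?z}" "\<theta> \<in> sgp {?z + ?z}" "b = ?z + \<theta>"
      moreover from this have "a + b = ?z + (a + \<theta>)" using comm by (metis add.assoc)
      ultimately show ?thesis by (blast intro: sgp.intros)
    next
      fix \<eta> assume "\<eta> \<in> sgp {?z + ?z}" "a = ?z + \<eta>" "b \<in> sgp {?z + ?z}"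
      moreover from this have "a + b = ?z + (\<eta> + b)" by (metis add.assoc)
      ultimately show ?thesis by (blast intro: sgp.intros)
    qed (auto intro: sgp.intros)
  next
    case (neg a)
    have comm: "\<eta> + ?z = ?z + \<eta>" if "\<eta> \<in> sgp {?z + ?z}" for \<eta>
      using sgp_commutes[of "{?z + ?z}" ?z \<eta>] that by (simp add: add.assoc)
    from neg.IH show ?case
    proof (elim disjE bexE)
      fix \<eta> assume e: "\<eta> \<in> sgp {?z + ?z}" "a = ?z + \<eta>"
      have ne: "- \<eta> + - (?z + ?z) \<in> sgp {?z + ?z}" by (intro sgp.add sgp.neg e(1) sgp.incl singletonI)
      have "- a = - \<eta> + - (?z + ?z) + ?z"
        using e by (simp add: grp del: add_uminus_conv_diff)
      also have "\<dots> = ?z + (- \<eta> + - (?z + ?z))" using comm[OF ne] .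
      finally show ?thesis using ne by blast
    qed (auto intro: sgp.intros)
  qed
  define neg1 where "neg1 = upper 1 + lower (- 1) + upper 1 + (upper 1 + lower (- 1) + upper 1)"
  have sW: "snd ?z = neg1" "neg1 + neg1 = 0" by (auto simp: W_def neg1_def rsl2_eq_iff)
  have szz: "snd \<eta> = 0" if "\<eta> \<in> sgp {?z + ?z}" for \<eta>
    using that by induction (use sW in \<open>auto simp: rsl2_eq_iff\<close>)
  have sz: "snd \<zeta> = 0 \<or> snd \<zeta> = neg1" using Z[OF n(1)] szz sW(1) by (metis add.right_neutral snd_add)
  \<comment> \<open>The last clause holds because an outermost \<open>U\<close> adds the entry d to
    b and an outermost \<open>L\<close> adds a to c, and both diagonal entries are at least
    1.\<close>
  have pos: "ent_a (snd m) \<ge> 1 \<and> ent_d (snd m) \<ge> 1 \<and> ent_b (snd m) \<ge> 0 \<and> ent_c (snd m) \<ge> 0 \<and>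
      (ent_b (snd m) = 0 \<and> ent_c (snd m) = 0 \<longrightarrow> m = 0)"
    using n(3) by induction (auto simp: U_def L_def)
  have "snd \<zeta> + snd \<alpha> + snd m + snd \<beta> = 0" using n(5) by (metis snd_add snd_conv)
  then have m: "snd m = - snd \<alpha> - snd \<zeta> - snd \<beta>"
    by (metis add.assoc add_diff_cancel diff_0 minus_add_cancel group_cancel.neg1 add_eq_0_iff neg_eq_iff_add_eq_0 diff_conv_add_uminus minus_add add_0)
  have "m = 0 \<and> \<alpha> = \<beta>"
  proof (cases "\<alpha> = \<beta>")
    case True
    have "ent_b (snd m) = 0 \<and> ent_c (snd m) = 0"
      using m sz n(2,4) True by (auto simp: neg1_def W_def)
    then show ?thesis using pos True by blast
  next
    case False
    have "ent_a (snd m) = 0" using m sz n(2,4) False by (auto simp: neg1_def W_def)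
    then show ?thesis using pos by simp
  qed
  then have "(g, 0) \<in> sgp {?z}"
    using n(1,2,5) by (auto simp: add.assoc intro: sgp.intros)
  \<comment> \<open>An odd power is excluded since its matrix would be -1.\<close>
  from Z[OF this] have "(g, 0) \<in> sgp {?z + ?z}"
  proof (elim disjE bexE)
    fix \<eta> assume e: "\<eta> \<in> sgp {?z + ?z}" "(g, 0) = ?z + \<eta>"
    have "snd ?z + snd \<eta> = 0" using arg_cong[OF e(2), of snd] by simp
    then have "neg1 = 0" using szz[OF e(1)] sW by simp
    then show ?thesis by (simp add: neg1_def rsl2_eq_iff)
  qed
  from sgp_image[OF _ this, of fst] have "fst (g, 0) \<in> sgp (fst ` {?z + ?z})" by simp
  moreover have "fst (?z + ?z) = - sym (- 1) (- 1)"
    using w_uminus[OF u1] by (simp add: W_def sym_def h_def grp del: add_uminus_conv_diff)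
  moreover have "- sym (- 1) (- 1) \<in> syms"
    unfolding syms_def by (rule sgp.neg, rule sgp.incl) (use units_uminus[OF u1] in blast)
  ultimately show ?thesis unfolding syms_def using sgp_least[of "{- sym (- 1) (- 1)}"] by force
qed

subsection \<open>Alternating products\<close>

text \<open>Reduced words of an amalgam, with no claim of uniqueness. That a reduced word is
  nontrivial comes later, from ping-pong.\<close>

inductive alternating :: "'c::group_add set \<Rightarrow> 'c set \<Rightarrow> 'c \<Rightarrow> bool" where
  single: "g \<in> P \<Longrightarrow> g \<notin> Q \<Longrightarrow> alternating P Q g"
| step: "g \<in> P \<Longrightarrow> g \<notin> Q \<Longrightarrow> alternating Q P h \<Longrightarrow> alternating P Q (g + h)"

lemma add_notin_sgp: "j \<in> sgp V \<Longrightarrow> g \<notin> sgp V \<Longrightarrow> j + g \<notin> sgp V"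
  by (metis minus_add_cancel sgp.add sgp.neg)

lemma alternating_absorb:
  assumes "alternating (sgp V) (sgp V') k" "j \<in> sgp V" "j \<in> sgp V'"
  shows "alternating (sgp V) (sgp V') (j + k)"
  using assms(1)
proof cases
  case single
  then show ?thesis using assms by (intro alternating.single sgp.add add_notin_sgp)
next
  case (step g h)
  then have "alternating (sgp V) (sgp V') ((j + g) + h)"
    using assms by (intro alternating.step sgp.add add_notin_sgp)
  then show ?thesis using step by (simp add: add.assoc)
qed

text \<open>Only the front of the word changes: if the product with the first factor falls into the
  intersection, the next factor absorbs it.\<close>

lemma alternating_left_mult:
  assumes "g \<in> sgp V"
    and k: "k \<in> sgp V \<inter> sgp V' \<or> alternating (sgp V) (sgp V') k \<or> alternating (sgp V') (sgp V) k"
  shows "g + k \<in> sgp V \<inter> sgp V' \<or> alternating (sgp V) (sgp V') (g + k) \<or> alternating (sgp V') (sgp V) (g + k)"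
  using k
proof (elim disjE)
  assume "k \<in> sgp V \<inter> sgp V'"
  then show ?thesis using assms(1) by (cases "g + k \<in> sgp V'") (auto intro: sgp.add alternating.single)
next
  assume "alternating (sgp V) (sgp V') k"
  then show ?thesis
  proof cases
    case single
    then show ?thesis using assms(1) by (cases "g + k \<in> sgp V'") (auto intro: sgp.add alternating.single)
  next
    case (step g1 h)
    have *: "g + k = (g + g1) + h" using step by (simp add: add.assoc)
    have "g + g1 \<in> sgp V" using step assms(1) by (auto intro: sgp.add)
    then show ?thesis unfolding * using step(4)
      by (cases "g + g1 \<in> sgp V'") (auto intro: alternating_absorb alternating.step)
  qed
next
  assume "alternating (sgp V') (sgp V) k"
  then show ?thesis using assms(1)
    by (cases "g \<in> sgp V'") (auto intro: alternating_absorb alternating.step)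
qed

lemma alternating_span:
  assumes "g \<in> sgp (sgp V \<union> sgp V')"
  shows "g \<in> sgp V \<inter> sgp V' \<or> alternating (sgp V) (sgp V') g \<or> alternating (sgp V') (sgp V) g"
proof -
  let ?S = "\<lambda>k. k \<in> sgp V \<inter> sgp V' \<or> alternating (sgp V) (sgp V') k \<or> alternating (sgp V') (sgp V) k"
  have *: "?S k \<Longrightarrow> ?S (g + k)" if "g \<in> sgp V \<union> sgp V'" for g k
    using that alternating_left_mult[of g V k V'] alternating_left_mult[of g V' k V] by blast
  have "?S (g + k) \<and> ?S (- g + k)" if "?S k" for k
    using assms that
  proof (induction arbitrary: k)
    case zero
    then show ?case by simp
  next
    case (incl g)
    then show ?case using *[of g k] *[of "- g" k] by (auto intro: sgp.neg)
  next
    case (add g h)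
    show ?case using add.IH(1)[of "h + k"] add.IH(2)[of k] add.IH(1)[of k] add.IH(2)[of "- g + k"] add.prems
      by (simp add: grp del: add_uminus_conv_diff)
  next
    case (neg g)
    then show ?case by simp
  qed
  from this[of 0] show ?thesis by (simp add: sgp.zero)
qed

lemma sgp_Un_central:
  assumes c: "\<And>z g. z \<in> Z \<Longrightarrow> g \<in> V \<Longrightarrow> z + g = g + z" and Z: "Z = sgp Z" and g: "g \<in> sgp (V \<union> Z)"
  shows "\<exists>z\<in>Z. \<exists>g0\<in>sgp V. g = z + g0"
proof -
  have c': "z + g = g + z" if "z \<in> Z" "g \<in> sgp V" for z g
    using that(2) by (rule sgp_commutes[rotated]) (use c that in auto)
  have Zi: "0 \<in> Z" "\<And>a b. a \<in> Z \<Longrightarrow> b \<in> Z \<Longrightarrow> a + b \<in> Z" "\<And>a. a \<in> Z \<Longrightarrow> - a \<in> Z"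
    using sgp.zero[of Z] sgp.add[of _ Z] sgp.neg[of _ Z] Z by auto
  from g show ?thesis
  proof induction
    case zero
    then show ?case using Zi sgp.zero by force
  next
    case (incl g)
    then show ?case
    proof
      assume "g \<in> V"
      then show ?thesis using Zi(1) by (intro bexI[of _ 0] bexI[of _ g]) (auto intro: sgp.incl)
    next
      assume "g \<in> Z"
      then show ?thesis by (intro bexI[of _ g] bexI[of _ 0]) (auto intro: sgp.zero)
    qed
  next
    case (add g h)
    then obtain z g0 z' h0 where *: "z \<in> Z" "g0 \<in> sgp V" "g = z + g0" "z' \<in> Z" "h0 \<in> sgp V" "h = z' + h0"
      by blast
    have "g + h = z + (g0 + z') + h0" using * by (simp add: add.assoc)
    also have "\<dots> = (z + z') + (g0 + h0)" using c'[of z' g0] * by (metis add.assoc)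
    finally show ?case using * Zi by (blast intro: sgp.add)
  next
    case (neg g)
    then obtain z g0 where *: "z \<in> Z" "g0 \<in> sgp V" "g = z + g0" by blast
    have "- g = - (g0 + z)" using * c' by simp
    also have "\<dots> = - z + - g0" by (simp add: minus_add)
    finally show ?case using * Zi by (blast intro: sgp.neg)
  qed
qed

subsection \<open>Adjoining the inverse of a prime\<close>

text \<open>Conjugation by the diagonal matrix with entries \<open>1\<close> and \<open>p\<close>; junk at \<open>p = 0\<close>.\<close>
lift_definition twist :: "rat \<Rightarrow> rsl2 \<Rightarrow> rsl2" is
  "\<lambda>p (a, b, c, d). if p = 0 then (a, b, c, d) else (a, b / p, c * p, d)"
  by (auto split: if_splits)

lemma entries_twist [simp]:
  "ent_a (twist p M) = ent_a M" "p \<noteq> 0 \<Longrightarrow> ent_b (twist p M) = ent_b M / p"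
  "p \<noteq> 0 \<Longrightarrow> ent_c (twist p M) = ent_c M * p" "ent_d (twist p M) = ent_d M"
  by (transfer; auto)+

lemma twist_add: "p \<noteq> 0 \<Longrightarrow> twist p (M + N) = twist p M + twist p N"
  by (simp add: rsl2_eq_iff field_simps)

lemma twist_eq_zero: "p \<noteq> 0 \<Longrightarrow> twist p M = 0 \<Longrightarrow> M = 0"
  by (simp add: rsl2_eq_iff)

lemma (in steinberg_system) sym_syms: "u \<in> units \<Longrightarrow> v \<in> units \<Longrightarrow> sym u v \<in> syms"
  unfolding syms_def by (rule sgp.incl) blast

text \<open>\<open>A\<close> is B[1/p] for a prime \<open>p\<close> of \<open>B\<close>.
  \<open>kernel_B\<close> is the induction hypothesis; it ranges over all systems over
  \<open>B\<close> in the given group because it is needed for two of them. \<open>Gamma0\<close> is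
  the arithmetic input: generation of the congruence subgroup by elementary and diagonal
  matrices.\<close>

locale steinberg_extension =
  steinberg_system A x y + B: rat_subring B for A B :: "rat set" and x y :: "rat \<Rightarrow> 'b::group_add" +
  fixes p :: rat
  assumes BA: "B \<subseteq> A" and p0: "p \<noteq> 0" and pB: "p \<in> B" and pA: "1 / p \<in> A" and p_nonunit: "1 / p \<notin> B"
    and p_prime: "s \<in> B \<Longrightarrow> t \<in> B \<Longrightarrow> s * t / p \<in> B \<Longrightarrow> s / p \<in> B \<or> t / p \<in> B"
    and A_denom: "t \<in> A \<Longrightarrow> \<exists>k. p ^ k * t \<in> B"
    and Gamma0: "ent_a M \<in> B \<Longrightarrow> ent_b M \<in> B \<Longrightarrow> ent_c M / p \<in> B \<Longrightarrow> ent_d M \<in> B \<Longrightarrow>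
      M \<in> sgp ({upper t | t. t \<in> B} \<union> {lower (p * t) | t. t \<in> B} \<union> {diagm u | u. u \<in> B.units})"
    and kernel_B: "steinberg_system B x' y' \<Longrightarrow> (g, 0) \<in> sgp (steinberg_system.gens B x' y') \<Longrightarrow>
      g \<in> steinberg_system.syms B x' (y' :: rat \<Rightarrow> 'b)"
begin

lemma units_BA: "u \<in> B.units \<Longrightarrow> u \<in> units"
  using BA by (auto simp: units_def B.units_def)

lemma p_unit: "1 / p \<in> units" "p \<in> units"
  using p0 pB pA BA by (auto simp: units_def)

sublocale B: steinberg_system B x y
  by unfold_locales (use BA units_BA in \<open>auto intro!: x_add y_add w_conj\<close>)

text \<open>With \<open>y'\<close>, the system over \<open>B\<close> that belongs to the conjugate
  of SL_2(B) by diag(1,p). Its w(u) is \<open>w (u / p)\<close>, so its relations are instances of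
  those over \<open>A\<close> at the unit u / p.\<close>

definition x' :: "rat \<Rightarrow> 'b" where "x' t = x (t / p)"
definition y' :: "rat \<Rightarrow> 'b" where "y' t = y (p * t)"

sublocale T: steinberg_system B x' y'
proof
  show "x' s + x' t = x' (s + t)" if "s \<in> B" "t \<in> B" for s t
    using that x_add[of "s / p" "t / p"] BA divide_mem[OF _ p_unit(2)]
    by (auto simp: x'_def add_divide_distrib)
  show "y' s + y' t = y' (s + t)" if "s \<in> B" "t \<in> B" for s t
    using that y_add[of "p * s" "p * t"] BA pB mult_mem[of p] by (auto simp: y'_def distrib_left)
  show "(x' u + y' (- (1 / u)) + x' u) + x' t + (x' (- u) + y' (1 / u) + x' (- u)) = y' (- (t / u\<^sup>2))"
    if u: "u \<in> B.units" and t: "t \<in> B" for u t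
  proof -
    have "t / p \<in> A" using t BA divide_mem[OF _ p_unit(2)] by blast
    from w_conj[OF units_divide[OF units_BA[OF u] p_unit(2)] this] show ?thesis
      using p0 by (simp add: x'_def y'_def power_divide power2_eq_square mult.commute)
  qed
qed

lemma syms_central: "z \<in> syms \<Longrightarrow> u \<in> units \<Longrightarrow> z + h u = h u + z"
  using gens_fst_commutes[OF _ h_gens] .

text \<open>In the conjugate system w(u) is \<open>w (u / p)\<close>, so its h(u) is h(u / p) h(1 /
  p)^-1. The two systems thus share their diagonal elements modulo symbols, and the symbols of the
  conjugate system are products of symbols over \<open>A\<close>.\<close>

lemma T_h: "u \<in> B.units \<Longrightarrow> T.h u = - sym u (1 / p) + h u"
proof -
  assume u: "u \<in> B.units"
  have w: "T.w v = w (v / p)" for v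
    by (simp add: T.w_def w_def x'_def y'_def)
  have "T.h u = w (u / p) + - w (1 / p)"
    using w_uminus[OF p_unit(1)] by (simp add: T.h_def w)
  also have "\<dots> = h (u / p) + - h (1 / p)"
    by (simp add: h_def grp del: add_uminus_conv_diff)
  also have "\<dots> = - sym u (1 / p) + h u"
    by (simp add: sym_def grp del: add_uminus_conv_diff)
  finally show ?thesis .
qed

lemma T_sym: "u \<in> B.units \<Longrightarrow> v \<in> B.units \<Longrightarrow> T.sym u v \<in> syms"
proof -
  assume u: "u \<in> B.units" and v: "v \<in> B.units"
  have s: "- sym u (1 / p) \<in> syms" if "u \<in> B.units" for u
    using sym_syms[OF units_BA[OF that] p_unit(1)] unfolding syms_def by (rule sgp.neg)
  have "T.sym u v = - sym u (1 / p) + (h u + - sym v (1 / p)) + h v + - h (u * v) + sym (u * v) (1 / p)"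
    by (simp add: T.sym_def T_h u v B.units_mult grp del: add_uminus_conv_diff)
  also have "\<dots> = - sym u (1 / p) + - sym v (1 / p) + sym u v + sym (u * v) (1 / p)"
    unfolding syms_central[OF s[OF v] units_BA[OF u], symmetric]
    by (simp only: sym_def[of u v] grp)
  also have "\<dots> \<in> syms"
  proof -
    have "sym u v \<in> syms" "sym (u * v) (1 / p) \<in> syms"
      using u v units_BA B.units_mult p_unit by (auto intro!: sym_syms)
    then show ?thesis using s[OF u] s[OF v] unfolding syms_def by (intro sgp.add)
  qed
  finally show ?thesis .
qed

lemma B_syms: "z \<in> B.syms \<Longrightarrow> z \<in> syms"
  unfolding syms_def B.syms_def
  by (rule subsetD[OF sgp_mono]) (use units_BA in auto)

lemma T_syms: "z \<in> T.syms \<Longrightarrow> z \<in> syms"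
proof -
  have "{T.sym u v | u v. u \<in> B.units \<and> v \<in> B.units} \<subseteq> syms" using T_sym by auto
  then show "z \<in> T.syms \<Longrightarrow> z \<in> syms"
    unfolding syms_def T.syms_def using sgp_least by blast
qed

section \<open>The two subgroups of the amalgam, modulo symbols\<close>

definition Z :: "('b \<times> rsl2) set" where "Z = {(z, 0) | z. z \<in> syms}"

lemma Z_sgp: "Z = sgp Z"
proof
  show "Z \<subseteq> sgp Z" by (auto intro: sgp.incl)
  have "g \<in> Z" if "g \<in> sgp Z" for g
    using that
  proof induction
    case zero
    then show ?case by (auto simp: Z_def syms_def zero_prod_def intro: sgp.zero)
  next
    case (add g h)
    then show ?case by (auto simp: Z_def syms_def intro: sgp.add)
  next
    case (neg g)
    then show ?case by (auto simp: Z_def syms_def rsl2_eq_iff intro: sgp.neg)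
  qed
  then show "sgp Z \<subseteq> Z" by blast
qed

definition twisted_gens :: "('b \<times> rsl2) set" where
  "twisted_gens = (\<lambda>(g, M). (g, twist p M)) ` T.gens"

lemma twisted_gens_eq:
  "twisted_gens = {(x (t / p), upper (t / p)) | t. t \<in> B} \<union> {(y (p * t), lower (p * t)) | t. t \<in> B}"
proof -
  have "twist p (upper t) = upper (t / p)" "twist p (lower t) = lower (p * t)" for t
    using p0 by (simp_all add: rsl2_eq_iff)
  then show ?thesis
    unfolding twisted_gens_def T.gens_def x'_def y'_def image_Un by (simp add: setcompr_eq_image image_image)
qed

lemma B_gens_sub: "sgp B.gens \<subseteq> sgp gens"
  using BA by (intro sgp_mono) (auto simp: gens_def B.gens_def)

lemma twisted_gens_sub: "sgp twisted_gens \<subseteq> sgp gens"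
proof (intro sgp_mono)
  have "t / p \<in> A" "p * t \<in> A" if "t \<in> B" for t
    using that BA pB divide_mem[OF _ p_unit(2)] mult_mem[of p t] by auto
  then show "twisted_gens \<subseteq> gens"
    unfolding twisted_gens_eq gens_def by blast
qed

text \<open>\<open>P\<close> and \<open>Q\<close> lie over SL_2(B) and over its conjugate. With all
  symbols over \<open>A\<close> adjoined, the elements with trivial matrix are exactly the symbol
  products in both, so neither can distinguish two lifts of a matrix modulo symbols.\<close>

abbreviation P :: "('b \<times> rsl2) set" where "P \<equiv> sgp (B.gens \<union> Z)"
abbreviation Q :: "('b \<times> rsl2) set" where "Q \<equiv> sgp (twisted_gens \<union> Z)"

lemma Z_central: "z \<in> Z \<Longrightarrow> g \<in> sgp gens \<Longrightarrow> z + g = g + z"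
  by (cases g) (auto simp: Z_def gens_fst_commutes rsl2_eq_iff)

lemma P_decomp: "g \<in> P \<Longrightarrow> \<exists>z\<in>Z. \<exists>g0\<in>sgp B.gens. g = z + g0"
  by (rule sgp_Un_central[OF _ Z_sgp]) (meson B_gens_sub Z_central sgp.incl subsetD)+

lemma Q_decomp: "g \<in> Q \<Longrightarrow> \<exists>z\<in>Z. \<exists>g0\<in>sgp twisted_gens. g = z + g0"
  by (rule sgp_Un_central[OF _ Z_sgp]) (meson twisted_gens_sub Z_central sgp.incl subsetD)+

lemma twisted_untwist: "(g, M) \<in> sgp twisted_gens \<Longrightarrow> \<exists>N. (g, N) \<in> sgp T.gens \<and> M = twist p N"
proof -
  assume "(g, M) \<in> sgp twisted_gens"
  then have "\<exists>q\<in>sgp T.gens. (\<lambda>(g, M). (g, twist p M)) q = (g, M)"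
    unfolding twisted_gens_def by (rule sgp_image_preimage[rotated]) (use p0 in \<open>auto simp: twist_add\<close>)
  then show ?thesis by auto
qed

lemma P_kernel: "(g, 0) \<in> P \<Longrightarrow> g \<in> syms"
proof -
  assume "(g, 0) \<in> P"
  from P_decomp[OF this] obtain z g0 where z: "z \<in> syms" "(g0, 0) \<in> sgp B.gens" "g = z + g0"
    by (auto simp: Z_def)
  have "g0 \<in> syms" using B_syms[OF kernel_B[OF B.steinberg_system_axioms z(2)]] .
  then show ?thesis using z by (auto simp: syms_def intro: sgp.add)
qed

lemma Q_kernel: "(g, 0) \<in> Q \<Longrightarrow> g \<in> syms"
proof -
  assume "(g, 0) \<in> Q"
  from Q_decomp[OF this] obtain z g0 where z: "z \<in> syms" "(g0, 0) \<in> sgp twisted_gens" "g = z + g0"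
    by (auto simp: Z_def)
  from twisted_untwist[OF z(2)] have "(g0, 0) \<in> sgp T.gens" using twist_eq_zero[OF p0] by metis
  from T_syms[OF kernel_B[OF T.steinberg_system_axioms this]] show ?thesis
    using z by (auto simp: syms_def intro: sgp.add)
qed

lemma gens_entries:
  assumes "(g, M) \<in> sgp (steinberg_system.gens B x1 y1)" and "steinberg_system B x1 y1"
  shows "ent_a M \<in> B \<and> ent_b M \<in> B \<and> ent_c M \<in> B \<and> ent_d M \<in> B"
proof -
  have "ent_a (snd q) \<in> B \<and> ent_b (snd q) \<in> B \<and> ent_c (snd q) \<in> B \<and> ent_d (snd q) \<in> B"
    if "q \<in> sgp (steinberg_system.gens B x1 y1)" for q
    using that
  proof induction
    case zero
    then show ?case by (simp add: B.zero_mem B.one_mem)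
  next
    case (incl q)
    then show ?case using steinberg_system.gens_def[OF assms(2)] by (auto simp: B.zero_mem B.one_mem)
  next
    case (add q q')
    then show ?case by (simp add: B.add_mem B.mult_mem)
  next
    case (neg q)
    then show ?case by (simp add: B.uminus_mem)
  qed
  from this[OF assms(1)] show ?thesis by simp
qed

lemma P_entries: "(g, M) \<in> P \<Longrightarrow> ent_a M \<in> B \<and> ent_b M \<in> B \<and> ent_c M \<in> B \<and> ent_d M \<in> B"
proof -
  assume "(g, M) \<in> P"
  from P_decomp[OF this] obtain g0 where "(g0, M) \<in> sgp B.gens"
    by (auto simp: Z_def)
  from gens_entries[OF this B.steinberg_system_axioms] show ?thesis .
qed

lemma Q_entries: "(g, M) \<in> Q \<Longrightarrow> ent_a M \<in> B \<and> p * ent_b M \<in> B \<and> ent_c M / p \<in> B \<and> ent_d M \<in> B"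
proof -
  assume "(g, M) \<in> Q"
  from Q_decomp[OF this] obtain g0 where "(g0, M) \<in> sgp twisted_gens"
    by (auto simp: Z_def)
  then obtain N where "(g0, N) \<in> sgp T.gens" "M = twist p N" using twisted_untwist by blast
  with gens_entries[OF this(1) T.steinberg_system_axioms] p0 show ?thesis by simp
qed

lemma Z_P: "z \<in> syms \<Longrightarrow> (z, 0) \<in> P" and Z_Q: "z \<in> syms \<Longrightarrow> (z, 0) \<in> Q"
  by (auto simp: Z_def intro: sgp.incl)

lemma h_P: "u \<in> B.units \<Longrightarrow> (h u, diagm u) \<in> P"
  using B.h_gens sgp_mono[of B.gens "B.gens \<union> Z"] by blast

text \<open>The conjugate system itself supplies \<open>T.h u\<close>; the correction to
  \<open>h u\<close> is a symbol, which \<open>Q\<close> contains by construction.\<close>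

lemma h_Q: "u \<in> B.units \<Longrightarrow> (h u, diagm u) \<in> Q"
proof -
  assume u: "u \<in> B.units"
  have "(\<lambda>(g, M). (g, twist p M)) (T.h u, diagm u) \<in> sgp twisted_gens"
    unfolding twisted_gens_def
    by (rule sgp_image[OF _ T.h_gens[OF u]]) (use p0 in \<open>auto simp: twist_add\<close>)
  moreover have "twist p (diagm u) = diagm u"
    using p0 by (simp add: rsl2_eq_iff)
  ultimately have "(T.h u, diagm u) \<in> Q" using sgp_mono[of twisted_gens "twisted_gens \<union> Z"] by auto
  moreover have "(sym u (1 / p), 0) \<in> Q"
    using u units_BA p_unit by (intro Z_Q sym_syms)
  ultimately have "(sym u (1 / p), 0) + (T.h u, diagm u) \<in> Q" by (rule sgp.add[rotated])
  then show ?thesis using T_h[OF u] by simp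
qed

text \<open>Each generator of Gamma_0(p) has one lift lying in both subgroups:
  \<open>upper t\<close> is also the twisted generator for p t, \<open>lower (p * t)\<close> is a
  generator over \<open>B\<close>, and the diagonal matrices lift to \<open>h u\<close>. A word in
  the generators inherits this.\<close>

lemma Gamma0_lift:
  assumes "ent_a M \<in> B" "ent_b M \<in> B" "ent_c M / p \<in> B" "ent_d M \<in> B"
  shows "\<exists>g. (g, M) \<in> P \<and> (g, M) \<in> Q"
proof -
  let ?V = "{(x t, upper t) | t. t \<in> B} \<union> {(y (p * t), lower (p * t)) | t. t \<in> B} \<union> {(h u, diagm u) | u. u \<in> B.units}"
  have "snd ` ?V = {upper t | t. t \<in> B} \<union> {lower (p * t) | t. t \<in> B} \<union> {diagm u | u. u \<in> B.units}"
    by force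
  with Gamma0[OF assms] have "M \<in> sgp (snd ` ?V)" by simp
  then obtain q where q: "q \<in> sgp ?V" "snd q = M" using sgp_image_preimage[of snd M ?V] by auto
  have "(y (p * t), lower (p * t)) \<in> P" if "t \<in> B" for t
    using B.mult_mem[OF pB that] unfolding B.gens_def by (intro sgp.incl) blast
  then have "?V \<subseteq> P"
    using h_P by (auto simp: B.gens_def intro: sgp.incl)
  moreover have "(x t, upper t) \<in> Q" if "t \<in> B" for t
  proof -
    have "(x (p * t / p), upper (p * t / p)) \<in> twisted_gens"
      using that pB B.mult_mem unfolding twisted_gens_eq by blast
    then show ?thesis using p0 by (auto intro: sgp.incl)
  qed
  then have "?V \<subseteq> Q"
    using h_Q by (auto simp: twisted_gens_eq intro: sgp.incl)
  ultimately have "q \<in> P" "q \<in> Q"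
    using q(1) sgp_least[of ?V "B.gens \<union> Z"] sgp_least[of ?V "twisted_gens \<union> Z"] by blast+
  with q(2) show ?thesis by (cases q) auto
qed

text \<open>If p divided the lower left entry, the matrix would be in Gamma_0(p) and have a lift
  common to \<open>P\<close> and \<open>Q\<close>. The given element differs from it by an element
  of \<open>P\<close> with trivial matrix, that is by symbols, and so would lie in
  \<open>Q\<close>.\<close>

lemma P_minus_Q: "(g, M) \<in> P \<Longrightarrow> (g, M) \<notin> Q \<Longrightarrow> ent_c M / p \<notin> B"
proof
  assume gP: "(g, M) \<in> P" and gQ: "(g, M) \<notin> Q" and c: "ent_c M / p \<in> B"
  obtain g1 where g1: "(g1, M) \<in> P" "(g1, M) \<in> Q"
    using Gamma0_lift P_entries[OF gP] c by blast
  have "(g, M) - (g1, M) \<in> P" using gP g1 by (intro sgp_diff)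
  then have "g - g1 \<in> syms" by (auto intro: P_kernel)
  then have "(g - g1, 0) + (g1, M) \<in> Q" using g1 by (intro sgp.add Z_Q)
  then show False using gQ by simp
qed

lemma Q_minus_P: "(g, M) \<in> Q \<Longrightarrow> (g, M) \<notin> P \<Longrightarrow> ent_b M \<notin> B"
proof
  assume gQ: "(g, M) \<in> Q" and gP: "(g, M) \<notin> P" and b: "ent_b M \<in> B"
  obtain g1 where g1: "(g1, M) \<in> P" "(g1, M) \<in> Q"
    using Gamma0_lift Q_entries[OF gQ] b by blast
  have "(g, M) - (g1, M) \<in> Q" using gQ g1 by (intro sgp_diff)
  then have "g - g1 \<in> syms" by (auto intro: Q_kernel)
  then have "(g - g1, 0) + (g1, M) \<in> P" using g1 by (intro sgp.add Z_P)
  then show False using gP by simp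
qed

text \<open>
  Ping-pong on the columns \<open>(s, t)\<close>: elements of \<open>P - Q\<close> move \<open>near_first n\<close> into \<open>near_second n\<close>,
  elements of \<open>Q - P\<close> move \<open>near_second n\<close> into \<open>near_first (Suc n)\<close>.
\<close>

definition near_first :: "nat \<Rightarrow> rat \<Rightarrow> rat \<Rightarrow> bool" where
  "near_first n s t \<longleftrightarrow> p ^ n * s \<in> B \<and> p ^ n * s / p \<notin> B \<and> p ^ n * t / p \<in> B"

definition near_second :: "nat \<Rightarrow> rat \<Rightarrow> rat \<Rightarrow> bool" where
  "near_second n s t \<longleftrightarrow> p ^ n * t \<in> B \<and> p ^ n * t / p \<notin> B \<and> p ^ n * s \<in> B"

lemma add_not_divisible:
  assumes "s \<in> B" "t \<in> B" "s / p \<notin> B" "t / p \<notin> B" "r / p \<in> B"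
  shows "(s * t + r) / p \<notin> B"
proof
  assume "(s * t + r) / p \<in> B"
  then have "(s * t + r) / p - r / p \<in> B" using assms by (intro B.diff_mem)
  then have "s * t / p \<in> B" by (simp add: add_divide_distrib)
  then show False using p_prime assms by blast
qed

text \<open>The entry c is prime to p and s has the larger power of p in its denominator, so c s
  dominates d t in the new second coordinate.\<close>

lemma P_pingpong:
  assumes "(g, M) \<in> P" "(g, M) \<notin> Q" "near_first n s t"
  shows "near_second n (ent_a M * s + ent_b M * t) (ent_c M * s + ent_d M * t)"
proof -
  note e = P_entries[OF assms(1)] and c = P_minus_Q[OF assms(1,2)]
  note f = assms(3)[unfolded near_first_def]
  have t: "p ^ n * t \<in> B" using f p0 B.mult_mem[OF pB, of "p ^ n * t / p"] by simp
  have "(ent_c M * (p ^ n * s) + ent_d M * (p ^ n * t)) / p \<notin> B"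
    using e f c B.mult_mem[of "ent_d M" "p ^ n * t / p"] by (intro add_not_divisible) auto
  moreover have "ent_c M * (p ^ n * s) + ent_d M * (p ^ n * t) \<in> B"
    "ent_a M * (p ^ n * s) + ent_b M * (p ^ n * t) \<in> B"
    using e f t by (auto intro!: B.add_mem B.mult_mem)
  ultimately show ?thesis by (simp add: near_second_def algebra_simps)
qed

text \<open>Here p b lies in \<open>B\<close> and is prime to p, so b t puts exactly one more p into
  the denominator of the first coordinate.\<close>

lemma Q_pingpong:
  assumes "(g, M) \<in> Q" "(g, M) \<notin> P" "near_second n s t"
  shows "near_first (Suc n) (ent_a M * s + ent_b M * t) (ent_c M * s + ent_d M * t)"
proof -
  note e = Q_entries[OF assms(1)] and b = Q_minus_P[OF assms(1,2)]
  note f = assms(3)[unfolded near_second_def]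
  have "((p * ent_b M) * (p ^ n * t) + p * (ent_a M * (p ^ n * s))) / p \<notin> B"
    using e f b p0 B.mult_mem by (intro add_not_divisible) auto
  moreover have "(p * ent_b M) * (p ^ n * t) + p * (ent_a M * (p ^ n * s)) \<in> B"
    using e f by (auto intro!: B.add_mem B.mult_mem pB)
  moreover have "ent_c M \<in> B"
    using e p0 B.mult_mem[OF pB, of "ent_c M / p"] by simp
  then have "ent_c M * (p ^ n * s) + ent_d M * (p ^ n * t) \<in> B"
    using e f by (auto intro!: B.add_mem B.mult_mem)
  ultimately show ?thesis using p0 by (simp add: near_first_def algebra_simps)
qed

text \<open>A column of the product is the product applied to (1,0) or (0,1). The last factor
  decides which one is followed: (1,0) is in position for \<open>P\<close>, (0,1) for
  \<open>Q\<close>. The bounds \<open>n \<ge> 1\<close> record that some factor from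
  \<open>Q\<close> has acted; without them the columns of the identity matrix would satisfy the
  conclusion.\<close>

lemma alternating_pingpong:
  "alternating V W q \<Longrightarrow>
    (V = P \<and> W = Q \<longrightarrow> (\<exists>n. near_second n (ent_a (snd q)) (ent_c (snd q))) \<or>
        (\<exists>n\<ge>1. near_second n (ent_b (snd q)) (ent_d (snd q)))) \<and>
    (V = Q \<and> W = P \<longrightarrow> (\<exists>n\<ge>1. near_first n (ent_a (snd q)) (ent_c (snd q))) \<or>
        (\<exists>n\<ge>1. near_first n (ent_b (snd q)) (ent_d (snd q))))"
proof (induction rule: alternating.induct)
  case (single q V W)
  have 1: "near_first 0 1 0" "near_second 0 0 1"
    using p_nonunit by (simp_all add: near_first_def near_second_def B.one_mem B.zero_mem)
  show ?case
  proof (intro conjI impI; elim conjE)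
    assume "V = P" "W = Q"
    with P_pingpong[of "fst q" "snd q", OF _ _ 1(1)] single
    show "(\<exists>n. near_second n (ent_a (snd q)) (ent_c (snd q))) \<or>
        (\<exists>n\<ge>1. near_second n (ent_b (snd q)) (ent_d (snd q)))" by auto
  next
    assume "V = Q" "W = P"
    with Q_pingpong[of "fst q" "snd q", OF _ _ 1(2)] single
    have "near_first (Suc 0) (ent_b (snd q)) (ent_d (snd q))" by simp
    then show "(\<exists>n\<ge>1. near_first n (ent_a (snd q)) (ent_c (snd q))) \<or>
        (\<exists>n\<ge>1. near_first n (ent_b (snd q)) (ent_d (snd q)))" by auto
  qed
next
  case (step q V W r)
  show ?case
  proof (intro conjI impI; elim conjE)
    assume VW: "V = P" "W = Q"
    with step.IH consider n where "n \<ge> 1" "near_first n (ent_a (snd r)) (ent_c (snd r))"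
      | n where "n \<ge> 1" "near_first n (ent_b (snd r)) (ent_d (snd r))" by blast
    then show "(\<exists>n. near_second n (ent_a (snd (q + r))) (ent_c (snd (q + r)))) \<or>
        (\<exists>n\<ge>1. near_second n (ent_b (snd (q + r))) (ent_d (snd (q + r))))"
      by cases (use P_pingpong[of "fst q" "snd q"] step.hyps VW in \<open>force+\<close>)
  next
    assume VW: "V = Q" "W = P"
    with step.IH consider n where "near_second n (ent_a (snd r)) (ent_c (snd r))"
      | n where "n \<ge> 1" "near_second n (ent_b (snd r)) (ent_d (snd r))" by blast
    then show "(\<exists>n\<ge>1. near_first n (ent_a (snd (q + r))) (ent_c (snd (q + r)))) \<or>
        (\<exists>n\<ge>1. near_first n (ent_b (snd (q + r))) (ent_d (snd (q + r))))"
    proof cases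
      case (1 n)
      then have "near_first (Suc n) (ent_a (snd (q + r))) (ent_c (snd (q + r)))"
        using Q_pingpong[of "fst q" "snd q"] step.hyps VW by simp
      then show ?thesis by (intro disjI1 exI[of _ "Suc n"]) simp
    next
      case (2 n)
      then have "near_first (Suc n) (ent_b (snd (q + r))) (ent_d (snd (q + r)))"
        using Q_pingpong[of "fst q" "snd q"] step.hyps VW by simp
      then show ?thesis by (intro disjI2 exI[of _ "Suc n"]) simp
    qed
  qed
qed

lemma not_alternating: "\<not> alternating P Q (g, 0)" "\<not> alternating Q P (g, 0)"
proof -
  have *: "p ^ n / p \<in> B" if "n \<ge> 1" for n
  proof -
    from that obtain m where "n = Suc m" by (cases n) auto
    then show ?thesis using p0 pB by (simp add: B.power_mem)
  qed
  show "\<not> alternating P Q (g, 0)"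
  proof
    assume "alternating P Q (g, 0)"
    from mp[OF conjunct1[OF alternating_pingpong[OF this]] conjI[OF HOL.refl HOL.refl]] show False
      using * by (auto simp: near_second_def B.zero_mem)
  qed
  show "\<not> alternating Q P (g, 0)"
  proof
    assume "alternating Q P (g, 0)"
    from mp[OF conjunct2[OF alternating_pingpong[OF this]] conjI[OF HOL.refl HOL.refl]] show False
      using * by (auto simp: near_first_def B.zero_mem)
  qed
qed

text \<open>w(1/p) is a word in the twisted generators and w(-1) one over \<open>B\<close>, so
  h(1/p) is in the group generated by both. Conjugation by h(1/p) or its inverse divides the
  argument of x or y by p^2, which reaches every power of p in the denominator; hence the even
  exponents.\<close>

lemma gens_span: "sgp gens \<subseteq> sgp (P \<union> Q)"
proof (rule sgp_least)
  let ?G = "sgp (P \<union> Q)"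
  have P: "q \<in> P \<Longrightarrow> q \<in> ?G" and Q: "q \<in> Q \<Longrightarrow> q \<in> ?G" for q by (auto intro: sgp.incl)
  have wp: "(w (1 / p), upper (1 / p) + lower (- p) + upper (1 / p)) \<in> ?G"
  proof -
    have "(x (1 / p), upper (1 / p)) \<in> Q"
      using B.one_mem unfolding twisted_gens_eq by (intro sgp.incl) blast
    moreover have "(y (- p), lower (- p)) \<in> Q"
    proof -
      have "(y (p * (- 1)), lower (p * (- 1))) \<in> twisted_gens"
        using B.one_mem B.uminus_mem unfolding twisted_gens_eq by blast
      then show ?thesis by (auto intro: sgp.incl)
    qed
    ultimately have "(x (1 / p), upper (1 / p)) + (y (- p), lower (- p)) + (x (1 / p), upper (1 / p)) \<in> Q"
      by (intro sgp.add)
    then show ?thesis by (intro Q) (simp add: w_def)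
  qed
  have w1: "(w (- 1), upper (- 1) + lower 1 + upper (- 1)) \<in> ?G"
  proof -
    have "(x (- 1), upper (- 1)) + (y 1, lower 1) + (x (- 1), upper (- 1)) \<in> P"
      by (intro sgp.add) (auto intro!: sgp.incl B.uminus_mem B.one_mem simp: B.gens_def)
    then show ?thesis by (intro P) (simp add: w_def)
  qed
  have h: "(h (1 / p), diagm (1 / p)) \<in> ?G"
  proof -
    have "(upper (1 / p) + lower (- p) + upper (1 / p)) + (upper (- 1) + lower 1 + upper (- 1)) = diagm (1 / p)"
      using p0 by (simp add: rsl2_eq_iff)
    then show ?thesis using sgp.add[OF wp w1] by (simp add: h_def)
  qed
  have X: "(x t, upper t) \<in> ?G" if "p ^ (2 * k) * t \<in> B" "t \<in> A" for k t
    using that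
  proof (induction k arbitrary: t)
    case 0
    then show ?case by (intro P sgp.incl) (auto simp: B.gens_def)
  next
    case (Suc k)
    have tA: "p\<^sup>2 * t \<in> A" using Suc.prems BA pB by (auto intro!: mult_mem power_mem)
    have "(x (p\<^sup>2 * t), upper (p\<^sup>2 * t)) \<in> ?G"
      using Suc.prems by (intro Suc.IH tA) (simp add: power2_eq_square algebra_simps)
    then have "(h (1 / p), diagm (1 / p)) + (x (p\<^sup>2 * t), upper (p\<^sup>2 * t)) - (h (1 / p), diagm (1 / p)) \<in> ?G"
      using h by (intro sgp_diff sgp.add)
    moreover have "h (1 / p) + x (p\<^sup>2 * t) - h (1 / p) = x t"
      using h_x[OF p_unit(1) tA] p0 by (simp add: power_divide)
    moreover have "diagm (1 / p) + upper (p\<^sup>2 * t) - diagm (1 / p) = upper t"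
      using p0 by (simp add: rsl2_eq_iff power2_eq_square)
    ultimately show ?case by simp
  qed
  have Y: "(y t, lower t) \<in> ?G" if "p ^ (2 * k) * t \<in> B" "t \<in> A" for k t
    using that
  proof (induction k arbitrary: t)
    case 0
    then show ?case by (intro P sgp.incl) (auto simp: B.gens_def)
  next
    case (Suc k)
    have tA: "t * p\<^sup>2 \<in> A" using Suc.prems BA pB by (auto intro!: mult_mem power_mem)
    have "(y (t * p\<^sup>2), lower (t * p\<^sup>2)) \<in> ?G"
      using Suc.prems by (intro Suc.IH tA) (simp add: power2_eq_square algebra_simps)
    then have "- (h (1 / p), diagm (1 / p)) + (y (t * p\<^sup>2), lower (t * p\<^sup>2)) + (h (1 / p), diagm (1 / p)) \<in> ?G"
      using h by (intro sgp.neg sgp.add)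
    moreover have "- h (1 / p) + y (t * p\<^sup>2) + h (1 / p) = y t"
      using h_neg_y[OF p_unit(1) tA] p0 by (simp add: power_divide add.assoc)
    moreover have "- diagm (1 / p) + lower (t * p\<^sup>2) + diagm (1 / p) = lower t"
      using p0 by (simp add: rsl2_eq_iff power2_eq_square)
    ultimately show ?case by simp
  qed
  have "\<exists>k. p ^ (2 * k) * t \<in> B" if "t \<in> A" for t
  proof -
    obtain k where k: "p ^ k * t \<in> B" using A_denom \<open>t \<in> A\<close> by blast
    then have "p ^ k * (p ^ k * t) \<in> B" by (rule B.mult_mem[OF B.power_mem[OF pB]])
    then show ?thesis by (intro exI[of _ k]) (simp add: mult_2 power_add mult.assoc)
  qed
  then show "gens \<subseteq> ?G" using X Y by (fastforce simp: gens_def)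
qed

text \<open>With trivial matrix no alternating form is possible, which leaves the intersection of
  \<open>P\<close> and \<open>Q\<close>; there the induction hypothesis over \<open>B\<close>
  applies.\<close>

theorem kernel_symbols: "(g, 0) \<in> sgp gens \<Longrightarrow> g \<in> syms"
  using gens_span alternating_span[of "(g, 0)" "B.gens \<union> Z" "twisted_gens \<union> Z"] not_alternating P_kernel by blast

end

subsection \<open>\<open>S\<close>-integers\<close>

definition smooth :: "nat set \<Rightarrow> nat \<Rightarrow> bool" where
  "smooth S m \<longleftrightarrow> m > 0 \<and> (\<forall>p. prime p \<longrightarrow> p dvd m \<longrightarrow> p \<in> S)"

text \<open>Explicit fractions, so that divisibility by a prime outside \<open>S\<close> can be read
  off the numerator. For a set of primes this is \<open>Z_loc S\<close>.\<close>

definition S_integers :: "nat set \<Rightarrow> rat set" where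
  "S_integers S = {of_int a / of_nat m | a m. smooth S m}"

lemma smooth_one: "smooth S 1"
  by (auto simp: smooth_def)

lemma smooth_mult: "smooth S m \<Longrightarrow> smooth S n \<Longrightarrow> smooth S (m * n)"
  by (auto simp: smooth_def prime_dvd_mult_iff)

lemma smooth_mono: "S \<subseteq> T \<Longrightarrow> smooth S m \<Longrightarrow> smooth T m"
  by (auto simp: smooth_def)

lemma smooth_pos: "smooth S m \<Longrightarrow> m > 0"
  by (simp add: smooth_def)

lemma S_integersI: "smooth S m \<Longrightarrow> of_int a / of_nat m \<in> S_integers S"
  by (auto simp: S_integers_def)

interpretation S_int: rat_subring "S_integers S" for S
proof
  show "1 \<in> S_integers S" using S_integersI[OF smooth_one, of 1 S] by simp
  fix s t assume "s \<in> S_integers S" "t \<in> S_integers S"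
  then obtain a m b n where st: "s = of_int a / of_nat m" "smooth S m" "t = of_int b / of_nat n" "smooth S n"
    by (auto simp: S_integers_def)
  then have "m > 0" "n > 0" using smooth_pos by auto
  then have "s - t = of_int (a * int n - b * int m) / of_nat (m * n)" "s * t = of_int (a * b) / of_nat (m * n)"
    unfolding st(1,3) by (simp_all add: field_simps)
  then show "s - t \<in> S_integers S" "s * t \<in> S_integers S"
    using st by (metis S_integersI smooth_mult)+
qed

lemma S_integers_mono: "S \<subseteq> T \<Longrightarrow> S_integers S \<subseteq> S_integers T"
  by (auto simp: S_integers_def intro: smooth_mono)

lemma S_integers_empty: "S_integers {} = \<int>"
proof -
  have "m = 1" if "smooth {} m" for m
    using that prime_factor_nat[of m] by (auto simp: smooth_def)
  then have "t \<in> \<int>" if "t \<in> S_integers {}" for t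
    using that by (force simp: S_integers_def)
  moreover have "t \<in> S_integers {}" if "t \<in> \<int>" for t
    using that S_integersI[OF smooth_one] by (elim Ints_cases) force
  ultimately show ?thesis by blast
qed

lemma smooth_unit: "smooth S m \<Longrightarrow> of_nat m \<in> S_int.units S"
  using S_integersI[of S m 1] S_int.nat_mem[of m S] by (auto simp: S_int.units_def dest: smooth_pos)

lemma S_integers_divide_iff:
  assumes p: "prime p" "p \<notin> S" and m: "smooth S m"
  shows "of_int a / of_nat m / of_nat p \<in> S_integers S \<longleftrightarrow> int p dvd a"
proof
  assume "of_int a / of_nat m / of_nat p \<in> S_integers S"
  then obtain b n where bn: "(of_int a / of_nat m / of_nat p :: rat) = of_int b / of_nat n" "smooth S n"
    by (auto simp: S_integers_def)
  have pos: "m > 0" "n > 0" "p > 0" using m bn p smooth_pos prime_gt_0_nat by auto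
  have "(of_int (a * int n) :: rat) = of_int (b * (int m * int p))"
    using bn(1) pos by (simp add: field_simps)
  then have "a * int n = b * (int m * int p)" by (simp only: of_int_eq_iff)
  then have "int p dvd a * int n" by simp
  moreover have "\<not> int p dvd int n" using bn(2) p by (auto simp: smooth_def)
  ultimately show "int p dvd a" using p by (simp add: prime_dvd_mult_iff)
next
  assume "int p dvd a"
  then obtain b where "a = int p * b" by auto
  then show "of_int a / of_nat m / of_nat p \<in> S_integers S"
    using S_integersI[OF m, of b] p prime_gt_0_nat[of p] by (simp add: field_simps)
qed

lemma S_integers_prime:
  assumes p: "prime p" "p \<notin> S" and st: "s \<in> S_integers S" "t \<in> S_integers S" "s * t / of_nat p \<in> S_integers S"
  shows "s / of_nat p \<in> S_integers S \<or> t / of_nat p \<in> S_integers S"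
proof -
  obtain a m b n where *: "s = of_int a / of_nat m" "smooth S m" "t = of_int b / of_nat n" "smooth S n"
    using st by (auto simp: S_integers_def)
  then have "of_int (a * b) / of_nat (m * n) / of_nat p \<in> S_integers S" using st(3) by simp
  then have "int p dvd a * b" using S_integers_divide_iff[OF p smooth_mult] * by blast
  then have "int p dvd a \<or> int p dvd b" using p by (simp add: prime_dvd_mult_iff)
  then show ?thesis using S_integers_divide_iff[OF p] * by blast
qed

lemma S_integers_prime_nonunit:
  assumes p: "prime p" "p \<notin> S" shows "1 / of_nat p \<notin> S_integers S"
  using S_integers_divide_iff[OF p smooth_one, of 1] p prime_gt_1_nat[of p] by auto

lemma S_integers_insert_denom:
  assumes p: "prime p" and t: "t \<in> S_integers (insert p S)"
  shows "\<exists>k. of_nat p ^ k * t \<in> S_integers S"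
proof -
  obtain a m where am: "t = of_int a / of_nat m" "smooth (insert p S) m" using t by (auto simp: S_integers_def)
  have "m \<noteq> 0" "\<not> is_unit p" using am p smooth_pos by auto
  then obtain n where n: "m = p ^ multiplicity p m * n" "\<not> p dvd n"
    by (metis multiplicity_decompose')
  have "smooth S n"
    unfolding smooth_def
  proof (intro conjI allI impI)
    show "n > 0" using n \<open>m \<noteq> 0\<close> by (cases n) auto
    fix q assume "prime q" "q dvd n"
    then have "q dvd m" using n(1) by (metis dvd_mult)
    then show "q \<in> S" using am(2) \<open>prime q\<close> \<open>q dvd n\<close> n(2) by (auto simp: smooth_def)
  qed
  moreover have "of_nat p ^ multiplicity p m * t = of_int a / of_nat n"
  proof -
    have "(of_nat m :: rat) = of_nat p ^ multiplicity p m * of_nat n"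
      by (subst n(1)) simp
    then show ?thesis using am p prime_gt_0_nat[of p] by simp
  qed
  ultimately show ?thesis using S_integersI by metis
qed

lemma Z_loc_eq:
  assumes "\<And>p. p \<in> S \<Longrightarrow> prime p"
  shows "Z_loc S = S_integers S"
proof -
  let ?R = "ring_of_type_algebra :: rat ring"
  let ?H = "{1 / of_nat p | p. p \<in> S} :: rat set"
  interpret R: ring ?R by (rule ring_from_type_algebra)
  have R: "carrier ?R = UNIV" "\<one>\<^bsub>?R\<^esub> = 1" "\<And>a b. a \<oplus>\<^bsub>?R\<^esub> b = a + b" "\<And>a b. a \<otimes>\<^bsub>?R\<^esub> b = a * b" "\<zero>\<^bsub>?R\<^esub> = 0"
    by (simp_all add: ring_of_type_algebra_def)
  have inv: "\<ominus>\<^bsub>?R\<^esub> a = - a" for a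
    using R.minus_equality[of "- a" a] R by simp
  show ?thesis
  proof
    show "Z_loc S \<subseteq> S_integers S"
    proof
      fix t assume "t \<in> Z_loc S"
      then show "t \<in> S_integers S"
        unfolding Z_loc_def
      proof induction
        case (incl h)
        then obtain p where p: "h = 1 / of_nat p" "p \<in> S" by auto
        have "smooth S p" using assms[OF p(2)] p(2) prime_gt_0_nat
          by (auto simp: smooth_def dest: primes_dvd_imp_eq)
        then show ?case using S_integersI[of S p 1] p by simp
      qed (simp_all add: R inv S_int.one_mem S_int.uminus_mem S_int.add_mem S_int.mult_mem)
    qed
    interpret Z: rat_subring "Z_loc S"
    proof
      show "1 \<in> Z_loc S" using generate_ring.one[of ?R ?H] by (simp add: Z_loc_def R)
      show "s - t \<in> Z_loc S" if "s \<in> Z_loc S" "t \<in> Z_loc S" for s t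
        using that generate_ring.eng_add[of s ?R ?H "- t"] generate_ring.a_inv[of t ?R ?H]
        by (simp add: Z_loc_def R inv)
      show "s * t \<in> Z_loc S" if "s \<in> Z_loc S" "t \<in> Z_loc S" for s t
        using that generate_ring.eng_mult[of s ?R ?H t] by (simp add: Z_loc_def R)
    qed
    have inc: "1 / of_nat p \<in> Z_loc S" if "p \<in> S" for p
      using that by (auto simp: Z_loc_def intro: generate_ring.incl)
    have "1 / of_nat m \<in> Z_loc S" if "smooth S m" for m
      using that
    proof (induction m rule: less_induct)
      case (less m)
      show ?case
      proof (cases "m = 1")
        case True
        then show ?thesis by (simp add: Z.one_mem)
      next
        case False
        then obtain p where p: "prime p" "p dvd m" using prime_factor_nat by blast
        then obtain n where n: "m = p * n" by auto
        have "p \<in> S" using less.prems p by (auto simp: smooth_def)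
        have n0: "n > 0" using less.prems n by (auto simp: smooth_def)
        then have "n < m" using n p prime_gt_1_nat[of p] by simp
        moreover have "smooth S n" using less.prems n n0 by (auto simp: smooth_def)
        ultimately have "1 / of_nat n \<in> Z_loc S" using less.IH by blast
        from Z.mult_mem[OF inc[OF \<open>p \<in> S\<close>] this] show ?thesis by (simp add: n)
      qed
    qed
    then show "S_integers S \<subseteq> Z_loc S"
      using Z.mult_mem[OF Z.int_mem] by (fastforce simp: S_integers_def)
  qed
qed

subsection \<open>A two-step Euclidean algorithm\<close>

text \<open>Pigeonhole: [0, D) is cut into K + 1 intervals, and \<open>f j\<close> is the one
  containing the remainder of j a. Either some remainder lies in the first or the last interval, or
  the K remainders share K - 1 intervals and the difference of two indices serves as multiplier. The
  point is that the multiplier is at most K, hence a unit in the application.\<close>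

lemma dirichlet_int:
  fixes a D :: int and K :: nat
  assumes D: "D > 0" and K: "K \<ge> 1"
  shows "\<exists>j\<in>{1..K}. \<exists>q. \<bar>int j * a - q * D\<bar> * (int K + 1) \<le> D"
proof -
  define r where "r j = (int j * a) mod D" for j
  define f where "f j = (r j * (int K + 1)) div D" for j
  have r: "0 \<le> r j" "r j < D" for j using D by (simp_all add: r_def)
  have rq: "int j * a - (int j * a) div D * D = r j" for j
    by (simp add: r_def minus_div_mult_eq_mod)
  have f: "f j * D \<le> r j * (int K + 1)" "r j * (int K + 1) < f j * D + D" for j
    using div_mult_mod_eq[of "r j * (int K + 1)" D]
      pos_mod_bound[OF D, of "r j * (int K + 1)"] pos_mod_sign[OF D, of "r j * (int K + 1)"]
    unfolding f_def by linarith+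
  have f0: "0 \<le> f j" for j using r[of j] D by (simp add: f_def pos_imp_zdiv_nonneg_iff)
  have fK: "f j \<le> int K" for j
  proof -
    have "r j * (int K + 1) < D * (int K + 1)" using r by simp
    then have "f j * D < (int K + 1) * D" using f(1)[of j] by (metis le_less_trans mult.commute)
    then show ?thesis using D by simp
  qed
  consider j where "j \<in> {1..K}" "f j = 0" | j where "j \<in> {1..K}" "f j = int K"
    | "\<And>j. j \<in> {1..K} \<Longrightarrow> f j \<noteq> 0 \<and> f j \<noteq> int K" by blast
  then show ?thesis
  proof cases
    case (1 j)
    then have "\<bar>r j\<bar> * (int K + 1) \<le> D" using f(2)[of j] r[of j] by simp
    then show ?thesis using 1 rq[of j] by metis
  next
    case (2 j)
    have "(D - r j) * (int K + 1) \<le> D" using f(1)[of j] 2 by (simp add: algebra_simps)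
    moreover have "\<bar>int j * a - ((int j * a) div D + 1) * D\<bar> = D - r j"
      using rq[of j] r[of j] by (simp add: algebra_simps)
    ultimately show ?thesis using 2 by metis
  next
    case 3
    have "f ` {1..K} \<subseteq> {1..int K - 1}"
    proof (intro image_subsetI)
      fix j assume "j \<in> {1..K}"
      with 3 f0[of j] fK[of j] show "f j \<in> {1..int K - 1}" by force
    qed
    then have "card (f ` {1..K}) \<le> card {1..int K - 1}" by (intro card_mono) auto
    also have "\<dots> < card {1..K}" using K by simp
    finally have "\<not> inj_on f {1..K}" by (rule pigeonhole)
    then obtain i j where "i \<in> {1..K}" "j \<in> {1..K}" "f i = f j" "i \<noteq> j" by (auto simp: inj_on_def)
    then obtain i j where ij: "i \<in> {1..K}" "j \<in> {1..K}" "f i = f j" "i < j"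
      by (metis linorder_neqE_nat)
    have "\<bar>r j - r i\<bar> * (int K + 1) = \<bar>r j * (int K + 1) - r i * (int K + 1)\<bar>"
      by (simp add: abs_mult left_diff_distrib[symmetric])
    also have "\<dots> \<le> D" using f[of i] f[of j] unfolding ij(3) by linarith
    finally have "\<bar>r j - r i\<bar> * (int K + 1) \<le> D" .
    moreover have "int (j - i) * a - ((int j * a) div D - (int i * a) div D) * D = r j - r i"
      using rq[of i] rq[of j] ij by (simp add: of_nat_diff algebra_simps)
    ultimately show ?thesis using ij by (intro bexI[of _ "j - i"]) (metis, auto)
  qed
qed

lemma dirichlet_int':
  fixes a D :: int and K :: nat
  assumes D: "D \<noteq> 0" and K: "K \<ge> 1"
  shows "\<exists>j\<in>{1..K}. \<exists>q. \<bar>int j * a - q * D\<bar> * (int K + 1) \<le> \<bar>D\<bar>"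
proof -
  obtain j q where "j \<in> {1..K}" "\<bar>int j * a - q * \<bar>D\<bar>\<bar> * (int K + 1) \<le> \<bar>D\<bar>"
    using dirichlet_int[of "\<bar>D\<bar>" K a] D K by auto
  then show ?thesis by (intro bexI[of _ j] exI[of _ "q * sgn D"]) (simp_all add: mult.assoc abs_sgn[symmetric] mult.commute[of "sgn D"])
qed

lemma sgp_cancel_left: "g \<in> sgp V \<Longrightarrow> g + h \<in> sgp V \<Longrightarrow> h \<in> sgp V"
  by (metis minus_add_cancel sgp.add sgp.neg)

text \<open>
  Writing the first column as \<open>(a\<^sub>1 / m, p k)\<close>, two divisions with multipliers at most \<open>K\<close>,
  each gaining a factor \<open>K + 1\<close>, make up for the loss of the factor \<open>p\<close>.
\<close>

lemma Gamma0_generated: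
  fixes p K :: nat
  assumes K: "K \<ge> 1" "\<And>j. j \<in> {1..K} \<Longrightarrow> smooth S j" and p: "p > 0" "p < (K + 1)\<^sup>2"
    and p1: "p = 1 \<or> 1 / of_nat p \<notin> S_integers S"
    and M: "ent_a M \<in> S_integers S" "ent_b M \<in> S_integers S" "ent_c M / of_nat p \<in> S_integers S" "ent_d M \<in> S_integers S"
  shows "M \<in> sgp ({upper t | t. t \<in> S_integers S} \<union> {lower (of_nat p * t) | t. t \<in> S_integers S} \<union>
    {diagm u | u. u \<in> S_int.units S})" (is "_ \<in> sgp ?V")
proof -
  let ?B = "S_integers S"
  define \<Gamma> where "\<Gamma> M \<longleftrightarrow> ent_a M \<in> ?B \<and> ent_b M \<in> ?B \<and> ent_c M / of_nat p \<in> ?B \<and> ent_d M \<in> ?B" for M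
  have up: "upper t \<in> sgp ?V" and lo: "lower (of_nat p * t) \<in> sgp ?V" if "t \<in> ?B" for t
    using that by (auto intro: sgp.incl)
  have di: "diagm u \<in> sgp ?V" if "u \<in> S_int.units S" for u
    using that by (auto intro: sgp.incl)
  have pB: "of_nat p \<in> ?B" by (rule S_int.nat_mem)
  have c_mem: "ent_c M \<in> ?B" if "\<Gamma> M" for M
    using that S_int.mult_mem[OF pB, of "ent_c M / of_nat p"] p by (simp add: \<Gamma>_def)
  have \<Gamma>up: "\<Gamma> (upper t + M)" if "\<Gamma> M" "t \<in> ?B" for M t
    using that c_mem[OF that(1)] by (auto simp: \<Gamma>_def intro!: S_int.add_mem S_int.mult_mem)
  have \<Gamma>lo: "\<Gamma> (lower (of_nat p * t) + M)" if "\<Gamma> M" "t \<in> ?B" for M t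
    using that p pB by (auto simp: \<Gamma>_def add_divide_distrib intro!: S_int.add_mem S_int.mult_mem)
  have \<Gamma>di: "\<Gamma> (diagm u + M)" if "\<Gamma> M" "u \<in> S_int.units S" for M u
    using that S_int.unitsD[OF that(2)] S_int.mult_mem[of "1 / u" S "ent_c M / of_nat p"] S_int.mult_mem[of "1 / u" S "ent_d M"]
    by (auto simp: \<Gamma>_def mult.commute intro!: S_int.mult_mem)
  have c0: "M \<in> sgp ?V" if "\<Gamma> M" "ent_c M = 0" for M
  proof -
    have ad: "ent_a M * ent_d M = 1" using rsl2_det[of M] that by simp
    then have d: "ent_a M \<noteq> 0" by auto
    with ad have d': "ent_d M = 1 / ent_a M" by (simp add: field_simps)
    have "1 / ent_a M \<in> ?B" unfolding d'[symmetric] using that by (simp add: \<Gamma>_def)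
    then have u: "ent_a M \<in> S_int.units S" using that d by (auto simp: \<Gamma>_def S_int.units_def)
    have b: "ent_b M * ent_d M \<in> ?B" using that by (auto simp: \<Gamma>_def intro: S_int.mult_mem)
    have "diagm (ent_a M) + upper (ent_b M * ent_d M) = M"
      using that d d' by (simp add: rsl2_eq_iff)
    with sgp.add[OF di[OF u] up[OF b]] show ?thesis by simp
  qed
  \<comment> \<open>The lower left entry is split as p times a unit times an integer k, and |k|
    decreases. Denominators and multipliers go into the unit, which keeps k integral.\<close>
  have main: "M \<in> sgp ?V" if "\<Gamma> M" "u \<in> S_int.units S" "ent_c M = of_nat p * u * of_int k" "nat \<bar>k\<bar> = n" for n k u M
    using that
  proof (induction n arbitrary: M u k rule: less_induct)
    case (less n M u k)
    show ?case
    proof (cases "k = 0")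
      case True
      then show ?thesis using less.prems c0 by simp
    next
      case k0: False
      have u0: "u \<noteq> 0" using less.prems(2) by (simp add: S_int.units_def)
      \<comment> \<open>diag(u, 1/u) divides the lower left entry by u and leaves p k.\<close>
      define N where "N = diagm u + M"
      have \<Gamma>N: "\<Gamma> N" using \<Gamma>di less.prems by (simp add: N_def)
      have cN: "ent_c N = of_nat p * of_int k" using less.prems u0 by (simp add: N_def)
      have "ent_a N \<in> ?B" using \<Gamma>N by (simp add: \<Gamma>_def)
      then obtain a1 m where a1: "ent_a N = of_int a1 / of_nat m" and m: "smooth S m"
        by (auto simp: S_integers_def)
      have m0: "m > 0" using m smooth_pos by blast
      have "int p * k \<noteq> 0" using p k0 by simp
      from dirichlet_int'[OF this K(1), of a1] obtain j q where j: "j \<in> {1..K}"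
        and q: "\<bar>int j * a1 - q * (int p * k)\<bar> * (int K + 1) \<le> \<bar>int p * k\<bar>" by blast
      define r where "r = int j * a1 - q * (int p * k)"
      have jm: "smooth S (j * m)" using smooth_mult K(2)[OF j] m by blast
      have j0: "j > 0" using j by simp
      \<comment> \<open>First division: the upper left entry a1 / m becomes r / (j m) with |r| at
        most p |k| / (K + 1).\<close>
      define N2 where "N2 = upper (of_int (- q) / of_nat (j * m)) + N"
      have \<Gamma>N2: "\<Gamma> N2" unfolding N2_def by (intro \<Gamma>up \<Gamma>N S_integersI jm)
      have cN2: "ent_c N2 = of_nat p * of_int k" by (simp add: N2_def cN)
      have aN2: "ent_a N2 = of_int r / of_nat (j * m)"
        using j0 m0 by (simp add: N2_def a1 cN r_def field_simps)
      have "N2 \<in> sgp ?V"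
      proof (cases "r = 0")
        case True
        \<comment> \<open>A vanishing upper left entry makes p invertible, which leaves p = 1, the
          case used for SL_2 itself. Then the column (0, k) is taken to (k, k) and on to (k,
          0).\<close>
        have det: "- ent_b N2 * (of_nat p * of_int k) = 1"
          using rsl2_det[of N2] aN2 cN2 True by simp
        have "p = 1"
        proof (rule ccontr)
          assume "p \<noteq> 1"
          have "1 / of_nat p = - ent_b N2 * of_int k"
            using det p by (simp add: field_simps)
          moreover have "\<dots> \<in> ?B"
            using \<Gamma>N2 by (intro S_int.mult_mem S_int.uminus_mem S_int.int_mem) (simp add: \<Gamma>_def)
          ultimately show False using p1 \<open>p \<noteq> 1\<close> by simp
        qed
        define N3 where "N3 = upper 1 + N2"
        have "\<Gamma> N3" unfolding N3_def by (intro \<Gamma>up \<Gamma>N2 S_int.one_mem)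
        then have "\<Gamma> (lower (of_nat p * (- 1)) + N3)"
          by (intro \<Gamma>lo S_int.uminus_mem S_int.one_mem)
        moreover have "ent_c (lower (of_nat p * (- 1)) + N3) = 0"
          using aN2 True cN2 \<open>p = 1\<close> by (simp add: N3_def)
        ultimately have "lower (of_nat p * (- 1)) + N3 \<in> sgp ?V" by (rule c0)
        then have "N3 \<in> sgp ?V"
          by (rule sgp_cancel_left[rotated]) (intro lo S_int.uminus_mem S_int.one_mem)
        then show ?thesis
          unfolding N3_def by (rule sgp_cancel_left[rotated]) (intro up S_int.one_mem)
      next
        case r0: False
        from dirichlet_int'[OF this K(1), of k] obtain j' q' where j': "j' \<in> {1..K}"
          and q': "\<bar>int j' * k - q' * r\<bar> * (int K + 1) \<le> \<bar>r\<bar>" by blast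
        define k' where "k' = int j' * k - q' * r"
        have j'0: "j' > 0" using j' by simp
        have j'u: "of_nat j' \<in> S_int.units S" using K(2)[OF j'] by (rule smooth_unit)
        \<comment> \<open>Second division: with this \<open>s\<close> the lower left entry p k turns
          into p k' / j', since the upper left entry is r / (j m).\<close>
        define s where "s = of_int (- q' * int (j * m)) / (of_nat j' :: rat)"
        have sB: "s \<in> ?B" unfolding s_def by (intro S_integersI K(2) j')
        define N3 where "N3 = lower (of_nat p * s) + N2"
        have "\<Gamma> N3" unfolding N3_def by (intro \<Gamma>lo \<Gamma>N2 sB)
        moreover have "1 / of_nat j' \<in> S_int.units S" using j'u by (rule S_int.units_inverse)
        moreover have "ent_c N3 = of_nat p * (1 / of_nat j') * of_int k'"
          using j0 m0 j'0 by (simp add: N3_def aN2 cN2 s_def k'_def field_simps)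
        moreover have "nat \<bar>k'\<bar> < n"
        proof -
          have "\<bar>k'\<bar> * (int K + 1) * (int K + 1) \<le> \<bar>r\<bar> * (int K + 1)"
            using q' by (intro mult_right_mono) (simp_all add: k'_def)
          also have "\<dots> \<le> int p * \<bar>k\<bar>" using q by (simp add: r_def abs_mult)
          also have "\<dots> < (int K + 1)\<^sup>2 * \<bar>k\<bar>"
          proof (rule mult_strict_right_mono)
            have "int p < int ((K + 1)\<^sup>2)" using p(2) by (simp only: of_nat_less_iff)
            then show "int p < (int K + 1)\<^sup>2" by (simp add: add.commute)
          qed (use k0 in simp)
          finally have "(int K + 1)\<^sup>2 * \<bar>k'\<bar> < (int K + 1)\<^sup>2 * \<bar>k\<bar>"
            by (simp add: power2_eq_square mult.commute mult.left_commute)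
          then have "\<bar>k'\<bar> < \<bar>k\<bar>" by (rule mult_left_less_imp_less) simp
          then show ?thesis using less.prems(4) by simp
        qed
        ultimately have "N3 \<in> sgp ?V" using less.IH by blast
        then show ?thesis
          unfolding N3_def by (rule sgp_cancel_left[rotated]) (intro lo sB)
      qed
      then have "N \<in> sgp ?V"
        unfolding N2_def by (rule sgp_cancel_left[rotated]) (intro up S_integersI jm)
      then show ?thesis
        unfolding N_def by (rule sgp_cancel_left[rotated]) (intro di less.prems(2))
    qed
  qed
  obtain k m where km: "ent_c M / of_nat p = of_int k / of_nat m" "smooth S m"
    using M(3) by (auto simp: S_integers_def)
  have "ent_c M = of_nat p * (1 / of_nat m) * of_int k"
    using km(1) p by (simp add: field_simps)
  moreover have "1 / of_nat m \<in> S_int.units S" using smooth_unit[OF km(2)] by (rule S_int.units_inverse)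
  moreover have "\<Gamma> M" using M by (simp add: \<Gamma>_def)
  ultimately show ?thesis using main by blast
qed

subsection \<open>Admissible sets of primes\<close>

text \<open>Records an order in which the primes can be adjoined; the bound \<open>K\<close> may
  differ from prime to prime, as more and more numbers become invertible.\<close>

inductive admissible :: "nat set \<Rightarrow> bool" where
  empty: "admissible {}"
| insert: "admissible S \<Longrightarrow> prime p \<Longrightarrow> p \<notin> S \<Longrightarrow> K \<ge> 1 \<Longrightarrow> (\<And>j. j \<in> {1..K} \<Longrightarrow> smooth S j) \<Longrightarrow>
    p < (K + 1)\<^sup>2 \<Longrightarrow> admissible (insert p S)"

lemma admissible_prime: "admissible S \<Longrightarrow> p \<in> S \<Longrightarrow> prime p"
  by (induction rule: admissible.induct) auto

theorem admissible_kernel_symbols: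
  fixes x y :: "rat \<Rightarrow> 'b::group_add"
  assumes "admissible S" "steinberg_system (S_integers S) x y"
    and "(g, 0) \<in> sgp (steinberg_system.gens (S_integers S) x y)"
  shows "g \<in> steinberg_system.syms (S_integers S) x y"
  using assms
proof (induction arbitrary: x y g rule: admissible.induct)
  case empty
  then show ?case using steinberg_system.kernel_symbols_Ints S_integers_empty by metis
next
  case (insert S p K)
  interpret I: steinberg_system "S_integers (insert p S)" x y by (rule insert.prems(1))
  have p0: "p > 0" using \<open>prime p\<close> prime_gt_0_nat by blast
  interpret steinberg_extension "S_integers (insert p S)" "S_integers S" x y "of_nat p"
  proof
    show "S_integers S \<subseteq> S_integers (insert p S)" by (rule S_integers_mono) auto
    show "of_nat p \<noteq> (0 :: rat)" using p0 by simp
    show "of_nat p \<in> S_integers S" by (rule S_int.nat_mem)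
    show "1 / of_nat p \<notin> S_integers S" using S_integers_prime_nonunit insert.hyps by blast
    have "smooth (insert p S) p"
      using \<open>prime p\<close> p0 by (auto simp: smooth_def dest: primes_dvd_imp_eq)
    then show "1 / of_nat p \<in> S_integers (insert p S)" using S_integersI[of "insert p S" p 1] by simp
    show "s / of_nat p \<in> S_integers S \<or> t / of_nat p \<in> S_integers S"
      if "s \<in> S_integers S" "t \<in> S_integers S" "s * t / of_nat p \<in> S_integers S" for s t
      using S_integers_prime insert.hyps that by blast
    show "\<exists>k. of_nat p ^ k * t \<in> S_integers S" if "t \<in> S_integers (insert p S)" for t
      using S_integers_insert_denom \<open>prime p\<close> that by blast
    show "M \<in> sgp ({upper t |t. t \<in> S_integers S} \<union> {lower (of_nat p * t) |t. t \<in> S_integers S} \<union>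
        {diagm u |u. u \<in> S_int.units S})"
      if "ent_a M \<in> S_integers S" "ent_b M \<in> S_integers S" "ent_c M / of_nat p \<in> S_integers S" "ent_d M \<in> S_integers S" for M
      using Gamma0_generated[of K S p M] insert.hyps p0 that S_integers_prime_nonunit by blast
    show "g \<in> steinberg_system.syms (S_integers S) x' y'"
      if "steinberg_system (S_integers S) x' y'" "(g, 0) \<in> sgp (steinberg_system.gens (S_integers S) x' y')"
      for x' y' :: "rat \<Rightarrow> 'b" and g
      using insert.IH that by blast
  qed
  show ?case using kernel_symbols insert.prems(2) by blast
qed

lemma admissible_first_primes: "admissible (first_primes n)"
proof (induction n)
  case 0
  then show ?case by (simp add: first_primes_def admissible.empty)
next
  case (Suc n)
  let ?P = "{p::nat. prime p}"
  have inf: "infinite ?P" by (rule primes_infinite)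
  define p where "p = enumerate ?P n"
  have p: "prime p" using enumerate_in_set[OF inf, of n] by (simp add: p_def)
  then have p2: "p \<ge> 2" using prime_ge_2_nat by blast
  have small: "q \<in> first_primes n" if "prime q" "q < p" for q
  proof -
    have "\<exists>k. enumerate ?P k = q" using enumerate_Ex[of ?P q] inf that by simp
    then obtain k where k: "q = enumerate ?P k" by blast
    then have "k < n" using that(2) strict_mono_enumerate[OF inf] by (simp add: p_def strict_mono_less)
    then show ?thesis using k by (auto simp: first_primes_def)
  qed
  have "p \<notin> first_primes n"
    using strict_mono_enumerate[OF inf] by (auto simp: first_primes_def p_def strict_mono_eq)
  \<comment> \<open>Here K = p - 1: the prime factors of a number below p are below p and hence come
    earlier in the enumeration. The size condition is just p < p^2.\<close>
  moreover have "smooth (first_primes n) j" if "j \<in> {1..p - 1}" for j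
    unfolding smooth_def
  proof (intro conjI allI impI)
    show "j > 0" using that by simp
    fix q assume "prime q" "q dvd j"
    then have "q \<le> j" using \<open>j > 0\<close> dvd_imp_le by blast
    then show "q \<in> first_primes n" using that p2 \<open>prime q\<close> by (intro small) auto
  qed
  moreover have "p < (p - 1 + 1)\<^sup>2" using p2 by (simp add: power2_eq_square)
  ultimately have "admissible (insert p (first_primes n))"
    using Suc p p2 by (intro admissible.insert[of _ _ "p - 1"]) auto
  moreover have "insert p (first_primes n) = first_primes (Suc n)"
    by (auto simp: first_primes_def p_def lessThan_Suc)
  ultimately show ?case by simp
qed

text \<open>With K = 1 no number but 1 has to be invertible beforehand, and both primes are below
  2^2.\<close>

lemma admissible_2_3: "admissible {2, 3}"
proof -
  have "smooth S (Suc 0)" for S using smooth_one by simp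
  then have "admissible (insert 3 (insert 2 {}))"
    by (intro admissible.insert[where K = 1] admissible.empty) (auto simp: power2_eq_square)
  then show ?thesis by (simp add: insert_commute)
qed

text \<open>The numbers 1, 2, 3, 4 have no prime factors besides 2 and 3, while 5 has; so K = 4, and
  (4 + 1)^2 = 25 exceeds every prime in the exceptional sets.\<close>

lemma admissible_insert_small:
  assumes "admissible S" "{2, 3} \<subseteq> S" "prime p" "p < 25" "p \<notin> S"
  shows "admissible (insert p S)"
proof (rule admissible.insert[where K = 4])
  fix j :: nat assume j: "j \<in> {1..4}"
  have "q \<in> S" if "prime q" "q dvd j" for q
  proof -
    have "q \<le> 4" using that j dvd_imp_le[of q j] by auto
    then have "q = 2 \<or> q = 3 \<or> q = 4" using prime_ge_2_nat[OF that(1)] by auto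
    moreover have "q \<noteq> 4" using that(1) prime_product[of 2 2] by auto
    ultimately show ?thesis using assms(2) by auto
  qed
  then show "smooth S j" using j by (auto simp: smooth_def)
qed (use assms in \<open>auto simp: power2_eq_square\<close>)

lemma primes_upto_19: "prime (5::nat)" "prime (7::nat)" "prime (11::nat)" "prime (13::nat)" "prime (17::nat)" "prime (19::nat)"
  by (simp_all add: prime_nat_numeral_eq)

lemma admissible_exceptional:
  assumes "S \<in> {{2, 3, 7}, {2, 3, 11}, {2, 3, 5, 11}, {2, 3, 13}, {2, 3, 7, 13}, {2, 3, 17}, {2, 3, 5, 19}}"
  shows "admissible S"
proof -
  note p = primes_upto_19
  have 1: "admissible (insert q {2, 3})" if "prime q" "q < 25" "q > 3" for q
    using that by (intro admissible_insert_small admissible_2_3) auto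
  have 2: "admissible (insert r (insert q {2, 3}))" if "prime q" "q < 25" "q > 3" "prime r" "r < 25" "r > q" for q r
    using that by (intro admissible_insert_small 1) auto
  have "insert 7 {2, 3} = {2, 3, 7::nat}" "insert 11 {2, 3} = {2, 3, 11::nat}" "insert 13 {2, 3} = {2, 3, 13::nat}"
    "insert 17 {2, 3} = {2, 3, 17::nat}" "insert 11 (insert 5 {2, 3}) = {2, 3, 5, 11::nat}"
    "insert 13 (insert 7 {2, 3}) = {2, 3, 7, 13::nat}" "insert 19 (insert 5 {2, 3}) = {2, 3, 5, 19::nat}"
    by auto
  then show ?thesis
    using assms 1[OF p(2)] 1[OF p(3)] 1[OF p(4)] 1[OF p(5)] 2[OF p(1) _ _ p(3)] 2[OF p(2) _ _ p(4)] 2[OF p(1) _ _ p(6)]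
    by auto
qed

lemma first_primes_2: "n \<ge> 2 \<Longrightarrow> {2, 3} \<subseteq> first_primes n"
proof -
  assume n: "n \<ge> 2"
  let ?P = "{p::nat. prime p}"
  have inf: "infinite ?P" by (rule primes_infinite)
  have e0: "enumerate ?P 0 = 2"
    unfolding enumerate_0 by (rule Least_equality) (auto dest: prime_ge_2_nat)
  have "enumerate ?P 1 = (LEAST s. s \<in> ?P \<and> enumerate ?P 0 < s)"
    using enumerate_Suc''[OF inf, of 0] by simp
  also have "\<dots> = 3"
    unfolding e0 by (rule Least_equality) auto
  finally have "enumerate ?P 1 = 3" .
  then show ?thesis unfolding first_primes_def using n e0 by (force simp: image_iff)
qed

subsection \<open>Cayley's embedding\<close>

text \<open>
  Permutations form a type of class \<^class>\<open>group_add\<close>, so that results on Steinberg systems apply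
  to groups given by a carrier.
\<close>

typedef 'a permutation = "{f :: 'a \<Rightarrow> 'a. bij f}"
  by (rule exI[of _ id]) simp

setup_lifting type_definition_permutation

instantiation permutation :: (type) group_add
begin

lift_definition zero_permutation :: "'a permutation" is id by simp
lift_definition plus_permutation :: "'a permutation \<Rightarrow> 'a permutation \<Rightarrow> 'a permutation" is "(\<circ>)"
  by (simp add: bij_comp)
lift_definition uminus_permutation :: "'a permutation \<Rightarrow> 'a permutation" is "inv_into UNIV"
  by (simp add: bij_imp_bij_inv)
definition minus_permutation :: "'a permutation \<Rightarrow> 'a permutation \<Rightarrow> 'a permutation" where
  "minus_permutation f g = f + - g"

instance
proof
  fix a b c :: "'a permutation"
  show "a + b + c = a + (b + c)" by transfer (simp add: comp_assoc)
  show "0 + a = a" by transfer simp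
  show "a + 0 = a" by transfer simp
  show "- a + a = 0" by transfer (simp add: bij_is_inj)
  show "a + - b = a - b" by (simp add: minus_permutation_def)
qed

end

text \<open>Left translation, continued by the identity outside the carrier so that it is a
  permutation of the whole type.\<close>

definition cayley :: "('a, 'm) monoid_scheme \<Rightarrow> 'a \<Rightarrow> 'a permutation" where
  "cayley G g = Abs_permutation (\<lambda>h. if h \<in> carrier G then g \<otimes>\<^bsub>G\<^esub> h else h)"

context group
begin

lemma cayley_bij:
  assumes "g \<in> carrier G"
  shows "bij (\<lambda>h. if h \<in> carrier G then g \<otimes> h else h)"
proof (rule bij_betw_byWitness[where f' = "\<lambda>h. if h \<in> carrier G then inv g \<otimes> h else h"])
qed (use assms in \<open>auto simp: m_assoc[symmetric]\<close>)

lemma Rep_cayley: "g \<in> carrier G \<Longrightarrow> Rep_permutation (cayley G g) = (\<lambda>h. if h \<in> carrier G then g \<otimes> h else h)"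
  unfolding cayley_def by (rule Abs_permutation_inverse) (simp add: cayley_bij)

lemma cayley_mult: "g \<in> carrier G \<Longrightarrow> h \<in> carrier G \<Longrightarrow> cayley G (g \<otimes> h) = cayley G g + cayley G h"
  by (rule Rep_permutation_inject[THEN iffD1])
    (auto simp: Rep_cayley plus_permutation.rep_eq m_assoc fun_eq_iff)

lemma cayley_inj: "g \<in> carrier G \<Longrightarrow> h \<in> carrier G \<Longrightarrow> cayley G g = cayley G h \<Longrightarrow> g = h"
proof -
  assume gh: "g \<in> carrier G" "h \<in> carrier G" and "cayley G g = cayley G h"
  then have "Rep_permutation (cayley G g) \<one> = Rep_permutation (cayley G h) \<one>" by simp
  then show "g = h" using gh by (simp add: Rep_cayley)
qed

lemma cayley_inv: "g \<in> carrier G \<Longrightarrow> cayley G (inv g) = - cayley G g"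
  using cayley_mult[of "inv g" g] cayley_mult[of \<one> \<one>]
  by (simp add: eq_neg_iff_add_eq_0) (metis add_0_right add_left_cancel)

end

subsection \<open>Groups given by generators and relations\<close>

context
  fixes B :: "'g set" and R :: "('g word \<times> 'g word) set"
begin

lemma word_equiv_words: "word_equiv B R u v \<Longrightarrow> u \<in> words_over B \<and> v \<in> words_over B"
  by (induction rule: word_equiv.induct) auto

lemma word_class_eq: "word_equiv B R u v \<Longrightarrow> word_class B R u = word_class B R v"
  unfolding word_class_def by (blast intro: word_equiv.sym word_equiv.trans)

lemma word_class_self: "u \<in> words_over B \<Longrightarrow> u \<in> word_class B R u"
  by (simp add: word_class_def word_equiv.refl)

lemma presented_carrier: "carrier (presented_group B R) = word_class B R ` words_over B"
  and presented_one: "\<one>\<^bsub>presented_group B R\<^esub> = word_class B R []"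
  by (simp_all add: presented_group_def)

lemma presented_elem:
  assumes "P \<in> carrier (presented_group B R)" obtains u where "u \<in> words_over B" "P = word_class B R u"
  using assms unfolding presented_carrier by blast

text \<open>The product is a union over all pairs of representatives; by congruence every member of
  that union is the same class.\<close>

lemma presented_mult:
  assumes "u \<in> words_over B" "v \<in> words_over B"
  shows "word_class B R u \<otimes>\<^bsub>presented_group B R\<^esub> word_class B R v = word_class B R (u @ v)"
proof -
  have eq: "word_class B R (u' @ v') = word_class B R (u @ v)"
    if "u' \<in> word_class B R u" "v' \<in> word_class B R v" for u' v'
    using that unfolding word_class_def[of B R u] word_class_def[of B R v]
    by (intro word_class_eq word_equiv.cong) (auto intro: word_equiv.sym)
  have "(\<Union>u'\<in>word_class B R u. \<Union>v'\<in>word_class B R v. word_class B R (u' @ v')) = word_class B R (u @ v)"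
    using eq word_class_self[OF assms(1)] word_class_self[OF assms(2)] by blast
  then show ?thesis
    by (simp add: presented_group_def)
qed

definition formal_inverse :: "'g word \<Rightarrow> 'g word" where
  "formal_inverse u = rev (map (\<lambda>(b, g). (\<not> b, g)) u)"

lemma formal_inverse_words: "u \<in> words_over B \<Longrightarrow> formal_inverse u \<in> words_over B"
  by (auto simp: formal_inverse_def in_lists_conv_set)

lemma formal_inverse_equiv: "u \<in> words_over B \<Longrightarrow> word_equiv B R (formal_inverse u @ u) []"
proof (induction u)
  case Nil
  then show ?case by (simp add: formal_inverse_def word_equiv.refl)
next
  case (Cons c u)
  obtain b g where c: "c = (b, g)" by (cases c)
  have u: "u \<in> words_over B" and g: "g \<in> B" using Cons.prems c by auto
  have "word_equiv B R (formal_inverse u @ ([(\<not> b, g), (b, g)] @ u)) (formal_inverse u @ ([] @ u))"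
    using word_equiv.cancel[OF g, of R "\<not> b"] u formal_inverse_words[OF u]
    by (intro word_equiv.cong word_equiv.refl) simp_all
  then show ?case using Cons.IH[OF u] by (simp add: formal_inverse_def c) (blast intro: word_equiv.trans)
qed

lemma presented_is_group: "group (presented_group B R)"
proof (rule groupI)
  show "\<one>\<^bsub>presented_group B R\<^esub> \<in> carrier (presented_group B R)" by (auto simp: presented_carrier presented_one)
  show "P \<otimes>\<^bsub>presented_group B R\<^esub> Q \<in> carrier (presented_group B R)" if "P \<in> carrier (presented_group B R)" "Q \<in> carrier (presented_group B R)" for P Q
    using that by (elim presented_elem) (simp add: presented_mult presented_carrier)
  show "P \<otimes>\<^bsub>presented_group B R\<^esub> Q \<otimes>\<^bsub>presented_group B R\<^esub> U = P \<otimes>\<^bsub>presented_group B R\<^esub> (Q \<otimes>\<^bsub>presented_group B R\<^esub> U)"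
    if "P \<in> carrier (presented_group B R)" "Q \<in> carrier (presented_group B R)" "U \<in> carrier (presented_group B R)" for P Q U
    using that by (elim presented_elem) (simp add: presented_mult)
  show "\<one>\<^bsub>presented_group B R\<^esub> \<otimes>\<^bsub>presented_group B R\<^esub> P = P" if "P \<in> carrier (presented_group B R)" for P
    using that by (elim presented_elem) (simp add: presented_mult presented_one)
  show "\<exists>Q\<in>carrier (presented_group B R). Q \<otimes>\<^bsub>presented_group B R\<^esub> P = \<one>\<^bsub>presented_group B R\<^esub>" if "P \<in> carrier (presented_group B R)" for P
  proof -
    from that obtain u where u: "u \<in> words_over B" "P = word_class B R u" by (rule presented_elem)
    then have "word_class B R (formal_inverse u) \<otimes>\<^bsub>presented_group B R\<^esub> P = \<one>\<^bsub>presented_group B R\<^esub>"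
      using formal_inverse_words by (simp add: presented_mult presented_one word_class_eq formal_inverse_equiv)
    moreover have "word_class B R (formal_inverse u) \<in> carrier (presented_group B R)"
      unfolding presented_carrier using formal_inverse_words[OF u(1)] by (rule imageI)
    ultimately show ?thesis by blast
  qed
qed

end

lemma (in group) word_value_append:
  assumes "f \<in> B \<rightarrow> carrier G" "u \<in> words_over B" "v \<in> words_over B"
  shows "word_value G f u \<in> carrier G \<and> word_value G f (u @ v) = word_value G f u \<otimes> word_value G f v"
proof -
  have c: "word_value G f v \<in> carrier G" if "v \<in> words_over B" for v
    using that assms(1) by (induction v) (auto simp: word_value_def Pi_iff split: prod.splits)
  show ?thesis
    using assms(2)
  proof (induction u rule: list.induct)
    case Nil
    then show ?case using c[OF assms(3)] by (simp add: word_value_def)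
  next
    case (Cons d u)
    obtain b g where d: "d = (b, g)" by (cases d)
    have u: "u \<in> words_over B" and g: "f g \<in> carrier G" using Cons.prems d assms(1) by auto
    have "word_value G f u \<in> carrier G \<and> word_value G f (u @ v) = word_value G f u \<otimes> word_value G f v"
      using Cons.IH u by blast
    then show ?case using g c[OF assms(3)] by (simp add: word_value_def d m_assoc)
  qed
qed

lemma (in group) word_value_equiv:
  assumes f: "f \<in> B \<rightarrow> carrier G"
    and R: "\<And>r s. (r, s) \<in> R \<Longrightarrow> r \<in> words_over B \<Longrightarrow> s \<in> words_over B \<Longrightarrow> word_value G f r = word_value G f s"
    and "word_equiv B R u v"
  shows "word_value G f u = word_value G f v"
  using assms(3)
proof (induction rule: word_equiv.induct)
  case (cong u u' v v')
  then show ?case using word_value_append[OF f] word_equiv_words by metis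
next
  case (cancel g b)
  then have "f g \<in> carrier G" using f by auto
  then show ?case by (cases b) (simp_all add: word_value_def)
next
  case (rel r s)
  then show ?case by (rule R)
qed auto

text \<open>All words of a class have the same value, so the image under \<open>word_value\<close>
  is a singleton and \<open>the_elem\<close> is meaningful.\<close>

lemma (in group) presented_hom_class:
  assumes f: "f \<in> B \<rightarrow> carrier G"
    and R: "\<And>r s. (r, s) \<in> R \<Longrightarrow> r \<in> words_over B \<Longrightarrow> s \<in> words_over B \<Longrightarrow> word_value G f r = word_value G f s"
    and u: "u \<in> words_over B"
  shows "presented_hom G f (word_class B R u) = word_value G f u"
proof -
  have "word_value G f ` word_class B R u = {word_value G f u}"
    using word_value_equiv[OF f R] word_class_self[OF u] by (force simp: word_class_def)
  then show ?thesis by (simp add: presented_hom_def)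
qed

lemma (in group) presented_hom_hom:
  assumes f: "f \<in> B \<rightarrow> carrier G"
    and R: "\<And>r s. (r, s) \<in> R \<Longrightarrow> r \<in> words_over B \<Longrightarrow> s \<in> words_over B \<Longrightarrow> word_value G f r = word_value G f s"
  shows "presented_hom G f \<in> hom (presented_group B R) G"
proof (rule homI)
  note * = presented_hom_class[OF f R]
  fix P assume "P \<in> carrier (presented_group B R)"
  then obtain u where u: "u \<in> words_over B" "P = word_class B R u" by (rule presented_elem)
  then show "presented_hom G f P \<in> carrier G" using * word_value_append[OF f u(1) u(1)] by simp
  fix Q assume "Q \<in> carrier (presented_group B R)"
  then obtain v where v: "v \<in> words_over B" "Q = word_class B R v" by (rule presented_elem)
  show "presented_hom G f (P \<otimes>\<^bsub>presented_group B R\<^esub> Q) = presented_hom G f P \<otimes> presented_hom G f Q"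
    using u v * word_value_append[OF f u(1) v(1)] by (simp add: presented_mult)
qed

subsection \<open>Special linear groups over subrings of the rationals\<close>

no_notation fps_nth (infixl \<open>$\<close> 75)

definition mat_of :: "rsl2 \<Rightarrow> rat^2^2" where
  "mat_of M = (\<chi> i j. if i = 1 then (if j = 1 then ent_a M else ent_b M)
                        else (if j = 1 then ent_c M else ent_d M))"

lemma mat_of_entries [simp]:
  "mat_of M $ 1 $ 1 = ent_a M" "mat_of M $ 1 $ 2 = ent_b M"
  "mat_of M $ 2 $ 1 = ent_c M" "mat_of M $ 2 $ 2 = ent_d M"
  unfolding mat_of_def vec_lambda_beta by simp_all

lemma mat2_eq_iff:
  fixes M N :: "'a^2^2"
  shows "M = N \<longleftrightarrow> M $ 1 $ 1 = N $ 1 $ 1 \<and> M $ 1 $ 2 = N $ 1 $ 2 \<and> M $ 2 $ 1 = N $ 2 $ 1 \<and> M $ 2 $ 2 = N $ 2 $ 2"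
  unfolding vec_eq_iff forall_2 by blast

lemma mat_of_add: "mat_of (M + N) = mat_of M ** mat_of N"
  by (simp add: mat2_eq_iff matrix_matrix_mult_def sum_2)

lemma mat_of_zero: "mat_of 0 = mat 1"
  by (simp add: mat2_eq_iff mat_def)

lemma mat_of_inject: "mat_of M = mat_of N \<longleftrightarrow> M = N"
  by (simp add: mat2_eq_iff rsl2_eq_iff)

lemma mat_of_surj:
  assumes "det N = 1" shows "\<exists>M. mat_of M = N"
proof -
  have "N $ 1 $ 1 * N $ 2 $ 2 - N $ 1 $ 2 * N $ 2 $ 1 = 1" using assms by (simp add: det_2)
  then have *: "Rep_rsl2 (Abs_rsl2 (N $ 1 $ 1, N $ 1 $ 2, N $ 2 $ 1, N $ 2 $ 2)) = (N $ 1 $ 1, N $ 1 $ 2, N $ 2 $ 1, N $ 2 $ 2)"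
    by (intro Abs_rsl2_inverse) simp
  show ?thesis
    by (rule exI[of _ "Abs_rsl2 (N $ 1 $ 1, N $ 1 $ 2, N $ 2 $ 1, N $ 2 $ 2)"])
      (simp add: mat2_eq_iff ent_a.rep_eq ent_b.rep_eq ent_c.rep_eq ent_d.rep_eq *)
qed

lemma elem_matrix_mat_of: "elem_matrix 1 2 t = mat_of (upper t)" "elem_matrix 2 1 t = mat_of (lower t)"
  by (simp_all add: mat2_eq_iff elem_matrix_def)

definition rsl2_over :: "rat set \<Rightarrow> rsl2 set" where
  "rsl2_over A = {M. ent_a M \<in> A \<and> ent_b M \<in> A \<and> ent_c M \<in> A \<and> ent_d M \<in> A}"

lemma SL2_carrier: "carrier (SL2 A) = mat_of ` rsl2_over A"
proof -
  have "det (mat_of M) = 1" for M using rsl2_det[of M] by (simp add: det_2)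
  then show ?thesis
    using mat_of_surj by (fastforce simp: SL2_def rsl2_over_def forall_2)
qed

lemma SL2_mult: "M \<otimes>\<^bsub>SL2 A\<^esub> N = M ** N" and SL2_one: "\<one>\<^bsub>SL2 A\<^esub> = mat 1"
  by (simp_all add: SL2_def)

context rat_subring
begin

lemma SL2_group: "group (SL2 B)"
proof (rule groupI)
  show "\<one>\<^bsub>SL2 B\<^esub> \<in> carrier (SL2 B)"
    unfolding SL2_carrier SL2_one mat_of_zero[symmetric]
    by (rule imageI) (simp add: rsl2_over_def zero_mem one_mem)
  show "M \<otimes>\<^bsub>SL2 B\<^esub> N \<in> carrier (SL2 B)" if "M \<in> carrier (SL2 B)" "N \<in> carrier (SL2 B)" for M N
    using that unfolding SL2_carrier SL2_mult
    by (auto simp: mat_of_add[symmetric] rsl2_over_def add_mem mult_mem intro!: imageI)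
  show "\<exists>N\<in>carrier (SL2 B). N \<otimes>\<^bsub>SL2 B\<^esub> M = \<one>\<^bsub>SL2 B\<^esub>" if "M \<in> carrier (SL2 B)" for M
  proof -
    from that obtain N where N: "N \<in> rsl2_over B" "M = mat_of N" by (auto simp: SL2_carrier)
    have "- N \<in> rsl2_over B" using N(1) by (simp add: rsl2_over_def uminus_mem)
    moreover have "mat_of (- N) \<otimes>\<^bsub>SL2 B\<^esub> M = \<one>\<^bsub>SL2 B\<^esub>"
      by (simp add: N SL2_mult SL2_one mat_of_add[symmetric] mat_of_zero)
    ultimately show ?thesis by (auto simp: SL2_carrier)
  qed
qed (auto simp: SL2_mult SL2_one matrix_mul_assoc)

lemma SL2_inv: "M \<in> rsl2_over B \<Longrightarrow> inv\<^bsub>SL2 B\<^esub> (mat_of M) = mat_of (- M)"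
proof (rule group.inv_equality[OF SL2_group])
  show "mat_of (- M) \<otimes>\<^bsub>SL2 B\<^esub> mat_of M = \<one>\<^bsub>SL2 B\<^esub>"
    by (simp add: SL2_mult SL2_one mat_of_add[symmetric] mat_of_zero)
qed (auto simp: SL2_carrier rsl2_over_def uminus_mem)

end

subsection \<open>The Steinberg group\<close>

definition elem :: "2 \<Rightarrow> rat \<Rightarrow> rsl2" where
  "elem i t = (if i = 1 then upper t else lower t)"

lemma index_cases:
  fixes i j :: 2
  assumes "i \<noteq> j" obtains "i = 1" "j = 2" | "i = 2" "j = 1"
  using assms exhaust_2[of i] exhaust_2[of j] by auto

lemma elem_matrix_elem: "i \<noteq> j \<Longrightarrow> elem_matrix i j t = mat_of (elem i t)"
  by (erule index_cases) (simp_all add: elem_def elem_matrix_mat_of)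

lemma x_word_words: "i \<noteq> j \<Longrightarrow> t \<in> A \<Longrightarrow> x_word i j t \<in> words_over (steinberg_gens A)"
  by (simp add: x_word_def steinberg_gens_def)

context rat_subring
begin

abbreviation "St \<equiv> St2 B"

definition st_x :: "2 \<Rightarrow> 2 \<Rightarrow> rat \<Rightarrow> rat steinberg_gen word set" where
  "st_x i j t = word_class (steinberg_gens B) (steinberg_rels B) (x_word i j t)"

lemma w_word_words:
  "i \<noteq> j \<Longrightarrow> u \<in> B \<Longrightarrow> v \<in> B \<Longrightarrow> w_word i j u v \<in> words_over (steinberg_gens B)"
  using x_word_words[of i j u B] x_word_words[of j i "- v" B] uminus_mem by (simp add: w_word_def)

lemma St_group: "group St"
  unfolding St2_def by (rule presented_is_group)

lemma st_x_closed: "i \<noteq> j \<Longrightarrow> t \<in> B \<Longrightarrow> st_x i j t \<in> carrier St"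
  unfolding st_x_def St2_def presented_carrier by (rule imageI) (rule x_word_words)

lemma st_x_add: "i \<noteq> j \<Longrightarrow> s \<in> B \<Longrightarrow> t \<in> B \<Longrightarrow> st_x i j s \<otimes>\<^bsub>St\<^esub> st_x i j t = st_x i j (s + t)"
proof -
  assume ij: "i \<noteq> j" and st: "s \<in> B" "t \<in> B"
  note words = x_word_words[OF ij, of _ B]
  have "(x_word i j s @ x_word i j t, x_word i j (s + t)) \<in> steinberg_rels B"
    unfolding steinberg_rels_def using ij st by blast
  then have "word_class (steinberg_gens B) (steinberg_rels B) (x_word i j s @ x_word i j t) =
      word_class (steinberg_gens B) (steinberg_rels B) (x_word i j (s + t))"
    using words st add_mem by (intro word_class_eq word_equiv.rel) simp_all
  then show ?thesis
    using words st by (simp add: st_x_def St2_def presented_mult)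
qed

lemma st_x_conj:
  assumes ij: "i \<noteq> j" and u: "u \<in> B" "v \<in> B" "u * v = 1" and t: "t \<in> B"
  shows "(st_x i j u \<otimes>\<^bsub>St\<^esub> st_x j i (- v) \<otimes>\<^bsub>St\<^esub> st_x i j u) \<otimes>\<^bsub>St\<^esub> st_x i j t \<otimes>\<^bsub>St\<^esub>
    (st_x i j (- u) \<otimes>\<^bsub>St\<^esub> st_x j i v \<otimes>\<^bsub>St\<^esub> st_x i j (- u)) = st_x j i (- (v\<^sup>2 * t))"
proof -
  let ?c = "word_class (steinberg_gens B) (steinberg_rels B)"
  let ?l = "w_word i j u v @ x_word i j t @ w_word i j (- u) (- v)"
  note words = x_word_words[of i j u B] x_word_words[of j i "- v" B] x_word_words[of i j t B]
    x_word_words[of i j "- u" B] x_word_words[of j i v B]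
  have m: "u \<in> B" "- u \<in> B" "- v \<in> B" using u uminus_mem by auto
  have "?c ?l = ?c (x_word j i (- (v\<^sup>2 * t)))"
  proof (intro word_class_eq word_equiv.rel)
    show "(?l, x_word j i (- (v\<^sup>2 * t))) \<in> steinberg_rels B"
      unfolding steinberg_rels_def using assms by blast
    show "?l \<in> words_over (steinberg_gens B)"
      using w_word_words[OF ij] ij u m t words by simp
    show "x_word j i (- (v\<^sup>2 * t)) \<in> words_over (steinberg_gens B)"
      using ij u t by (intro x_word_words uminus_mem mult_mem power_mem) auto
  qed
  then show ?thesis
    using ij u t m words by (simp add: st_x_def St2_def presented_mult w_word_def)
qed

lemma st_induct [consumes 1, case_names one gen inv_gen]:
  assumes "g \<in> carrier St" and "P \<one>\<^bsub>St\<^esub>"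
    and "\<And>i j t g. i \<noteq> j \<Longrightarrow> t \<in> B \<Longrightarrow> g \<in> carrier St \<Longrightarrow> P g \<Longrightarrow> P (st_x i j t \<otimes>\<^bsub>St\<^esub> g)"
    and "\<And>i j t g. i \<noteq> j \<Longrightarrow> t \<in> B \<Longrightarrow> g \<in> carrier St \<Longrightarrow> P g \<Longrightarrow> P (inv\<^bsub>St\<^esub> st_x i j t \<otimes>\<^bsub>St\<^esub> g)"
  shows "P g"
proof -
  let ?G = "steinberg_gens B" and ?R = "steinberg_rels B"
  interpret St: group St by (rule St_group)
  obtain u where u: "u \<in> words_over ?G" and g: "g = word_class ?G ?R u"
    using assms(1) unfolding St2_def by (rule presented_elem)
  have cl: "word_class ?G ?R u \<in> carrier St" if "u \<in> words_over ?G" for u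
    using that unfolding St2_def presented_carrier by (rule imageI)
  from u have "P (word_class ?G ?R u)"
  proof (induction u rule: list.induct)
    case Nil
    then show ?case using assms(2) by (simp add: St2_def presented_one)
  next
    case (Cons d u)
    obtain b i j t where d: "d = (b, i, j, t)" by (cases d)
    have u: "u \<in> words_over ?G" and ij: "i \<noteq> j" "t \<in> B"
      using Cons.prems d by (auto simp: steinberg_gens_def)
    have one: "[(b, i, j, t)] \<in> words_over ?G" for b using ij by (simp add: steinberg_gens_def)
    have eq: "word_class ?G ?R (d # u) = word_class ?G ?R [d] \<otimes>\<^bsub>St\<^esub> word_class ?G ?R u"
      using one u by (simp add: St2_def presented_mult d)
    show ?case
    proof (cases b)
      case True
      then have "word_class ?G ?R [d] = st_x i j t" by (simp add: st_x_def x_word_def d)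
      then show ?thesis using eq assms(3)[OF ij cl[OF u] Cons.IH[OF u]] by simp
    next
      case False
      have "word_class ?G ?R [(False, i, j, t)] \<otimes>\<^bsub>St\<^esub> st_x i j t = \<one>\<^bsub>St\<^esub>"
        using one[of False] one[of True] word_equiv.cancel[of "(i, j, t)" ?G ?R False] ij
        by (simp add: St2_def st_x_def x_word_def presented_mult presented_one steinberg_gens_def word_class_eq)
      then have "word_class ?G ?R [d] = inv\<^bsub>St\<^esub> st_x i j t"
        using St.inv_equality[OF _ st_x_closed[OF ij] cl[OF one[of False]]] False d by simp
      then show ?thesis using eq assms(4)[OF ij cl[OF u] Cons.IH[OF u]] by simp
    qed
  qed
  then show ?thesis by (simp add: g)
qed

text \<open>The universal property of the presentation, used for the map to matrices and again for
  the map into a given central extension.\<close>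

lemma St_hom:
  assumes "group F"
    and cl: "\<And>i j t. i \<noteq> j \<Longrightarrow> t \<in> B \<Longrightarrow> f i j t \<in> carrier F"
    and add: "\<And>i j s t. i \<noteq> j \<Longrightarrow> s \<in> B \<Longrightarrow> t \<in> B \<Longrightarrow> f i j s \<otimes>\<^bsub>F\<^esub> f i j t = f i j (s + t)"
    and conj: "\<And>i j u v t. i \<noteq> j \<Longrightarrow> u \<in> B \<Longrightarrow> v \<in> B \<Longrightarrow> u * v = 1 \<Longrightarrow> t \<in> B \<Longrightarrow>
      (f i j u \<otimes>\<^bsub>F\<^esub> f j i (- v) \<otimes>\<^bsub>F\<^esub> f i j u) \<otimes>\<^bsub>F\<^esub> f i j t \<otimes>\<^bsub>F\<^esub>
        (f i j (- u) \<otimes>\<^bsub>F\<^esub> f j i v \<otimes>\<^bsub>F\<^esub> f i j (- u)) = f j i (- (v\<^sup>2 * t))"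
  shows "presented_hom F (\<lambda>(i, j, t). f i j t) \<in> hom St F"
    and "\<And>i j t. i \<noteq> j \<Longrightarrow> t \<in> B \<Longrightarrow> presented_hom F (\<lambda>(i, j, t). f i j t) (st_x i j t) = f i j t"
proof -
  interpret F: group F by fact
  let ?f = "\<lambda>(i, j, t). f i j t"
  let ?G = "steinberg_gens B" and ?R = "steinberg_rels B"
  have f: "?f \<in> ?G \<rightarrow> carrier F" using cl by (auto simp: steinberg_gens_def)
  have R: "word_value F ?f r = word_value F ?f s" if "(r, s) \<in> ?R" for r s
    using that unfolding steinberg_rels_def
  proof (elim UnE CollectE exE conjE)
    fix i j s' t assume *: "(r, s) = (x_word i j s' @ x_word i j t, x_word i j (s' + t))" "i \<noteq> j" "s' \<in> B" "t \<in> B"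
    then show ?thesis using cl add add_mem by (simp add: x_word_def word_value_def)
  next
    fix i j u v t assume *: "(r, s) = (w_word i j u v @ x_word i j t @ w_word i j (- u) (- v), x_word j i (- (v\<^sup>2 * t)))"
      "i \<noteq> j" "u \<in> B" "v \<in> B" "u * v = 1" "t \<in> B"
    have c: "f i j u \<in> carrier F" "f j i (- v) \<in> carrier F" "f i j t \<in> carrier F" "f i j (- u) \<in> carrier F"
      "f j i v \<in> carrier F" "f j i (- (v\<^sup>2 * t)) \<in> carrier F"
      using * cl uminus_mem mult_mem power_mem by auto
    then show ?thesis using * conj[OF *(2-6)] by (simp add: x_word_def w_word_def word_value_def F.m_assoc)
  qed
  show "presented_hom F ?f \<in> hom St F"
    unfolding St2_def by (rule F.presented_hom_hom[OF f]) (rule R)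
  show "presented_hom F ?f (st_x i j t) = f i j t" if ij: "i \<noteq> j" "t \<in> B" for i j t
    unfolding st_x_def using F.presented_hom_class[OF f R x_word_words[OF ij]] cl[OF ij]
    by (simp add: x_word_def word_value_def)
qed

lemma elem_closed: "t \<in> B \<Longrightarrow> mat_of (elem i t) \<in> carrier (SL2 B)"
  by (auto simp: SL2_carrier elem_def rsl2_over_def one_mem zero_mem intro!: imageI)

lemma steinberg_map_hom: "steinberg_map B \<in> hom St (SL2 B)"
  and steinberg_map_st_x: "i \<noteq> j \<Longrightarrow> t \<in> B \<Longrightarrow> steinberg_map B (st_x i j t) = mat_of (elem i t)"
proof -
  have add: "elem_matrix i j s \<otimes>\<^bsub>SL2 B\<^esub> elem_matrix i j t = elem_matrix i j (s + t)" if "i \<noteq> j" for i j s t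
    using that by (simp add: SL2_mult elem_matrix_elem mat_of_add[symmetric] mat_of_inject)
      (auto simp: elem_def rsl2_eq_iff)
  have conj: "(elem_matrix i j u \<otimes>\<^bsub>SL2 B\<^esub> elem_matrix j i (- v) \<otimes>\<^bsub>SL2 B\<^esub> elem_matrix i j u) \<otimes>\<^bsub>SL2 B\<^esub> elem_matrix i j t \<otimes>\<^bsub>SL2 B\<^esub>
        (elem_matrix i j (- u) \<otimes>\<^bsub>SL2 B\<^esub> elem_matrix j i v \<otimes>\<^bsub>SL2 B\<^esub> elem_matrix i j (- u)) = elem_matrix j i (- (v\<^sup>2 * t))"
    if ij: "i \<noteq> j" and uv: "u * v = 1" for i j u v t
  proof -
    have u: "u \<noteq> 0" using uv by auto
    with uv have v: "v = 1 / u" by (simp add: field_simps)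
    have "elem i u + elem j (- v) + elem i u + elem i t + (elem i (- u) + elem j v + elem i (- u)) = elem j (- (v\<^sup>2 * t))"
      using ij by (rule index_cases) (simp_all add: elem_def rsl2_eq_iff u v power2_eq_square field_simps)
    then show ?thesis
      using ij by (simp add: SL2_mult elem_matrix_elem mat_of_add[symmetric])
  qed
  show "steinberg_map B \<in> hom St (SL2 B)"
    unfolding steinberg_map_def
    by (rule St_hom(1)[OF SL2_group, of elem_matrix]) (use add conj elem_closed in \<open>auto simp: elem_matrix_elem\<close>)
  show "steinberg_map B (st_x i j t) = mat_of (elem i t)" if "i \<noteq> j" "t \<in> B" for i j t
    unfolding steinberg_map_def elem_matrix_elem[OF that(1), symmetric]
    by (rule St_hom(2)[OF SL2_group, of elem_matrix]) (use add conj elem_closed that in \<open>auto simp: elem_matrix_elem\<close>)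
qed

lemma diagm_elementary:
  assumes "u \<in> units"
  shows "diagm u \<in> sgp ({upper t | t. t \<in> B} \<union> {lower t | t. t \<in> B})" (is "_ \<in> sgp ?V")
proof -
  have "upper u + lower (- (1 / u)) + upper u + (upper (- 1) + lower 1 + upper (- 1)) \<in> sgp ?V"
    using assms by (intro sgp.add sgp.incl) (auto intro: uminus_mem one_mem unitsD)
  also have "upper u + lower (- (1 / u)) + upper u + (upper (- 1) + lower 1 + upper (- 1)) = diagm u"
    using assms by (simp add: rsl2_eq_iff unitsD)
  finally show ?thesis .
qed

lemma steinberg_map_onto:
  assumes "M \<in> sgp ({upper t | t. t \<in> B} \<union> {lower t | t. t \<in> B})"
  shows "mat_of M \<in> steinberg_map B ` carrier St"
proof -
  interpret group_hom St "SL2 B" "steinberg_map B"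
    using St_group SL2_group steinberg_map_hom by (simp add: group_hom_def group_hom_axioms_def)
  have "mat_of M \<in> steinberg_map B ` carrier St \<and> M \<in> rsl2_over B"
    using assms
  proof induction
    case zero
    have "mat_of 0 = steinberg_map B \<one>\<^bsub>St\<^esub>" by (simp add: mat_of_zero SL2_one)
    then have "mat_of 0 \<in> steinberg_map B ` carrier St" using G.one_closed by (rule image_eqI)
    then show ?case by (simp add: rsl2_over_def zero_mem one_mem)
  next
    case (incl M)
    then obtain i t where t: "t \<in> B" "M = elem i t"
      by (auto simp: elem_def intro: that[of _ 1] that[of _ 2])
    obtain j where "i \<noteq> j" using exhaust_2[of i] by (metis one_neq_zero zero_neq_one)
    then have "mat_of M = steinberg_map B (st_x i j t)" "st_x i j t \<in> carrier St"
      using t steinberg_map_st_x st_x_closed by auto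
    then have "mat_of M \<in> steinberg_map B ` carrier St" by (rule image_eqI)
    then show ?case using t by (simp add: elem_def rsl2_over_def zero_mem one_mem)
  next
    case (add M N)
    then obtain g h where "g \<in> carrier St" "mat_of M = steinberg_map B g" "h \<in> carrier St" "mat_of N = steinberg_map B h"
      by blast
    then have "mat_of (M + N) = steinberg_map B (g \<otimes>\<^bsub>St\<^esub> h)" "g \<otimes>\<^bsub>St\<^esub> h \<in> carrier St"
      by (simp_all add: SL2_mult mat_of_add)
    then have "mat_of (M + N) \<in> steinberg_map B ` carrier St" by (rule image_eqI)
    then show ?case using add.IH by (auto simp: rsl2_over_def add_mem mult_mem)
  next
    case (neg M)
    then obtain g where g: "g \<in> carrier St" "mat_of M = steinberg_map B g"
      by blast
    then have "mat_of (- M) = steinberg_map B (inv\<^bsub>St\<^esub> g)" "inv\<^bsub>St\<^esub> g \<in> carrier St"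
      using neg.IH by (simp_all add: SL2_inv[symmetric])
    then have "mat_of (- M) \<in> steinberg_map B ` carrier St" by (rule image_eqI)
    then show ?case using neg.IH by (auto simp: rsl2_over_def uminus_mem)
  qed
  then show ?thesis ..
qed

end

text \<open>The case p = 1 of \<open>Gamma0_generated\<close>: Gamma_0(1) is the whole group, and K
  = 1 suffices because 1 < 2^2. The diagonal generators are then products of elementary
  matrices.\<close>

lemma S_integers_elementary:
  assumes "M \<in> rsl2_over (S_integers S)"
  shows "M \<in> sgp ({upper t | t. t \<in> S_integers S} \<union> {lower t | t. t \<in> S_integers S})" (is "_ \<in> sgp ?V")
proof -
  have "M \<in> sgp ({upper t | t. t \<in> S_integers S} \<union> {lower (of_nat 1 * t) | t. t \<in> S_integers S} \<union>
      {diagm u | u. u \<in> S_int.units S})"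
    by (rule Gamma0_generated[where K = 1]) (use assms smooth_one[of S] in \<open>auto simp: rsl2_over_def power2_eq_square\<close>)
  also have "\<dots> \<subseteq> sgp ?V"
    by (rule sgp_least) (use S_int.diagm_elementary in \<open>auto intro: sgp.incl\<close>)
  finally show ?thesis .
qed

lemma (in rat_subring) steinberg_cayley:
  fixes f :: "2 \<Rightarrow> 2 \<Rightarrow> rat \<Rightarrow> 'f"
  assumes "group F"
    and cl: "\<And>i j t. i \<noteq> j \<Longrightarrow> t \<in> B \<Longrightarrow> f i j t \<in> carrier F"
    and add: "\<And>i j s t. i \<noteq> j \<Longrightarrow> s \<in> B \<Longrightarrow> t \<in> B \<Longrightarrow> f i j s \<otimes>\<^bsub>F\<^esub> f i j t = f i j (s + t)"
    and conj: "\<And>i j u v t. i \<noteq> j \<Longrightarrow> u \<in> B \<Longrightarrow> v \<in> B \<Longrightarrow> u * v = 1 \<Longrightarrow> t \<in> B \<Longrightarrow>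
      (f i j u \<otimes>\<^bsub>F\<^esub> f j i (- v) \<otimes>\<^bsub>F\<^esub> f i j u) \<otimes>\<^bsub>F\<^esub> f i j t \<otimes>\<^bsub>F\<^esub>
        (f i j (- u) \<otimes>\<^bsub>F\<^esub> f j i v \<otimes>\<^bsub>F\<^esub> f i j (- u)) = f j i (- (v\<^sup>2 * t))"
  shows "steinberg_system B (\<lambda>t. cayley F (f 1 2 t)) (\<lambda>t. cayley F (f 2 1 t))"
proof -
  interpret F: group F by fact
  show ?thesis
  proof
    show "cayley F (f 1 2 s) + cayley F (f 1 2 t) = cayley F (f 1 2 (s + t))" if "s \<in> B" "t \<in> B" for s t
      using that add[of 1 2] by (simp add: F.cayley_mult[symmetric] cl)
    show "cayley F (f 2 1 s) + cayley F (f 2 1 t) = cayley F (f 2 1 (s + t))" if "s \<in> B" "t \<in> B" for s t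
      using that add[of 2 1] by (simp add: F.cayley_mult[symmetric] cl)
    show "(cayley F (f 1 2 u) + cayley F (f 2 1 (- (1 / u))) + cayley F (f 1 2 u)) + cayley F (f 1 2 t) +
        (cayley F (f 1 2 (- u)) + cayley F (f 2 1 (1 / u)) + cayley F (f 1 2 (- u))) = cayley F (f 2 1 (- (t / u\<^sup>2)))"
      if u: "u \<in> units" and t: "t \<in> B" for u t
    proof -
      have m: "u \<in> B" "1 / u \<in> B" "- u \<in> B" "- (1 / u) \<in> B" and "u * (1 / u) = 1"
        using u uminus_mem by (auto simp: units_def)
      then show ?thesis
        using conj[of 1 2 u "1 / u" t] t
        by (simp add: F.cayley_mult[symmetric] cl power_divide)
    qed
  qed
qed

text \<open>After Cayley's embedding a kernel element is the value of a word with trivial matrix,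
  hence a product of symbols, and these commute with all generators. Surjectivity is the elementary
  generation of SL_2.\<close>

theorem steinberg_central_extension:
  assumes "admissible S"
  shows "central_extension (St2 (S_integers S)) (SL2 (S_integers S)) (steinberg_map (S_integers S))"
proof -
  define A where "A = S_integers S"
  interpret rat_subring A unfolding A_def by (rule S_int.rat_subring_axioms)
  interpret St: group St by (rule St_group)
  interpret h: group_hom St "SL2 A" "steinberg_map A"
    using St_group SL2_group steinberg_map_hom by (simp add: group_hom_def group_hom_axioms_def)
  let ?c = "cayley St"
  interpret S: steinberg_system A "\<lambda>t. ?c (st_x 1 2 t)" "\<lambda>t. ?c (st_x 2 1 t)"
    by (rule steinberg_cayley[OF St_group st_x_closed st_x_add st_x_conj])
  have gen: "(?c (st_x i j t), elem i t) \<in> sgp S.gens" if "i \<noteq> j" "t \<in> A" for i j t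
    using that(1) by (rule index_cases)
      (use S.x_gens[OF that(2)] S.y_gens[OF that(2)] in \<open>simp_all add: elem_def\<close>)
  have lift: "\<exists>M. (?c g, M) \<in> sgp S.gens \<and> mat_of M = steinberg_map A g" if "g \<in> carrier St" for g
    using that
  proof (induction rule: st_induct)
    case one
    have "?c \<one>\<^bsub>St\<^esub> = 0" using St.cayley_mult[of "\<one>\<^bsub>St\<^esub>" "\<one>\<^bsub>St\<^esub>"] by simp (metis add_0_right add_left_cancel)
    then show ?case
      using sgp.zero[of S.gens] by (intro exI[of _ 0]) (simp add: mat_of_zero SL2_one zero_prod_def)
  next
    case (gen i j t g)
    then obtain M where M: "(?c g, M) \<in> sgp S.gens" "mat_of M = steinberg_map A g" by blast
    from sgp.add[OF \<open>\<And>i j t. i \<noteq> j \<Longrightarrow> t \<in> A \<Longrightarrow> (?c (st_x i j t), elem i t) \<in> sgp S.gens\<close>[OF gen(1,2)] M(1)]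
    have "(?c (st_x i j t \<otimes>\<^bsub>St\<^esub> g), elem i t + M) \<in> sgp S.gens"
      using gen st_x_closed by (simp add: St.cayley_mult)
    then show ?case
      using M(2) gen st_x_closed
      by (intro exI[of _ "elem i t + M"]) (simp add: mat_of_add SL2_mult steinberg_map_st_x)
  next
    case (inv_gen i j t g)
    then obtain M where M: "(?c g, M) \<in> sgp S.gens" "mat_of M = steinberg_map A g" by blast
    from sgp.add[OF sgp.neg[OF \<open>\<And>i j t. i \<noteq> j \<Longrightarrow> t \<in> A \<Longrightarrow> (?c (st_x i j t), elem i t) \<in> sgp S.gens\<close>[OF inv_gen(1,2)]] M(1)]
    have "(?c (inv\<^bsub>St\<^esub> st_x i j t \<otimes>\<^bsub>St\<^esub> g), - elem i t + M) \<in> sgp S.gens"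
      using inv_gen st_x_closed by (simp add: St.cayley_mult St.cayley_inv)
    moreover have "elem i t \<in> rsl2_over A"
      using inv_gen by (simp add: elem_def rsl2_over_def zero_mem one_mem)
    ultimately show ?case
      using M(2) inv_gen st_x_closed
      by (intro exI[of _ "- elem i t + M"]) (simp add: mat_of_add SL2_mult steinberg_map_st_x SL2_inv)
  qed
  have central: "z \<otimes>\<^bsub>St\<^esub> g = g \<otimes>\<^bsub>St\<^esub> z" if z: "z \<in> kernel St (SL2 A) (steinberg_map A)" and g: "g \<in> carrier St" for z g
  proof -
    have zc: "z \<in> carrier St" "steinberg_map A z = mat 1" using z by (auto simp: kernel_def SL2_one)
    obtain M where M: "(?c z, M) \<in> sgp S.gens" "mat_of M = mat_of 0" using lift[OF zc(1)] zc(2) by (auto simp: mat_of_zero)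
    then have "(?c z, 0) \<in> sgp S.gens" by (simp add: mat_of_inject)
    then have "?c z \<in> S.syms"
      using admissible_kernel_symbols[OF assms] S.steinberg_system_axioms unfolding A_def by blast
    moreover obtain N where "(?c g, N) \<in> sgp S.gens" using lift[OF g] by blast
    ultimately have "?c z + ?c g = ?c g + ?c z" by (rule S.gens_fst_commutes)
    then have "?c (z \<otimes>\<^bsub>St\<^esub> g) = ?c (g \<otimes>\<^bsub>St\<^esub> z)" using zc g by (simp add: St.cayley_mult)
    then show ?thesis using zc g by (intro St.cayley_inj) auto
  qed
  have "carrier (SL2 A) \<subseteq> steinberg_map A ` carrier St"
    unfolding SL2_carrier using S_integers_elementary steinberg_map_onto unfolding A_def by blast
  then have "steinberg_map A \<in> epi St (SL2 A)"
    using steinberg_map_hom h.hom_closed by (auto simp: epi_def)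
  then show ?thesis
    using central St_group SL2_group unfolding central_extension_def A_def[symmetric] by blast
qed

subsection \<open>Lifting the Steinberg relations to central extensions\<close>

context steinberg_system
begin

text \<open>At \<open>t = u\<close> the relation \<open>w_x\<close> lets x(u) pass through w(u) and
  come out as y(-1/u); cancelling the final x(u) gives x y x = y x y.\<close>

lemma w_braid: "u \<in> units \<Longrightarrow> y (- (1 / u)) + x u + y (- (1 / u)) = w u"
proof -
  assume u: "u \<in> units"
  have "w u + x u = y (- (1 / u)) + w u"
    using w_x[OF u unitsD(1)[OF u]] u by (simp add: unitsD power2_eq_square)
  then have "w u + x u = (y (- (1 / u)) + x u + y (- (1 / u))) + x u" by (simp add: w_def add.assoc)
  then show ?thesis by simp
qed

text \<open>By \<open>w_braid\<close> the element w_21(u) is w_12(-1/u), so this relation is an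
  instance of \<open>w_y\<close>.\<close>

lemma y_conj: "u \<in> units \<Longrightarrow> t \<in> B \<Longrightarrow>
  (y u + x (- (1 / u)) + y u) + y t + (y (- u) + x (1 / u) + y (- u)) = x (- (t / u\<^sup>2))"
proof -
  assume u: "u \<in> units" and t: "t \<in> B"
  let ?v = "- (1 / u)"
  have v: "?v \<in> units" using u by (intro units_uminus units_inverse)
  have "1 / u \<in> units" using u by (rule units_inverse)
  from w_braid[OF this] w_braid[OF v] u
  have "y u + x ?v + y u = w ?v" "y (- u) + x (1 / u) + y (- u) = w (- ?v)" by (simp_all add: unitsD)
  moreover have "w ?v + y t + w (- ?v) = x (- (t / u\<^sup>2))"
    unfolding w_y[OF v t] w_uminus[OF v] by (simp add: power_divide add.assoc)
  ultimately show ?thesis by simp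
qed

end

section \<open>Canonical lifts by commutators\<close>

definition commutator :: "'b::group_add \<Rightarrow> 'b \<Rightarrow> 'b" where
  "commutator a b = a + b - a - b"

text \<open>\<open>E\<close> is the graph of a central extension of \<open>SL\<^sub>2(A)\<close>.\<close>

locale central_graph = rat_subring A for A :: "rat set" +
  fixes E :: "('b::group_add \<times> rsl2) set"
  assumes E_sgp: "sgp E \<subseteq> E"
    and E_onto: "M \<in> rsl2_over A \<Longrightarrow> \<exists>g. (g, M) \<in> E"
    and E_central: "(z, 0) \<in> E \<Longrightarrow> (g, M) \<in> E \<Longrightarrow> z + g = g + z"
begin

lemma E_add: "(g, M) \<in> E \<Longrightarrow> (h, N) \<in> E \<Longrightarrow> (g + h, M + N) \<in> E"
  using sgp.add[of "(g, M)" E "(h, N)"] E_sgp by (auto intro: sgp.incl)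

lemma E_uminus: "(g, M) \<in> E \<Longrightarrow> (- g, - M) \<in> E"
  using sgp.neg[of "(g, M)" E] E_sgp by (auto intro: sgp.incl)

lemma E_diff: "(g, M) \<in> E \<Longrightarrow> (h, N) \<in> E \<Longrightarrow> (g - h, M - N) \<in> E"
  using E_add[OF _ E_uminus] by simp

lemma E_commutator: "(g, M) \<in> E \<Longrightarrow> (h, N) \<in> E \<Longrightarrow> (commutator g h, commutator M N) \<in> E"
  unfolding commutator_def by (intro E_diff E_add)

text \<open>Two lifts of one matrix differ by a central element, and in a commutator each such
  element meets its inverse.\<close>

lemma commutator_lift:
  assumes "(a, M) \<in> E" "(a', M) \<in> E" "(b, N) \<in> E" "(b', N) \<in> E"
  shows "commutator a b = commutator a' b'"
proof -
  note [simp del] = add_uminus_conv_diff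
  define z z' where "z = a - a'" and "z' = b - b'"
  have z: "(z, 0) \<in> E" "(z', 0) \<in> E"
    unfolding z_def z'_def using E_diff[OF assms(1,2)] E_diff[OF assms(3,4)] by simp_all
  have a: "a = z + a'" "b = z' + b'" by (simp_all add: z_def z'_def)
  note c = E_central[OF z(1)] E_central[OF z(2)]
  have "commutator a b = z + (a' + z') + b' + (- a' + - z) + (- b' + - z')"
    by (simp add: a commutator_def grp)
  also have "\<dots> = z + (z' + a') + b' + (- z + - a') + (- z' + - b')"
    using c(2)[OF assms(2)] c(1)[OF E_uminus[OF assms(2)]] c(2)[OF E_uminus[OF assms(4)]]
      commutes_neg[of "- a'" z] commutes_neg[of "- b'" z'] by simp
  also have "\<dots> = z + z' + (a' + b' + - z) + (- a' + - z') + - b'"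
    by (simp add: grp)
  also have "\<dots> = z + z' + (- z + (a' + b')) + (- z' + - a') + - b'"
    using c(1)[OF E_add[OF assms(2,4)]] c(2)[OF E_uminus[OF assms(2)]]
      commutes_neg[of "a' + b'" z] commutes_neg[of "- a'" z'] by simp
  also have "\<dots> = z + (z' + - z) + ((a' + b') + - z') + - a' + - b'"
    by (simp add: grp)
  also have "\<dots> = z + (- z + z') + (- z' + (a' + b')) + - a' + - b'"
    using c(1)[OF z(2)] c(2)[OF E_add[OF assms(2,4)]]
      commutes_neg[of z' z] commutes_neg[of "a' + b'" z'] by simp
  also have "\<dots> = commutator a' b'"
    by (simp add: commutator_def grp)
  finally show ?thesis .
qed

definition lift :: "rsl2 \<Rightarrow> 'b" where "lift M = (SOME g. (g, M) \<in> E)"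

lemma lift: "M \<in> rsl2_over A \<Longrightarrow> (lift M, M) \<in> E"
  unfolding lift_def using E_onto by (rule someI_ex)

end

locale central_graph_rational = central_graph A E for A and E :: "('b::group_add \<times> rsl2) set" +
  assumes two_unit: "2 \<in> units" and three_unit: "3 \<in> units"
    and common_divisor: "s \<in> A \<Longrightarrow> t \<in> A \<Longrightarrow> \<exists>r\<in>A. \<exists>m n. s = of_int m * r \<and> t = of_int n * r"
begin

text \<open>Both arguments are integral multiples of one element r, so up to central factors both
  lifts are powers of one lift of \<open>e r\<close>: a central extension of a cyclic group is
  abelian.\<close>

lemma lifts_commute:
  assumes e: "\<And>s t. e (s + t) = e s + e t" and e_over: "\<And>t. t \<in> A \<Longrightarrow> e t \<in> rsl2_over A"
    and st: "s \<in> A" "t \<in> A" and ab: "(a, e s) \<in> E" "(b, e t) \<in> E"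
  shows "a + b = b + a"
proof -
  note [simp del] = add_uminus_conv_diff
  obtain r m n where r: "r \<in> A" "s = of_int m * r" "t = of_int n * r" using common_divisor[OF st] by blast
  obtain c where c: "(c, e r) \<in> E" using E_onto[OF e_over[OF r(1)]] by blast
  note e0 = additive_zero[of e, OF e] and en = additive_uminus[of e, OF e]
  have nat: "\<exists>g\<in>sgp {c}. (g, e (of_nat k * r)) \<in> E" for k
  proof (induction k)
    case 0
    have "(c - c, e r - e r) \<in> E" by (intro E_diff c)
    then show ?case using e0 by (intro bexI[of _ 0] sgp.zero) simp
  next
    case (Suc k)
    then obtain g where "g \<in> sgp {c}" "(g, e (of_nat k * r)) \<in> E" by blast
    then have "c + g \<in> sgp {c}" "(c + g, e (of_nat (Suc k) * r)) \<in> E"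
      using E_add[OF c] by (auto intro: sgp.intros simp: e distrib_right)
    then show ?case by blast
  qed
  have int: "\<exists>g\<in>sgp {c}. (g, e (of_int k * r)) \<in> E" for k
  proof -
    obtain m n where k: "k = int m - int n" using int_diff_cases by blast
    obtain g h where "g \<in> sgp {c}" "(g, e (of_nat m * r)) \<in> E" "h \<in> sgp {c}" "(h, e (of_nat n * r)) \<in> E"
      using nat by meson
    moreover have "e (of_nat m * r) - e (of_nat n * r) = e (of_int k * r)"
    proof -
      have "of_int k * r = of_nat m * r + - (of_nat n * r)" by (simp add: k left_diff_distrib add_uminus_conv_diff)
      then show ?thesis by (simp only: e en diff_conv_add_uminus)
    qed
    ultimately show ?thesis using sgp_diff E_diff by metis
  qed
  obtain g h where g: "g \<in> sgp {c}" "(g, e s) \<in> E" and h: "h \<in> sgp {c}" "(h, e t) \<in> E"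
    using int r by metis
  have "c + h = h + c" using h(1) by (rule sgp_commutes[rotated]) simp
  then have gh: "h + g = g + h" using g(1) by (intro sgp_commutes[of "{c}" h g]) auto
  have z: "(a - g, 0) \<in> E" "(b - h, 0) \<in> E" using E_diff ab g h by fastforce+
  define z z' where "z = a - g" and "z' = b - h"
  have ab': "a = z + g" "b = z' + h" by (simp_all add: z_def z'_def)
  have c: "z' + g = g + z'" "z + z' = z' + z" "z + h = h + z"
    using E_central[OF z(2) g(2)] E_central[OF z(1,2)] E_central[OF z(1) h(2)] by (simp_all only: z_def z'_def)
  have "a + b = z + (g + z') + h" by (simp only: ab' add.assoc)
  also have "\<dots> = z + (z' + g) + h" by (simp only: c(1))
  also have "\<dots> = (z + z') + (g + h)" by (simp only: add.assoc)
  also have "\<dots> = (z' + z) + (h + g)" by (simp only: c(2) gh)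
  also have "\<dots> = z' + (z + h) + g" by (simp only: add.assoc)
  also have "\<dots> = (z' + h) + (z + g)" by (simp only: c(3) add.assoc)
  finally show ?thesis by (simp only: ab')
qed

text \<open>The canonical lift of \<open>e t\<close>. Here \<open>k\<close> is the factor by which
  taking the commutator with diag(2, 1/2) scales the argument: 2^2 - 1 = 3 for upper matrices and
  2^-2 - 1 = -3/4 for lower ones.\<close>

definition hat :: "(rat \<Rightarrow> rsl2) \<Rightarrow> rat \<Rightarrow> rat \<Rightarrow> 'b" where
  "hat e k t = commutator (lift (diagm 2)) (lift (e (t / k)))"

lemma diagm2: "(lift (diagm 2), diagm 2) \<in> E"
  using two_unit by (intro lift) (simp add: rsl2_over_def zero_mem unitsD)

lemma two_A: "2 \<in> A" "1 / 2 \<in> A" "1 / 3 \<in> A"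
  using two_unit three_unit unitsD by auto

context
  fixes e :: "rat \<Rightarrow> rsl2" and k q :: rat
  assumes e: "\<And>s t. e (s + t) = e s + e t" and e_over: "\<And>t. t \<in> A \<Longrightarrow> e t \<in> rsl2_over A"
    and k: "\<And>t. commutator (diagm 2) (e t) = e (k * t)" "k \<noteq> 0" "1 / k \<in> A" "k \<in> A"
    and q: "\<And>t. - diagm 2 + e t + diagm 2 = e (q * t)" "q \<in> A"
begin

lemma div_k: "t \<in> A \<Longrightarrow> t / k \<in> A"
  using mult_mem[OF _ k(3), of t] by simp

lemma hat_lift: "t \<in> A \<Longrightarrow> (hat e k t, e t) \<in> E"
  using E_commutator[OF diagm2 lift[OF e_over[OF div_k]], of t] k by (simp add: hat_def)

lemma hat_eq: "t \<in> A \<Longrightarrow> (h, diagm 2) \<in> E \<Longrightarrow> (a, e (t / k)) \<in> E \<Longrightarrow> hat e k t = commutator h a"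
  unfolding hat_def by (rule commutator_lift[OF diagm2 _ lift[OF e_over[OF div_k]]])

text \<open>Write [h, a b] as [h, a] times the conjugate of [h, b] by a. The conjugation does
  nothing, as [h, b] is a lift of \<open>e t\<close> and so commutes with a by
  \<open>lifts_commute\<close>.\<close>

lemma hat_add: "s \<in> A \<Longrightarrow> t \<in> A \<Longrightarrow> hat e k s + hat e k t = hat e k (s + t)"
proof -
  note [simp del] = add_uminus_conv_diff
  assume s: "s \<in> A" and t: "t \<in> A"
  define h a b where "h = lift (diagm 2)" and "a = lift (e (s / k))" and "b = lift (e (t / k))"
  have h: "(h, diagm 2) \<in> E" and a: "(a, e (s / k)) \<in> E" and b: "(b, e (t / k)) \<in> E"
    unfolding h_def a_def b_def using diagm2 lift e_over div_k s t by auto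
  have "(a + b, e ((s + t) / k)) \<in> E" using E_add[OF a b] by (simp add: e add_divide_distrib)
  then have "hat e k (s + t) = commutator h (a + b)" using s t h by (intro hat_eq add_mem)
  also have "\<dots> = commutator h a + (a + commutator h b) + - a" by (simp add: commutator_def grp)
  also have "a + commutator h b = commutator h b + a"
    using hat_lift[OF t] hat_eq[OF t h b] lifts_commute[OF e e_over div_k[OF s] t a] by simp
  also have "commutator h a + (commutator h b + a) + - a = hat e k s + hat e k t"
    using hat_eq[OF s h a] hat_eq[OF t h b] by (simp add: add.assoc)
  finally show ?thesis by simp
qed

text \<open>The canonical lift can also be formed with the inverse of diag(2, 1/2), into which
  conjugation by a w-element turns this matrix. It rests on the identity [h, a] = a
  [h^-1, h a^-1 h^-1] a^-1, whose inner commutator is a canonical lift and commutes with a. The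
  factor \<open>q\<close> describes conjugation by the inverse of diag(2, 1/2).\<close>

lemma hat_inverse:
  assumes t: "t \<in> A" and h: "(h, - diagm 2) \<in> E" and a: "(a, e (- (t / (k * q)))) \<in> E" and q0: "q \<noteq> 0" "1 / q \<in> A"
  shows "commutator h a = hat e k t"
proof -
  note [simp del] = add_uminus_conv_diff
  have s: "- (t / (k * q)) \<in> A"
    using mult_mem[OF div_k[OF t] q0(2)] uminus_mem by simp
  have h': "(- h, diagm 2) \<in> E" using E_uminus[OF h] by simp
  have "(h + - a + - h, - diagm 2 + - e (- (t / (k * q))) + diagm 2) \<in> E"
    using E_add[OF E_add[OF h E_uminus[OF a]] h'] .
  also have "- diagm 2 + - e (- (t / (k * q))) + diagm 2 = e (t / k)"
    using q(1)[of "t / (k * q)"] additive_uminus[of e, OF e] q0 by simp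
  finally have eq: "hat e k t = commutator (- h) (h + - a + - h)" using t h' by (intro hat_eq)
  have "a + hat e k t = hat e k t + a"
    using lifts_commute[OF e e_over s t a hat_lift[OF t]] .
  then have "hat e k t = a + hat e k t + - a" by (simp add: add.assoc)
  also have "\<dots> = commutator h a" unfolding eq by (simp add: commutator_def grp)
  finally show ?thesis by simp
qed

end

lemma upper_hat:
  "upper (s + t) = upper s + upper t" "t \<in> A \<Longrightarrow> upper t \<in> rsl2_over A"
  "commutator (diagm 2) (upper t) = upper (3 * t)"
  "- diagm 2 + upper t + diagm 2 = upper (1 / 4 * t)"
  by (simp_all add: rsl2_eq_iff rsl2_over_def zero_mem one_mem commutator_def)

lemma lower_hat:
  "lower (s + t) = lower s + lower t" "t \<in> A \<Longrightarrow> lower t \<in> rsl2_over A"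
  "commutator (diagm 2) (lower t) = lower (- (3 / 4) * t)"
  "- diagm 2 + lower t + diagm 2 = lower (4 * t)"
  by (simp_all add: rsl2_eq_iff rsl2_over_def zero_mem one_mem commutator_def)

lemma coeffs: "3 \<in> A" "1 / 4 \<in> A" "4 \<in> A" "- (3 / 4) \<in> A" "1 / (- (3 / 4)) \<in> A"
proof -
  show "3 \<in> A" "4 \<in> A" using nat_mem[of 3] nat_mem[of 4] by simp_all
  show "1 / 4 \<in> A" using mult_mem[OF two_A(2) two_A(2)] by simp
  then show "- (3 / 4) \<in> A" using \<open>3 \<in> A\<close> mult_mem[of 3 "1 / 4"] uminus_mem by simp
  show "1 / (- (3 / 4)) \<in> A" using \<open>4 \<in> A\<close> mult_mem[OF _ two_A(3), of 4] uminus_mem by simp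
qed

definition x_hat :: "rat \<Rightarrow> 'b" where "x_hat = hat upper 3"
definition y_hat :: "rat \<Rightarrow> 'b" where "y_hat = hat lower (- (3 / 4))"

lemma x_hat_lift: "t \<in> A \<Longrightarrow> (x_hat t, upper t) \<in> E"
  unfolding x_hat_def by (rule hat_lift[where q = "1 / 4"]) (use upper_hat coeffs two_A in auto)

lemma y_hat_lift: "t \<in> A \<Longrightarrow> (y_hat t, lower t) \<in> E"
  unfolding y_hat_def by (rule hat_lift[where q = 4]) (use lower_hat coeffs in auto)

lemma steinberg_hat: "steinberg_system A x_hat y_hat"
proof
  show add_x: "x_hat s + x_hat t = x_hat (s + t)" if "s \<in> A" "t \<in> A" for s t
    unfolding x_hat_def by (rule hat_add[where q = "1 / 4"]) (use upper_hat coeffs two_A that in auto)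
  show add_y: "y_hat s + y_hat t = y_hat (s + t)" if "s \<in> A" "t \<in> A" for s t
    unfolding y_hat_def by (rule hat_add[where q = 4]) (use lower_hat coeffs that in auto)
  show "(x_hat u + y_hat (- (1 / u)) + x_hat u) + x_hat t + (x_hat (- u) + y_hat (1 / u) + x_hat (- u)) = y_hat (- (t / u\<^sup>2))"
    if u: "u \<in> units" and t: "t \<in> A" for u t
  proof -
    note [simp del] = add_uminus_conv_diff
    have zx: "x_hat 0 = 0" using add_x[OF zero_mem zero_mem] by (metis add_0_right add_left_cancel)
    have zy: "y_hat 0 = 0" using add_y[OF zero_mem zero_mem] by (metis add_0_right add_left_cancel)
    have nx: "x_hat (- s) = - x_hat s" if "s \<in> A" for s
      using add_x[OF that uminus_mem[OF that]] zx by (metis add.right_inverse minus_unique)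
    have ny: "y_hat (- s) = - y_hat s" if "s \<in> A" for s
      using add_y[OF that uminus_mem[OF that]] zy by (metis add.right_inverse minus_unique)
    define v where "v = 1 / u"
    have uA: "u \<in> A" "v \<in> A" "u \<noteq> 0" using u unitsD by (auto simp: v_def)
    define W where "W = upper u + lower (- v) + upper u"
    define w where "w = x_hat u + y_hat (- v) + x_hat u"
    have w: "(w, W) \<in> E" unfolding w_def W_def
      using uA by (intro E_add x_hat_lift y_hat_lift uminus_mem)
    define h a where "h = lift (diagm 2)" and "a = lift (upper (t / 3))"
    have t3: "t / 3 \<in> A" using mult_mem[OF t two_A(3)] by simp
    have h: "(h, diagm 2) \<in> E" and a: "(a, upper (t / 3)) \<in> E"
      unfolding h_def a_def using diagm2 lift upper_hat(2) t3 by auto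
    have "x_hat (- u) + y_hat v + x_hat (- u) = - w"
      using uA ny[of v] nx[of u] by (simp add: w_def grp)
    then have "(x_hat u + y_hat (- v) + x_hat u) + x_hat t + (x_hat (- u) + y_hat v + x_hat (- u)) = w + x_hat t + - w"
      by (simp add: w_def)
    \<comment> \<open>Conjugation by w is applied inside the commutator: it inverts the diagonal
      matrix and turns the upper matrix into a lower one, which is the situation of
      \<open>hat_inverse\<close>.\<close>
    also have "\<dots> = commutator (w + h + - w) (w + a + - w)"
      unfolding x_hat_def hat_def h_def a_def by (simp add: commutator_def grp)
    also have "\<dots> = y_hat (- (t / u\<^sup>2))"
      unfolding y_hat_def
    proof (rule hat_inverse[where q = 4])
      have "W + diagm 2 + - W = - diagm 2"
        using uA by (simp add: W_def v_def rsl2_eq_iff divide_simps add_uminus_conv_diff)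
      then show "(w + h + - w, - diagm 2) \<in> E" using E_add[OF E_add[OF w h] E_uminus[OF w]] by simp
      have "W + upper (t / 3) + - W = lower (- (- (t / u\<^sup>2) / (- (3 / 4) * 4)))"
        using uA by (simp add: W_def v_def rsl2_eq_iff divide_simps power2_eq_square add_uminus_conv_diff)
      then show "(w + a + - w, lower (- (- (t / u\<^sup>2) / (- (3 / 4) * 4)))) \<in> E"
        using E_add[OF E_add[OF w a] E_uminus[OF w]] by simp
      show "- (t / u\<^sup>2) \<in> A"
        using mult_mem[OF mult_mem[OF t uA(2)] uA(2)] uminus_mem by (simp add: v_def power2_eq_square)
    qed (use lower_hat coeffs in auto)
    finally show ?thesis by (simp add: v_def)
  qed
qed

end

subsection \<open>Universality\<close>

text \<open>h(2) multiplies the argument of x by 4 and divides that of y by 4. So [h(2), x(s)] = x(3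
  s) and [h(2), y(s)] = y(-3 s / 4), and \<open>s\<close> is t / 3 or -4 t / 3.\<close>

lemma (in rat_subring) st_x_commutator:
  assumes two: "2 \<in> units" and three: "3 \<in> units" and ij: "i \<noteq> j" and t: "t \<in> B"
  shows "\<exists>k\<in>carrier St. \<exists>l\<in>carrier St. st_x i j t = k \<otimes>\<^bsub>St\<^esub> l \<otimes>\<^bsub>St\<^esub> inv\<^bsub>St\<^esub> k \<otimes>\<^bsub>St\<^esub> inv\<^bsub>St\<^esub> l"
proof -
  interpret St: group St by (rule St_group)
  let ?c = "cayley St"
  interpret S: steinberg_system B "\<lambda>t. ?c (st_x 1 2 t)" "\<lambda>t. ?c (st_x 2 1 t)"
    by (rule steinberg_cayley[OF St_group st_x_closed st_x_add st_x_conj])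
  note [simp del] = add_uminus_conv_diff
  have c1: "st_x 1 2 s \<in> carrier St" "st_x 2 1 s \<in> carrier St" if "s \<in> B" for s
    using that by (auto intro: st_x_closed)
  define W where "W u = st_x 1 2 u \<otimes>\<^bsub>St\<^esub> st_x 2 1 (- (1 / u)) \<otimes>\<^bsub>St\<^esub> st_x 1 2 u" for u
  have W: "W u \<in> carrier St" "?c (W u) = S.w u" if "u \<in> units" for u
    using c1[of u] c1[of "- (1 / u)"] unitsD[OF that] uminus_mem
    by (simp_all add: W_def S.w_def St.cayley_mult)
  define k where "k = W 2 \<otimes>\<^bsub>St\<^esub> W (- 1)"
  have k: "k \<in> carrier St" "?c k = S.h 2"
    using W[OF two] W[OF units_uminus[OF units_one]] by (simp_all add: k_def S.h_def St.cayley_mult)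
  have sol: "\<exists>k\<in>carrier St. \<exists>l\<in>carrier St. st_x i j t = k \<otimes>\<^bsub>St\<^esub> l \<otimes>\<^bsub>St\<^esub> inv\<^bsub>St\<^esub> k \<otimes>\<^bsub>St\<^esub> inv\<^bsub>St\<^esub> l"
    if l: "s \<in> B" and eq: "S.h 2 + ?c (st_x i j s) = ?c (st_x i j (s + t)) + S.h 2" for s
  proof -
    let ?l = "st_x i j s"
    have lc: "?l \<in> carrier St" "st_x i j (s + t) = st_x i j t \<otimes>\<^bsub>St\<^esub> ?l"
      using st_x_closed[OF ij l] st_x_add[OF ij t l] by (simp_all add: add.commute)
    have "?c (k \<otimes>\<^bsub>St\<^esub> ?l) = ?c (st_x i j t \<otimes>\<^bsub>St\<^esub> ?l \<otimes>\<^bsub>St\<^esub> k)"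
      using eq k lc st_x_closed[OF ij t] by (simp add: St.cayley_mult)
    then have "k \<otimes>\<^bsub>St\<^esub> ?l = st_x i j t \<otimes>\<^bsub>St\<^esub> ?l \<otimes>\<^bsub>St\<^esub> k"
      using k lc st_x_closed[OF ij t] by (intro St.cayley_inj) auto
    then have "k \<otimes>\<^bsub>St\<^esub> ?l \<otimes>\<^bsub>St\<^esub> inv\<^bsub>St\<^esub> k \<otimes>\<^bsub>St\<^esub> inv\<^bsub>St\<^esub> ?l = st_x i j t"
      using k lc st_x_closed[OF ij t] by (simp add: St.m_assoc)
    then show ?thesis using k lc by blast
  qed
  from ij show ?thesis
  proof (rule index_cases)
    assume [simp]: "i = 1" "j = 2"
    have s: "t / 3 \<in> B" using t three by (rule divide_mem)
    show ?thesis by (rule sol[OF s]) (use S.h_x[OF two s] in \<open>simp add: field_simps\<close>)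
  next
    assume [simp]: "i = 2" "j = 1"
    have s: "- (4 * t / 3) \<in> B" using divide_mem[OF mult_mem[OF nat_mem[of 4] t] three] uminus_mem by simp
    show ?thesis by (rule sol[OF s]) (use S.h_y[OF two s] in \<open>simp add: field_simps\<close>)
  qed
qed

text \<open>Perfectness in the form needed for the surjectivity on homology, where it is applied to
  subgroups only known to contain all commutators.\<close>

lemma (in rat_subring) St_perfect:
  assumes "2 \<in> units" "3 \<in> units" and D: "subgroup D St"
    and c: "\<And>a b. a \<in> carrier St \<Longrightarrow> b \<in> carrier St \<Longrightarrow> a \<otimes>\<^bsub>St\<^esub> b \<otimes>\<^bsub>St\<^esub> inv\<^bsub>St\<^esub> a \<otimes>\<^bsub>St\<^esub> inv\<^bsub>St\<^esub> b \<in> D"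
  shows "carrier St \<subseteq> D"
proof
  interpret D: subgroup D St by (rule D)
  interpret St: group St by (rule St_group)
  have x: "st_x i j t \<in> D" if "i \<noteq> j" "t \<in> B" for i j t
    using st_x_commutator[OF assms(1,2) that] c by auto
  fix g assume "g \<in> carrier St"
  then show "g \<in> D" by (induction rule: st_induct) (auto simp: x)
qed

text \<open>Existence: the canonical lifts in \<open>F\<close> satisfy the Steinberg relations.
  Uniqueness: every generator is a commutator, and two homomorphisms over SL_2 send a commutator to
  commutators of lifts of the same two matrices.\<close>

lemma (in rat_subring) St_universal:
  fixes F :: "('f, 'm) monoid_scheme"
  assumes units: "2 \<in> units" "3 \<in> units"
    and common_divisor: "\<And>s t. s \<in> B \<Longrightarrow> t \<in> B \<Longrightarrow> \<exists>r\<in>B. \<exists>m n. s = of_int m * r \<and> t = of_int n * r"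
    and F: "central_extension F (SL2 B) \<rho>"
  shows "\<exists>!h. h \<in> hom St F \<inter> extensional (carrier St) \<and> (\<forall>g\<in>carrier St. \<rho> (h g) = steinberg_map B g)"
proof -
  have grpF: "group F" and \<rho>: "\<rho> \<in> hom F (SL2 B)" "\<rho> ` carrier F = carrier (SL2 B)"
    and cent: "\<And>z g. z \<in> kernel F (SL2 B) \<rho> \<Longrightarrow> g \<in> carrier F \<Longrightarrow> z \<otimes>\<^bsub>F\<^esub> g = g \<otimes>\<^bsub>F\<^esub> z"
    using F by (auto simp: central_extension_def epi_def)
  interpret F: group F by (rule grpF)
  interpret St: group St by (rule St_group)
  interpret \<rho>: group_hom F "SL2 B" \<rho>
    using grpF SL2_group \<rho>(1) by (simp add: group_hom_def group_hom_axioms_def)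
  interpret \<phi>: group_hom St "SL2 B" "steinberg_map B"
    using St_group SL2_group steinberg_map_hom by (simp add: group_hom_def group_hom_axioms_def)
  let ?c = "cayley F"
  \<comment> \<open>The graph of \<rho>, with elements of \<open>F\<close> replaced by permutations
    so that the construction of canonical lifts applies.\<close>
  define E where "E = {(?c g, M) | g M. g \<in> carrier F \<and> M \<in> rsl2_over B \<and> \<rho> g = mat_of M}"
  have c1: "?c \<one>\<^bsub>F\<^esub> = 0" using F.cayley_mult[of "\<one>\<^bsub>F\<^esub>" "\<one>\<^bsub>F\<^esub>"] by simp (metis add_0_right add_left_cancel)
  interpret E: central_graph_rational B E
  proof
    have "q \<in> E" if "q \<in> sgp E" for q
      using that
    proof induction
      case zero
      have "\<rho> \<one>\<^bsub>F\<^esub> = mat_of 0" "0 \<in> rsl2_over B"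
        by (simp_all add: mat_of_zero SL2_one rsl2_over_def zero_mem one_mem)
      then have "(?c \<one>\<^bsub>F\<^esub>, 0) \<in> E" unfolding E_def using F.one_closed by blast
      then show ?case by (simp add: c1 zero_prod_def)
    next
      case (add q r)
      then obtain g M h N where *: "q = (?c g, M)" "g \<in> carrier F" "M \<in> rsl2_over B" "\<rho> g = mat_of M"
        "r = (?c h, N)" "h \<in> carrier F" "N \<in> rsl2_over B" "\<rho> h = mat_of N" by (auto simp: E_def)
      then have "\<rho> (g \<otimes>\<^bsub>F\<^esub> h) = mat_of (M + N)" "M + N \<in> rsl2_over B" "q + r = (?c (g \<otimes>\<^bsub>F\<^esub> h), M + N)"
        by (simp_all add: SL2_mult mat_of_add F.cayley_mult rsl2_over_def add_mem mult_mem)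
      then show ?case unfolding E_def using * by blast
    next
      case (neg q)
      then obtain g M where *: "q = (?c g, M)" "g \<in> carrier F" "M \<in> rsl2_over B" "\<rho> g = mat_of M" by (auto simp: E_def)
      then have "\<rho> (inv\<^bsub>F\<^esub> g) = mat_of (- M)" "- M \<in> rsl2_over B" "- q = (?c (inv\<^bsub>F\<^esub> g), - M)"
        by (simp_all add: SL2_inv F.cayley_inv) (simp add: rsl2_over_def uminus_mem)
      then show ?case unfolding E_def using * by blast
    qed
    then show "sgp E \<subseteq> E" by blast
    show "\<exists>g. (g, M) \<in> E" if "M \<in> rsl2_over B" for M
    proof -
      have "mat_of M \<in> \<rho> ` carrier F" using that by (simp add: \<rho>(2) SL2_carrier)
      then obtain g where "g \<in> carrier F" "\<rho> g = mat_of M" by auto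
      then show ?thesis using that unfolding E_def by blast
    qed
    show "z + g = g + z" if "(z, 0) \<in> E" "(g, M) \<in> E" for z g M
    proof -
      obtain z' where z': "z = ?c z'" "z' \<in> carrier F" "\<rho> z' = mat_of 0" using \<open>(z, 0) \<in> E\<close> by (auto simp: E_def)
      obtain g' where g': "g = ?c g'" "g' \<in> carrier F" using \<open>(g, M) \<in> E\<close> by (auto simp: E_def)
      have "z' \<in> kernel F (SL2 B) \<rho>" using z' by (simp add: kernel_def mat_of_zero SL2_one)
      from cent[OF this g'(2)] show ?thesis
        using z' g' by (metis F.cayley_mult)
    qed
  qed (use units common_divisor in auto)
  interpret S: steinberg_system B E.x_hat E.y_hat by (rule E.steinberg_hat)
  \<comment> \<open>The canonical lifts are permutations; they come from elements of
    \<open>F\<close> because they occur as first components of \<open>E\<close>.\<close>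
  define f where "f i j t = inv_into (carrier F) ?c (if i = (1::2) then E.x_hat t else E.y_hat t)" for i j :: 2 and t
  have f: "f i j t \<in> carrier F" "?c (f i j t) = (if i = 1 then E.x_hat t else E.y_hat t)" if "t \<in> B" for i j t
  proof -
    have "E.x_hat t \<in> ?c ` carrier F" "E.y_hat t \<in> ?c ` carrier F"
      using E.x_hat_lift[OF that] E.y_hat_lift[OF that] by (auto simp: E_def)
    then show "f i j t \<in> carrier F" "?c (f i j t) = (if i = 1 then E.x_hat t else E.y_hat t)"
      unfolding f_def by (simp_all add: inv_into_into f_inv_into_f)
  qed
  have f_add: "f i j s \<otimes>\<^bsub>F\<^esub> f i j t = f i j (s + t)" if "i \<noteq> j" "s \<in> B" "t \<in> B" for i j s t
    by (rule F.cayley_inj) (use that f add_mem in \<open>simp_all add: F.cayley_mult S.x_add S.y_add\<close>)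
  have f_conj: "(f i j u \<otimes>\<^bsub>F\<^esub> f j i (- v) \<otimes>\<^bsub>F\<^esub> f i j u) \<otimes>\<^bsub>F\<^esub> f i j t \<otimes>\<^bsub>F\<^esub>
        (f i j (- u) \<otimes>\<^bsub>F\<^esub> f j i v \<otimes>\<^bsub>F\<^esub> f i j (- u)) = f j i (- (v\<^sup>2 * t))"
    if ij: "i \<noteq> j" and uv: "u \<in> B" "v \<in> B" "u * v = 1" and t: "t \<in> B" for i j u v t
  proof -
    have u0: "u \<noteq> 0" using uv by auto
    with uv have v: "v = 1 / u" by (simp add: field_simps)
    have u: "u \<in> units" using uv u0 v by (simp add: units_def)
    have m: "u \<in> B" "1 / u \<in> B" "- (1 / u) \<in> B" "- u \<in> B" "- (t / u\<^sup>2) \<in> B"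
      using uv v uminus_mem divide_mem[OF divide_mem[OF t u] u] by (auto simp: power2_eq_square)
    note cc = f(1)[OF m(1)] f(1)[OF m(2)] f(1)[OF m(3)] f(1)[OF m(4)] f(1)[OF m(5)] f(1)[OF t]
    note cs = f(2)[OF m(1)] f(2)[OF m(2)] f(2)[OF m(3)] f(2)[OF m(4)] f(2)[OF m(5)] f(2)[OF t]
    have "(f i j u \<otimes>\<^bsub>F\<^esub> f j i (- (1 / u)) \<otimes>\<^bsub>F\<^esub> f i j u) \<otimes>\<^bsub>F\<^esub> f i j t \<otimes>\<^bsub>F\<^esub>
        (f i j (- u) \<otimes>\<^bsub>F\<^esub> f j i (1 / u) \<otimes>\<^bsub>F\<^esub> f i j (- u)) = f j i (- (t / u\<^sup>2))"
    proof (rule F.cayley_inj)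
      show "?c ((f i j u \<otimes>\<^bsub>F\<^esub> f j i (- (1 / u)) \<otimes>\<^bsub>F\<^esub> f i j u) \<otimes>\<^bsub>F\<^esub> f i j t \<otimes>\<^bsub>F\<^esub>
        (f i j (- u) \<otimes>\<^bsub>F\<^esub> f j i (1 / u) \<otimes>\<^bsub>F\<^esub> f i j (- u))) = ?c (f j i (- (t / u\<^sup>2)))"
        using ij by (rule index_cases)
          (use S.w_conj[OF u t] S.y_conj[OF u t] in \<open>simp_all add: F.cayley_mult cc cs\<close>)
    qed (simp_all add: cc)
    then show ?thesis by (simp add: v power_divide)
  qed
  define h where "h = restrict (presented_hom F (\<lambda>(i, j, t). f i j t)) (carrier St)"
  have h0: "presented_hom F (\<lambda>(i, j, t). f i j t) \<in> hom St F"
    by (rule St_hom(1)[OF grpF]; use f f_add f_conj in blast)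
  have h0x: "presented_hom F (\<lambda>(i, j, t). f i j t) (st_x i j t) = f i j t" if "i \<noteq> j" "t \<in> B" for i j t
    by (rule St_hom(2)[OF grpF]; use f f_add f_conj that in blast)
  have h: "h \<in> hom St F" using h0 by (auto simp: h_def hom_def Pi_iff)
  have hx: "h (st_x i j t) = f i j t" if "i \<noteq> j" "t \<in> B" for i j t
    using h0x[OF that] st_x_closed[OF that] by (simp add: h_def)
  interpret h: group_hom St F h
    using St_group grpF h by (simp add: group_hom_def group_hom_axioms_def)
  have \<rho>f: "\<rho> (f i j t) = mat_of (elem i t)" if "t \<in> B" for i j t
  proof -
    have "(?c (f i j t), elem i t) \<in> E"
      using f(2)[OF that] E.x_hat_lift[OF that] E.y_hat_lift[OF that] by (simp add: elem_def)
    then obtain g where g: "?c (f i j t) = ?c g" "g \<in> carrier F" "\<rho> g = mat_of (elem i t)" by (auto simp: E_def)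
    then have "f i j t = g" using f(1)[OF that] by (intro F.cayley_inj) auto
    then show ?thesis using g by simp
  qed
  have \<rho>h: "\<rho> (h g) = steinberg_map B g" if "g \<in> carrier St" for g
    using that
  proof (induction rule: st_induct)
    case one
    then show ?case by simp
  next
    case (gen i j t g)
    then show ?case using st_x_closed f(1) by (simp add: hx \<rho>f steinberg_map_st_x)
  next
    case (inv_gen i j t g)
    then show ?case using st_x_closed f(1) by (simp add: hx \<rho>f steinberg_map_st_x)
  qed
  show ?thesis
  proof (rule ex1I[of _ h])
    show "h \<in> hom St F \<inter> extensional (carrier St) \<and> (\<forall>g\<in>carrier St. \<rho> (h g) = steinberg_map B g)"
      using h \<rho>h by (simp add: h_def)
    fix h' assume h': "h' \<in> hom St F \<inter> extensional (carrier St) \<and> (\<forall>g\<in>carrier St. \<rho> (h' g) = steinberg_map B g)"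
    interpret h': group_hom St F h'
      using St_group grpF h' by (simp add: group_hom_def group_hom_axioms_def)
    have inE: "\<exists>M. (?c (h g), M) \<in> E \<and> (?c (h' g), M) \<in> E" if g: "g \<in> carrier St" for g
    proof -
      obtain M where M: "M \<in> rsl2_over B" "steinberg_map B g = mat_of M"
        using \<phi>.hom_closed[OF g] by (auto simp: SL2_carrier)
      then have "(?c (h g), M) \<in> E" "(?c (h' g), M) \<in> E"
        unfolding E_def using h.hom_closed[OF g] h'.hom_closed[OF g] \<rho>h[OF g] h' g by force+
      then show ?thesis by blast
    qed
    have x: "h' (st_x i j t) = h (st_x i j t)" if ij: "i \<noteq> j" "t \<in> B" for i j t
    proof -
      obtain k l where kl: "k \<in> carrier St" "l \<in> carrier St"
        "st_x i j t = k \<otimes>\<^bsub>St\<^esub> l \<otimes>\<^bsub>St\<^esub> inv\<^bsub>St\<^esub> k \<otimes>\<^bsub>St\<^esub> inv\<^bsub>St\<^esub> l"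
        using st_x_commutator[OF units ij] by blast
      obtain M N where "(?c (h k), M) \<in> E" "(?c (h' k), M) \<in> E" "(?c (h l), N) \<in> E" "(?c (h' l), N) \<in> E"
        using inE kl by meson
      then have "commutator (?c (h' k)) (?c (h' l)) = commutator (?c (h k)) (?c (h l))"
        by (intro E.commutator_lift)
      then have "?c (h' (st_x i j t)) = ?c (h (st_x i j t))"
        using kl by (simp add: F.cayley_mult F.cayley_inv commutator_def)
      then show ?thesis using st_x_closed[OF ij] by (intro F.cayley_inj) auto
    qed
    have "h' g = h g" if "g \<in> carrier St" for g
      using that by (induction rule: st_induct) (simp_all add: x st_x_closed)
    then show "h' = h" using h' by (intro extensionalityI[of _ "carrier St"]) (auto simp: h_def)
  qed
qed

lemma S_integers_common_divisor:
  assumes "s \<in> S_integers S" "t \<in> S_integers S"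
  shows "\<exists>r\<in>S_integers S. \<exists>m n. s = of_int m * r \<and> t = of_int n * r"
proof -
  obtain a m b n where *: "s = of_int a / of_nat m" "smooth S m" "t = of_int b / of_nat n" "smooth S n"
    using assms by (auto simp: S_integers_def)
  then have "m > 0" "n > 0" using smooth_pos by auto
  then have "s = of_int (a * int n) * (1 / of_nat (m * n))" "t = of_int (b * int m) * (1 / of_nat (m * n))"
    unfolding *(1,3) by (simp_all add: field_simps)
  moreover have "1 / of_nat (m * n) \<in> S_integers S"
    using S_integersI[OF smooth_mult[OF *(2,4)], of 1] by simp
  ultimately show ?thesis by blast
qed

subsection \<open>Extensions defined by two-cocycles\<close>

text \<open>The cocycle need not be normalised, whence the first component f(1,1)^-1 of the unit.
  The tautological cocycle with values in bar chains is indeed not normalised.\<close>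

definition cocycle_extension ::
  "('m, 'k) monoid_scheme \<Rightarrow> ('a, 'n) monoid_scheme \<Rightarrow> ('a \<Rightarrow> 'a \<Rightarrow> 'm) \<Rightarrow> ('m \<times> 'a) monoid" where
  "cocycle_extension M G f =
     \<lparr>carrier = carrier M \<times> carrier G,
      monoid.mult = (\<lambda>(m, a) (n, b). (m \<otimes>\<^bsub>M\<^esub> n \<otimes>\<^bsub>M\<^esub> f a b, a \<otimes>\<^bsub>G\<^esub> b)),
      one = (inv\<^bsub>M\<^esub> f \<one>\<^bsub>G\<^esub> \<one>\<^bsub>G\<^esub>, \<one>\<^bsub>G\<^esub>)\<rparr>"

lemma cocycle_extension_central:
  assumes "comm_group M" "group G"
    and f: "\<And>a b. a \<in> carrier G \<Longrightarrow> b \<in> carrier G \<Longrightarrow> f a b \<in> carrier M"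
    and cocycle: "\<And>a b c. a \<in> carrier G \<Longrightarrow> b \<in> carrier G \<Longrightarrow> c \<in> carrier G \<Longrightarrow>
      f b c \<otimes>\<^bsub>M\<^esub> f a (b \<otimes>\<^bsub>G\<^esub> c) = f a b \<otimes>\<^bsub>M\<^esub> f (a \<otimes>\<^bsub>G\<^esub> b) c"
  shows "central_extension (cocycle_extension M G f) G snd"
    and "\<And>a. a \<in> carrier G \<Longrightarrow> f \<one>\<^bsub>G\<^esub> a = f \<one>\<^bsub>G\<^esub> \<one>\<^bsub>G\<^esub>"
    and "\<And>a. a \<in> carrier G \<Longrightarrow> f a \<one>\<^bsub>G\<^esub> = f \<one>\<^bsub>G\<^esub> \<one>\<^bsub>G\<^esub>"
proof -
  interpret M: comm_group M by fact
  interpret G: group G by fact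
  let ?F = "cocycle_extension M G f"
  show f1: "f \<one>\<^bsub>G\<^esub> a = f \<one>\<^bsub>G\<^esub> \<one>\<^bsub>G\<^esub>" if "a \<in> carrier G" for a
    using cocycle[of "\<one>\<^bsub>G\<^esub>" "\<one>\<^bsub>G\<^esub>" a] that f[of "\<one>\<^bsub>G\<^esub>" a] f[of "\<one>\<^bsub>G\<^esub>" "\<one>\<^bsub>G\<^esub>"] by simp
  show f2: "f a \<one>\<^bsub>G\<^esub> = f \<one>\<^bsub>G\<^esub> \<one>\<^bsub>G\<^esub>" if "a \<in> carrier G" for a
    using cocycle[of a "\<one>\<^bsub>G\<^esub>" "\<one>\<^bsub>G\<^esub>"] that f[of a "\<one>\<^bsub>G\<^esub>"] f[of "\<one>\<^bsub>G\<^esub>" "\<one>\<^bsub>G\<^esub>"]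
    by simp
  have grp: "group ?F"
  proof (rule groupI)
    show "p \<otimes>\<^bsub>?F\<^esub> q \<in> carrier ?F" if "p \<in> carrier ?F" "q \<in> carrier ?F" for p q
      using that f by (auto simp: cocycle_extension_def)
    show "\<one>\<^bsub>?F\<^esub> \<in> carrier ?F" using f by (simp add: cocycle_extension_def)
    show "p \<otimes>\<^bsub>?F\<^esub> q \<otimes>\<^bsub>?F\<^esub> r = p \<otimes>\<^bsub>?F\<^esub> (q \<otimes>\<^bsub>?F\<^esub> r)"
      if "p \<in> carrier ?F" "q \<in> carrier ?F" "r \<in> carrier ?F" for p q r
    proof -
      obtain m a n b k c where pqr: "p = (m, a)" "q = (n, b)" "r = (k, c)" by (metis surj_pair)
      have c: "m \<in> carrier M" "n \<in> carrier M" "k \<in> carrier M" "a \<in> carrier G" "b \<in> carrier G" "c \<in> carrier G"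
        using that pqr by (auto simp: cocycle_extension_def)
      have "m \<otimes>\<^bsub>M\<^esub> n \<otimes>\<^bsub>M\<^esub> f a b \<otimes>\<^bsub>M\<^esub> k \<otimes>\<^bsub>M\<^esub> f (a \<otimes>\<^bsub>G\<^esub> b) c
          = m \<otimes>\<^bsub>M\<^esub> n \<otimes>\<^bsub>M\<^esub> k \<otimes>\<^bsub>M\<^esub> (f a b \<otimes>\<^bsub>M\<^esub> f (a \<otimes>\<^bsub>G\<^esub> b) c)"
        using c f by (simp add: M.m_ac)
      also have "\<dots> = m \<otimes>\<^bsub>M\<^esub> (n \<otimes>\<^bsub>M\<^esub> k \<otimes>\<^bsub>M\<^esub> f b c) \<otimes>\<^bsub>M\<^esub> f a (b \<otimes>\<^bsub>G\<^esub> c)"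
        unfolding cocycle[OF c(4-6), symmetric] using c f by (simp add: M.m_ac)
      finally show ?thesis using c by (simp add: pqr cocycle_extension_def G.m_assoc)
    qed
    show "\<one>\<^bsub>?F\<^esub> \<otimes>\<^bsub>?F\<^esub> p = p" if pF: "p \<in> carrier ?F" for p
    proof -
      obtain m a where p: "p = (m, a)" "m \<in> carrier M" "a \<in> carrier G"
        using pF by (auto simp: cocycle_extension_def)
      have "inv\<^bsub>M\<^esub> f \<one>\<^bsub>G\<^esub> \<one>\<^bsub>G\<^esub> \<otimes>\<^bsub>M\<^esub> m \<otimes>\<^bsub>M\<^esub> f \<one>\<^bsub>G\<^esub> \<one>\<^bsub>G\<^esub> = m"
      proof -
        have o: "f \<one>\<^bsub>G\<^esub> \<one>\<^bsub>G\<^esub> \<in> carrier M" by (rule f) auto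
        have "inv\<^bsub>M\<^esub> f \<one>\<^bsub>G\<^esub> \<one>\<^bsub>G\<^esub> \<otimes>\<^bsub>M\<^esub> m = m \<otimes>\<^bsub>M\<^esub> inv\<^bsub>M\<^esub> f \<one>\<^bsub>G\<^esub> \<one>\<^bsub>G\<^esub>"
          using p o by (intro M.m_comm) auto
        then show ?thesis using p o by (simp add: M.m_assoc)
      qed
      then show ?thesis using p by (simp add: cocycle_extension_def f1[OF p(3)])
    qed
    show "\<exists>q\<in>carrier ?F. q \<otimes>\<^bsub>?F\<^esub> p = \<one>\<^bsub>?F\<^esub>" if pF: "p \<in> carrier ?F" for p
    proof -
      obtain m a where p: "p = (m, a)" "m \<in> carrier M" "a \<in> carrier G"
        using pF by (auto simp: cocycle_extension_def)
      let ?g = "f (inv\<^bsub>G\<^esub> a) a" and ?o = "f \<one>\<^bsub>G\<^esub> \<one>\<^bsub>G\<^esub>"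
      have g: "?g \<in> carrier M" "?o \<in> carrier M" using f p by auto
      have "inv\<^bsub>M\<^esub> ?o \<otimes>\<^bsub>M\<^esub> inv\<^bsub>M\<^esub> ?g \<otimes>\<^bsub>M\<^esub> inv\<^bsub>M\<^esub> m \<otimes>\<^bsub>M\<^esub> m \<otimes>\<^bsub>M\<^esub> ?g =
          inv\<^bsub>M\<^esub> ?o \<otimes>\<^bsub>M\<^esub> (inv\<^bsub>M\<^esub> ?g \<otimes>\<^bsub>M\<^esub> ((inv\<^bsub>M\<^esub> m \<otimes>\<^bsub>M\<^esub> m) \<otimes>\<^bsub>M\<^esub> ?g))"
        using p g by (simp add: M.m_assoc del: M.l_inv)
      also have "\<dots> = inv\<^bsub>M\<^esub> ?o" using p g by simp
      finally show ?thesis using p g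
        by (intro bexI[of _ "(inv\<^bsub>M\<^esub> ?o \<otimes>\<^bsub>M\<^esub> inv\<^bsub>M\<^esub> ?g \<otimes>\<^bsub>M\<^esub> inv\<^bsub>M\<^esub> m, inv\<^bsub>G\<^esub> a)"])
          (simp_all add: cocycle_extension_def)
    qed
  qed
  moreover have "snd \<in> epi ?F G"
  proof -
    have "snd \<in> hom ?F G" by (rule homI) (auto simp: cocycle_extension_def)
    moreover have "a \<in> snd ` carrier ?F" if "a \<in> carrier G" for a
      using that by (intro image_eqI[of _ _ "(\<one>\<^bsub>M\<^esub>, a)"]) (auto simp: cocycle_extension_def)
    ultimately show ?thesis by (auto simp: epi_iff_subset)
  qed
  moreover have "z \<otimes>\<^bsub>?F\<^esub> p = p \<otimes>\<^bsub>?F\<^esub> z" if zp: "z \<in> kernel ?F G snd" "p \<in> carrier ?F" for z p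
  proof -
    obtain m n a where z: "z = (m, \<one>\<^bsub>G\<^esub>)" "m \<in> carrier M" and p: "p = (n, a)" "n \<in> carrier M" "a \<in> carrier G"
      using zp by (auto simp: cocycle_extension_def kernel_def)
    then show ?thesis using f1[OF p(3)] f2[OF p(3)] by (simp add: cocycle_extension_def M.m_comm)
  qed
  ultimately show "central_extension ?F G snd"
    using \<open>group G\<close> unfolding central_extension_def by blast
qed

subsection \<open>Low-degree bar complex\<close>

definition bar_basis :: "('a, 'm) monoid_scheme \<Rightarrow> nat \<Rightarrow> 'a list set" where
  "bar_basis G n = {xs. length xs = n \<and> set xs \<subseteq> carrier G}"

lemma bar_chains_basis: "bar_chains G n = free_Abelian_group (bar_basis G n)"
  by (simp add: bar_chains_def bar_basis_def)

lemma bar_basis_1: "xs \<in> bar_basis G (Suc 0) \<longleftrightarrow> (\<exists>a\<in>carrier G. xs = [a])"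
  by (auto simp: bar_basis_def length_Suc_conv)

lemma bar_basis_2: "xs \<in> bar_basis G 2 \<longleftrightarrow> (\<exists>a\<in>carrier G. \<exists>b\<in>carrier G. xs = [a, b])"
  by (auto simp: bar_basis_def length_Suc_conv numeral_2_eq_2)

lemma bar_basis_3: "xs \<in> bar_basis G 3 \<longleftrightarrow> (\<exists>a\<in>carrier G. \<exists>b\<in>carrier G. \<exists>c\<in>carrier G. xs = [a, b, c])"
  by (auto simp: bar_basis_def length_Suc_conv numeral_3_eq_3)

lemma bar_boundary_add: "bar_boundary G (c + d) = bar_boundary G c + bar_boundary G d"
  and bar_boundary_diff: "bar_boundary G (c - d) = bar_boundary G c - bar_boundary G d"
  and bar_boundary_minus: "bar_boundary G (- c) = - bar_boundary G c"
  and bar_boundary_0: "bar_boundary G 0 = 0"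
  by (simp_all add: bar_boundary_def frag_extend_add frag_extend_diff frag_extend_minus)

lemma bar_boundary_2: "bar_boundary G (frag_of [a, b]) = frag_of [b] - frag_of [a \<otimes>\<^bsub>G\<^esub> b] + frag_of [a]"
  by (simp add: bar_boundary_def)

lemma bar_boundary_3: "bar_boundary G (frag_of [a, b, c]) =
    frag_of [b, c] - frag_of [a \<otimes>\<^bsub>G\<^esub> b, c] + frag_of [a, b \<otimes>\<^bsub>G\<^esub> c] - frag_of [a, b]"
  by (simp add: bar_boundary_def numeral_2_eq_2 lessThan_Suc)

lemma free_Abelian_hom_additive:
  assumes "h \<in> hom (free_Abelian_group S) H" "comm_group H" "Poly_Mapping.keys c \<subseteq> S" "Poly_Mapping.keys d \<subseteq> S"
  shows "h (c + d) = h c \<otimes>\<^bsub>H\<^esub> h d" "h (c - d) = h c \<otimes>\<^bsub>H\<^esub> inv\<^bsub>H\<^esub> h d" "h (- c) = inv\<^bsub>H\<^esub> h c" "h 0 = \<one>\<^bsub>H\<^esub>" "h c \<in> carrier H"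
proof -
  interpret H: comm_group H by fact
  interpret h: group_hom "free_Abelian_group S" H h
    using assms(1) H.group_axioms by (simp add: group_hom_def group_hom_axioms_def)
  show add: "h (c + d) = h c \<otimes>\<^bsub>H\<^esub> h d"
    using h.hom_mult[of c d] assms by simp
  show min: "h (- c) = inv\<^bsub>H\<^esub> h c"
    using h.hom_inv[of c] assms by simp
  have "h (- d) = inv\<^bsub>H\<^esub> h d"
    using h.hom_inv[of d] assms by simp
  then show "h (c - d) = h c \<otimes>\<^bsub>H\<^esub> inv\<^bsub>H\<^esub> h d"
    using h.hom_mult[of c "- d"] assms by simp
  show "h 0 = \<one>\<^bsub>H\<^esub>" using h.hom_one by simp
  show "h c \<in> carrier H" using h.hom_closed[of c] assms by simp
qed

lemma free_Abelian_hom_eq: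
  assumes "h \<in> hom (free_Abelian_group S) H" "h' \<in> hom (free_Abelian_group S) H" "comm_group H"
    and "\<And>a. a \<in> S \<Longrightarrow> h (frag_of a) = h' (frag_of a)" and "Poly_Mapping.keys c \<subseteq> S"
  shows "h c = h' c"
  using assms(5)
proof (induction c rule: free_Abelian_group_induct[consumes 1, case_names zero diff gen])
  case zero
  show ?case using free_Abelian_hom_additive(4)[OF assms(1,3), of 0 0] free_Abelian_hom_additive(4)[OF assms(2,3), of 0 0] by simp
next
  case (diff x y)
  then show ?case using free_Abelian_hom_additive(2)[OF assms(1,3)] free_Abelian_hom_additive(2)[OF assms(2,3)] by simp
next
  case (gen a)
  then show ?case by (rule assms(4))
qed

subsection \<open>The second homology of the base of a universal central extension\<close>

locale central_extension_section =
  fixes E :: "('e, 'm) monoid_scheme" (structure) and G :: "('a, 'n) monoid_scheme" and \<pi> :: "'e \<Rightarrow> 'a" and s :: "'a \<Rightarrow> 'e"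
  assumes ext: "central_extension E G \<pi>" and sec: "set_section E G \<pi> s"
begin

lemma E_group: "group E" and G_group: "group G" and \<pi>_hom: "\<pi> \<in> hom E G"
  using ext by (auto simp: central_extension_def epi_def)

sublocale E: group E by (rule E_group)
sublocale G: group G by (rule G_group)
sublocale \<pi>: group_hom E G \<pi>
  using \<pi>_hom E_group G_group by (simp add: group_hom_def group_hom_axioms_def)

abbreviation "ker \<equiv> kernel E G \<pi>"
abbreviation "K \<equiv> kernel_group E G \<pi>"

lemma s: "g \<in> carrier G \<Longrightarrow> s g \<in> carrier E" "g \<in> carrier G \<Longrightarrow> \<pi> (s g) = g"
  using sec by (auto simp: set_section_def)

lemma central: "z \<in> ker \<Longrightarrow> x \<in> carrier E \<Longrightarrow> z \<otimes> x = x \<otimes> z"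
  using ext by (auto simp: central_extension_def)

lemma kerD: "z \<in> ker \<Longrightarrow> z \<in> carrier E" "z \<in> ker \<Longrightarrow> \<pi> z = \<one>\<^bsub>G\<^esub>"
  by (auto simp: kernel_def)

lemma ker_subgroup: "subgroup ker E" by (rule \<pi>.subgroup_kernel)

lemma K_simps: "carrier K = ker" "x \<otimes>\<^bsub>K\<^esub> y = x \<otimes> y" "\<one>\<^bsub>K\<^esub> = \<one>"
  by (simp_all add: kernel_group_def)

lemma K_group: "comm_group K"
proof -
  interpret K: group K
    unfolding kernel_group_def using subgroup.subgroup_is_group[OF ker_subgroup E_group] .
  show ?thesis by (rule K.group_comm_groupI) (simp add: K_simps central kerD)
qed

sublocale K: comm_group K by (rule K_group)

lemma K_inv: "z \<in> ker \<Longrightarrow> inv\<^bsub>K\<^esub> z = inv z"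
  unfolding kernel_group_def by (rule E.m_inv_consistent[OF ker_subgroup])

lemma K_pow: "z \<in> ker \<Longrightarrow> z [^] (n::int) = z [^]\<^bsub>K\<^esub> n"
  unfolding kernel_group_def by (rule E.int_pow_consistent[OF ker_subgroup])

lemma K_pow_closed: "z \<in> ker \<Longrightarrow> z [^]\<^bsub>K\<^esub> (n::int) \<in> ker"
  using K.int_pow_closed[of z n] by (simp add: K_simps)

lemma ker_closed: "y \<in> ker \<Longrightarrow> z \<in> ker \<Longrightarrow> y \<otimes> z \<in> ker" "z \<in> ker \<Longrightarrow> inv z \<in> ker"
  using ker_subgroup by (auto dest: subgroup.m_closed subgroup.m_inv_closed)

section \<open>The chain map given by a section\<close>

definition \<psi> :: "'a list \<Rightarrow> 'e" where
  "\<psi> xs = s (xs ! 0) \<otimes> s (xs ! 1) \<otimes> inv s (xs ! 0 \<otimes>\<^bsub>G\<^esub> xs ! 1)"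

abbreviation "\<Psi> \<equiv> section_chain_map E G \<pi> s"

lemma \<psi>: "a \<in> carrier G \<Longrightarrow> b \<in> carrier G \<Longrightarrow> \<psi> [a, b] \<in> ker"
  using s by (simp add: \<psi>_def kernel_def)

lemma \<psi>_ker: "xs \<in> bar_basis G 2 \<Longrightarrow> \<psi> xs \<in> ker"
  using \<psi> by (auto simp: bar_basis_2)

lemma s_mult: "a \<in> carrier G \<Longrightarrow> b \<in> carrier G \<Longrightarrow> s a \<otimes> s b = \<psi> [a, b] \<otimes> s (a \<otimes>\<^bsub>G\<^esub> b)"
  using s by (simp add: \<psi>_def E.m_assoc)

text \<open>Cancellation can make the support of a sum smaller than the union of the supports; over
  a common finite index set the products can be compared factor by factor.\<close>

lemma \<Psi>_superset:
  assumes "finite T" "Poly_Mapping.keys c \<subseteq> T" "T \<subseteq> bar_basis G 2"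
  shows "\<Psi> c = finprod K (\<lambda>xs. \<psi> xs [^]\<^bsub>K\<^esub> Poly_Mapping.lookup c xs) T"
proof -
  have "\<Psi> c = finprod K (\<lambda>xs. \<psi> xs [^]\<^bsub>K\<^esub> Poly_Mapping.lookup c xs) (Poly_Mapping.keys c)"
    unfolding section_chain_map_def \<psi>_def[symmetric]
    by (rule K.finprod_cong') (use assms \<psi>_ker K_pow K_pow_closed in \<open>auto simp: K_simps Pi_iff\<close>)
  also have "\<dots> = finprod K (\<lambda>xs. \<psi> xs [^]\<^bsub>K\<^esub> Poly_Mapping.lookup c xs) T"
    by (rule K.finprod_mono_neutral_cong_left)
      (use assms \<psi>_ker in \<open>auto simp: K_simps in_keys_iff Pi_iff intro!: K_pow_closed\<close>)
  finally show ?thesis .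
qed

lemma \<Psi>_hom: "\<Psi> \<in> hom (bar_chains G 2) K"
proof (rule homI)
  fix c assume c: "c \<in> carrier (bar_chains G 2)"
  then have kc: "Poly_Mapping.keys c \<subseteq> bar_basis G 2" by (simp add: bar_chains_basis)
  have P: "(\<lambda>xs. \<psi> xs [^]\<^bsub>K\<^esub> Poly_Mapping.lookup c xs) \<in> T \<rightarrow> carrier K" if "T \<subseteq> bar_basis G 2" for T and c :: "'a list \<Rightarrow>\<^sub>0 int"
    using that \<psi>_ker by (auto simp: K_simps intro!: K_pow_closed)
  show "\<Psi> c \<in> carrier K"
    unfolding \<Psi>_superset[OF finite_keys subset_refl kc] by (rule K.finprod_closed) (rule P[OF kc])
  fix d assume "d \<in> carrier (bar_chains G 2)"
  then have kd: "Poly_Mapping.keys d \<subseteq> bar_basis G 2" by (simp add: bar_chains_basis)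
  let ?T = "Poly_Mapping.keys c \<union> Poly_Mapping.keys d"
  have T: "finite ?T" "?T \<subseteq> bar_basis G 2" using kc kd by auto
  have "\<Psi> (c + d) = finprod K (\<lambda>xs. \<psi> xs [^]\<^bsub>K\<^esub> Poly_Mapping.lookup (c + d) xs) ?T"
    by (rule \<Psi>_superset[OF T(1) keys_add T(2)])
  also have "\<dots> = finprod K (\<lambda>xs. \<psi> xs [^]\<^bsub>K\<^esub> Poly_Mapping.lookup c xs \<otimes>\<^bsub>K\<^esub> \<psi> xs [^]\<^bsub>K\<^esub> Poly_Mapping.lookup d xs) ?T"
    using T(2) \<psi>_ker
    by (intro K.finprod_cong') (auto simp: lookup_add K.int_pow_mult[unfolded K_simps] K_simps Pi_iff intro!: ker_closed K_pow_closed)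
  also have "\<dots> = finprod K (\<lambda>xs. \<psi> xs [^]\<^bsub>K\<^esub> Poly_Mapping.lookup c xs) ?T \<otimes>\<^bsub>K\<^esub> finprod K (\<lambda>xs. \<psi> xs [^]\<^bsub>K\<^esub> Poly_Mapping.lookup d xs) ?T"
    by (rule K.finprod_multf) (rule P[OF T(2)])+
  also have "\<dots> = \<Psi> c \<otimes>\<^bsub>K\<^esub> \<Psi> d"
    using \<Psi>_superset[OF T(1) _ T(2), of c] \<Psi>_superset[OF T(1) _ T(2), of d] by simp
  finally show "\<Psi> (c \<otimes>\<^bsub>bar_chains G 2\<^esub> d) = \<Psi> c \<otimes>\<^bsub>K\<^esub> \<Psi> d" by (simp add: bar_chains_basis)
qed

lemma \<Psi>_generator: "a \<in> carrier G \<Longrightarrow> b \<in> carrier G \<Longrightarrow> \<Psi> (frag_of [a, b]) = \<psi> [a, b]"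
proof -
  assume ab: "a \<in> carrier G" "b \<in> carrier G"
  have k: "\<psi> [a, b] \<in> carrier K" using \<psi>[OF ab] by (simp add: K_simps)
  have "\<Psi> (frag_of [a, b]) = finprod K (\<lambda>xs. \<psi> xs [^]\<^bsub>K\<^esub> Poly_Mapping.lookup (frag_of [a, b]) xs) {[a, b]}"
    by (rule \<Psi>_superset) (use ab in \<open>auto simp: keys_frag_of bar_basis_2\<close>)
  also have "\<dots> = \<psi> [a, b]"
    using k by (simp add: Pi_iff K.int_pow_1)
  finally show ?thesis .
qed

text \<open>Multiplied by s(abc), both sides become s(a) s(b) s(c); the left side uses that
  \<psi>(b,c) is central.\<close>

lemma \<psi>_cocycle:
  assumes "a \<in> carrier G" "b \<in> carrier G" "c \<in> carrier G"
  shows "\<psi> [b, c] \<otimes> \<psi> [a, b \<otimes>\<^bsub>G\<^esub> c] = \<psi> [a, b] \<otimes> \<psi> [a \<otimes>\<^bsub>G\<^esub> b, c]"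
proof -
  have k: "\<psi> [b, c] \<in> carrier E" "\<psi> [a, b \<otimes>\<^bsub>G\<^esub> c] \<in> carrier E" "\<psi> [a, b] \<in> carrier E" "\<psi> [a \<otimes>\<^bsub>G\<^esub> b, c] \<in> carrier E"
    using assms \<psi> kerD by auto
  have "(\<psi> [b, c] \<otimes> \<psi> [a, b \<otimes>\<^bsub>G\<^esub> c]) \<otimes> s (a \<otimes>\<^bsub>G\<^esub> b \<otimes>\<^bsub>G\<^esub> c) = \<psi> [b, c] \<otimes> (s a \<otimes> s (b \<otimes>\<^bsub>G\<^esub> c))"
    using s_mult[of a "b \<otimes>\<^bsub>G\<^esub> c"] assms k s by (simp add: E.m_assoc G.m_assoc)
  also have "\<dots> = s a \<otimes> (\<psi> [b, c] \<otimes> s (b \<otimes>\<^bsub>G\<^esub> c))"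
    using central[OF \<psi>[OF assms(2,3)] s(1)[OF assms(1)]] assms k s by (simp add: E.m_assoc[symmetric])
  also have "\<dots> = s a \<otimes> s b \<otimes> s c"
    using s_mult[of b c] assms s by (simp add: E.m_assoc)
  also have "\<dots> = (\<psi> [a, b] \<otimes> \<psi> [a \<otimes>\<^bsub>G\<^esub> b, c]) \<otimes> s (a \<otimes>\<^bsub>G\<^esub> b \<otimes>\<^bsub>G\<^esub> c)"
    using s_mult[of a b] s_mult[of "a \<otimes>\<^bsub>G\<^esub> b" c] assms k s by (simp add: E.m_assoc)
  finally show ?thesis using assms k s by simp
qed

lemma C2: "comm_group (bar_chains G n)"
  unfolding bar_chains_basis by (rule abelian_free_Abelian_group)

lemmas \<Psi>_additive = free_Abelian_hom_additive[OF \<Psi>_hom[unfolded bar_chains_basis] K_group]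

lemma boundary_3_chain:
  assumes "Poly_Mapping.keys c \<subseteq> bar_basis G 3"
  shows "Poly_Mapping.keys (bar_boundary G c) \<subseteq> bar_basis G 2 \<and> bar_boundary G (bar_boundary G c) = 0 \<and> \<Psi> (bar_boundary G c) = \<one>"
  using assms
proof (induction c rule: free_Abelian_group_induct[consumes 1, case_names zero diff gen])
  case zero
  then show ?case using \<Psi>_additive(4)[of 0 0] by (simp add: bar_boundary_0 K_simps)
next
  case (diff x y)
  then have k: "Poly_Mapping.keys (bar_boundary G x - bar_boundary G y) \<subseteq> bar_basis G 2"
    using keys_diff[of "bar_boundary G x" "bar_boundary G y"] by blast
  have "\<Psi> (bar_boundary G x - bar_boundary G y) = \<one>\<^bsub>K\<^esub> \<otimes>\<^bsub>K\<^esub> inv\<^bsub>K\<^esub> \<one>\<^bsub>K\<^esub>"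
    using diff \<Psi>_additive(2)[of "bar_boundary G x" "bar_boundary G y"] by (simp only: K_simps(3))
  then show ?case using diff k by (simp add: bar_boundary_diff K.r_inv[OF K.one_closed, unfolded K_simps(3)] K_simps(3))
next
  case (gen xs)
  then obtain a b c where xs: "xs = [a, b, c]" and abc: "a \<in> carrier G" "b \<in> carrier G" "c \<in> carrier G"
    by (auto simp: bar_basis_3)
  let ?b = "frag_of [b, c] - frag_of [a \<otimes>\<^bsub>G\<^esub> b, c] + frag_of [a, b \<otimes>\<^bsub>G\<^esub> c] - frag_of [a, b]"
  have kg: "Poly_Mapping.keys (frag_of [x, y]) \<subseteq> bar_basis G 2" if "x \<in> carrier G" "y \<in> carrier G" for x y
    using that by (auto simp: keys_frag_of bar_basis_2)
  have k1: "Poly_Mapping.keys (frag_of [b, c] - frag_of [a \<otimes>\<^bsub>G\<^esub> b, c]) \<subseteq> bar_basis G 2"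
    using keys_diff kg abc by (meson G.m_closed Un_least subset_trans)
  have k2: "Poly_Mapping.keys (frag_of [b, c] - frag_of [a \<otimes>\<^bsub>G\<^esub> b, c] + frag_of [a, b \<otimes>\<^bsub>G\<^esub> c]) \<subseteq> bar_basis G 2"
    using keys_add k1 kg[of a "b \<otimes>\<^bsub>G\<^esub> c"] abc by (meson G.m_closed Un_least subset_trans)
  have k3: "Poly_Mapping.keys ?b \<subseteq> bar_basis G 2"
    using keys_diff k2 kg[of a b] abc by (meson Un_least subset_trans)
  have dd: "bar_boundary G ?b = 0"
    using abc by (simp add: bar_boundary_add bar_boundary_diff bar_boundary_2 G.m_assoc)
  have p: "\<psi> [b, c] \<in> carrier K" "\<psi> [a, b \<otimes>\<^bsub>G\<^esub> c] \<in> carrier K" "\<psi> [a, b] \<in> carrier K" "\<psi> [a \<otimes>\<^bsub>G\<^esub> b, c] \<in> carrier K"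
    using abc \<psi> by (auto simp: K_simps)
  have "\<Psi> ?b = \<psi> [b, c] \<otimes>\<^bsub>K\<^esub> inv\<^bsub>K\<^esub> \<psi> [a \<otimes>\<^bsub>G\<^esub> b, c] \<otimes>\<^bsub>K\<^esub> \<psi> [a, b \<otimes>\<^bsub>G\<^esub> c] \<otimes>\<^bsub>K\<^esub> inv\<^bsub>K\<^esub> \<psi> [a, b]"
    using abc by (simp add: \<Psi>_additive(2)[OF k2 kg] \<Psi>_additive(1)[OF k1 kg] \<Psi>_additive(2)[OF kg kg] \<Psi>_generator)
  also have "\<dots> = (\<psi> [b, c] \<otimes>\<^bsub>K\<^esub> \<psi> [a, b \<otimes>\<^bsub>G\<^esub> c]) \<otimes>\<^bsub>K\<^esub> inv\<^bsub>K\<^esub> (\<psi> [a, b] \<otimes>\<^bsub>K\<^esub> \<psi> [a \<otimes>\<^bsub>G\<^esub> b, c])"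
    using p by (simp add: K.inv_mult K.m_ac)
  also have "\<dots> = \<one>\<^bsub>K\<^esub>"
    using p \<psi>_cocycle[OF abc] by (simp only: K_simps(2)[symmetric] K.r_inv K.m_closed)
  finally show ?case using dd k3 by (simp add: xs bar_boundary_3 K_simps)
qed

lemma boundary_2_chain:
  assumes "Poly_Mapping.keys c \<subseteq> bar_basis G 2"
  shows "Poly_Mapping.keys (bar_boundary G c) \<subseteq> bar_basis G (Suc 0)"
  using assms
proof (induction c rule: free_Abelian_group_induct[consumes 1, case_names zero diff gen])
  case zero
  then show ?case by (simp add: bar_boundary_0)
next
  case (diff x y)
  then show ?case using keys_diff[of "bar_boundary G x" "bar_boundary G y"] by (auto simp: bar_boundary_diff)
next
  case (gen xs)
  then obtain a b where xs: "xs = [a, b]" and ab: "a \<in> carrier G" "b \<in> carrier G"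
    by (auto simp: bar_basis_2)
  have "Poly_Mapping.keys (frag_of [b] - frag_of [a \<otimes>\<^bsub>G\<^esub> b] + frag_of [a]) \<subseteq>
      Poly_Mapping.keys (frag_of [b]) \<union> Poly_Mapping.keys (frag_of [a \<otimes>\<^bsub>G\<^esub> b]) \<union> Poly_Mapping.keys (frag_of [a])"
    using keys_add[of "frag_of [b] - frag_of [a \<otimes>\<^bsub>G\<^esub> b]" "frag_of [a]"] keys_diff[of "frag_of [b]" "frag_of [a \<otimes>\<^bsub>G\<^esub> b]"] by blast
  then show ?case using ab by (auto simp: xs bar_boundary_2 keys_frag_of bar_basis_1)
qed

abbreviation "C \<equiv> bar_chains G 2"
abbreviation "Z2 \<equiv> C\<lparr>carrier := bar_cycles G 2\<rparr>"

lemma cycles_subgroup: "subgroup (bar_cycles G 2) C"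
proof -
  interpret C: comm_group C by (rule C2)
  have kd: "Poly_Mapping.keys (c + d) \<subseteq> bar_basis G 2"
    if "Poly_Mapping.keys c \<subseteq> bar_basis G 2" "Poly_Mapping.keys d \<subseteq> bar_basis G 2" for c d :: "'a list \<Rightarrow>\<^sub>0 int"
    using keys_add that by (meson Un_least subset_trans)
  show ?thesis
    by (rule C.subgroupI)
      (auto simp: bar_cycles_def bar_chains_basis bar_boundary_add bar_boundary_minus bar_boundary_0 kd intro!: exI[of _ 0])
qed

lemma boundaries_subgroup: "subgroup (bar_boundaries G 2) C"
proof -
  interpret C: comm_group C by (rule C2)
  show ?thesis
  proof (rule C.subgroupI)
    show "bar_boundaries G 2 \<subseteq> carrier C"
      using boundary_3_chain by (auto simp: bar_boundaries_def bar_chains_basis)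
    have "bar_boundary G 0 \<in> bar_boundaries G 2"
      unfolding bar_boundaries_def by (rule imageI) (simp add: bar_chains_basis)
    then show "bar_boundaries G 2 \<noteq> {}" by blast
    fix b assume "b \<in> bar_boundaries G 2"
    then obtain c where c: "b = bar_boundary G c" "Poly_Mapping.keys c \<subseteq> bar_basis G 3"
      by (auto simp: bar_boundaries_def bar_chains_basis)
    have "bar_boundary G (- c) \<in> bar_boundaries G 2"
      unfolding bar_boundaries_def by (rule imageI) (use c in \<open>simp add: bar_chains_basis\<close>)
    then show "inv\<^bsub>C\<^esub> b \<in> bar_boundaries G 2"
      using boundary_3_chain[OF c(2)] c(1) by (simp add: bar_chains_basis bar_boundary_minus)
    fix b' assume "b' \<in> bar_boundaries G 2"
    then obtain c' where c': "b' = bar_boundary G c'" "Poly_Mapping.keys c' \<subseteq> bar_basis G 3"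
      by (auto simp: bar_boundaries_def bar_chains_basis)
    have "bar_boundary G (c + c') \<in> bar_boundaries G 2"
      unfolding bar_boundaries_def by (rule imageI) (use c c' keys_add[of c c'] in \<open>auto simp: bar_chains_basis\<close>)
    then show "b \<otimes>\<^bsub>C\<^esub> b' \<in> bar_boundaries G 2"
      by (simp add: c(1) c'(1) bar_chains_basis bar_boundary_add)
  qed
qed

text \<open>Let M be the group of all 2-chains modulo boundaries and f(a,b) the class of [a|b], a
  cocycle precisely because boundaries are divided out. A homomorphism x -> (\<alpha>(x), \<pi>(x))
  into the extension by M yields a homomorphism \<nu> from the kernel to M. On generators, and hence
  on all chains, \<nu>(\<Psi>(c)) is the class of c times a term depending only on the boundary of
  c. For a cycle in the kernel of \<Psi> the class is therefore trivial.\<close>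

lemma homology_kernel_le:
  assumes univ: "\<And>(F :: (('a list \<Rightarrow>\<^sub>0 int) set \<times> 'a) monoid) \<rho>. central_extension F G \<rho> \<Longrightarrow>
      \<exists>h\<in>hom E F. \<forall>x\<in>carrier E. \<rho> (h x) = \<pi> x"
    and c: "c \<in> bar_cycles G 2" "\<Psi> c = \<one>"
  shows "c \<in> bar_boundaries G 2"
proof -
  interpret C: comm_group C by (rule C2)
  let ?B = "bar_boundaries G 2"
  have B: "?B \<lhd> C" using boundaries_subgroup by (rule C.subgroup_imp_normal)
  define M where "M = C Mod ?B"
  interpret M: comm_group M unfolding M_def by (rule C.abelian_FactGroup[OF boundaries_subgroup])
  define cl where "cl d = ?B #>\<^bsub>C\<^esub> d" for d
  have cl_hom: "cl \<in> hom C M" unfolding cl_def M_def by (rule normal.r_coset_hom_Mod[OF B])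
  note cl_add = free_Abelian_hom_additive[OF cl_hom[unfolded bar_chains_basis] M.comm_group_axioms]
  have kg: "Poly_Mapping.keys (frag_of [x, y]) \<subseteq> bar_basis G 2" if "x \<in> carrier G" "y \<in> carrier G" for x y
    using that by (auto simp: keys_frag_of bar_basis_2)
  have cl_B: "cl d = \<one>\<^bsub>M\<^esub> \<longleftrightarrow> d \<in> ?B" if "d \<in> carrier C" for d
  proof -
    have "?B #>\<^bsub>C\<^esub> d = ?B \<longleftrightarrow> d \<in> ?B"
      using C.coset_join1[OF _ that boundaries_subgroup] C.coset_join2[OF that boundaries_subgroup] by blast
    then show ?thesis by (simp add: cl_def M_def FactGroup_def)
  qed
  define f where "f a b = cl (frag_of [a, b])" for a b
  have f: "f a b \<in> carrier M" if "a \<in> carrier G" "b \<in> carrier G" for a b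
    unfolding f_def by (rule cl_add(5)[OF kg[OF that] kg[OF that]])
  have cocycle: "f b c \<otimes>\<^bsub>M\<^esub> f a (b \<otimes>\<^bsub>G\<^esub> c) = f a b \<otimes>\<^bsub>M\<^esub> f (a \<otimes>\<^bsub>G\<^esub> b) c"
    if abc: "a \<in> carrier G" "b \<in> carrier G" "c \<in> carrier G" for a b c
  proof -
    let ?p = "frag_of [b, c] + frag_of [a, b \<otimes>\<^bsub>G\<^esub> c]" and ?q = "frag_of [a, b] + frag_of [a \<otimes>\<^bsub>G\<^esub> b, c]"
    have k: "Poly_Mapping.keys ?p \<subseteq> bar_basis G 2" "Poly_Mapping.keys ?q \<subseteq> bar_basis G 2"
      using keys_add kg abc by (meson G.m_closed Un_least subset_trans)+
    have "?p - ?q = bar_boundary G (frag_of [a, b, c])" by (simp add: bar_boundary_3)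
    also have "\<dots> \<in> ?B" unfolding bar_boundaries_def
      by (rule imageI) (use abc in \<open>auto simp: bar_chains_basis keys_frag_of bar_basis_3\<close>)
    finally have "?p - ?q \<in> ?B" .
    then have "cl (?p - ?q) = \<one>\<^bsub>M\<^esub>"
      using cl_B[of "?p - ?q"] subgroup.subset[OF boundaries_subgroup] by blast
    then have "cl ?p \<otimes>\<^bsub>M\<^esub> inv\<^bsub>M\<^esub> cl ?q = \<one>\<^bsub>M\<^esub>" using cl_add(2)[OF k] by simp
    then have "cl ?p = cl ?q" using cl_add(5)[OF k] cl_add(5)[OF k(2,1)] by (metis M.inv_equality M.inv_inv M.inv_closed)
    then show ?thesis using abc by (simp add: f_def cl_add(1)[OF kg kg])
  qed
  note F = cocycle_extension_central[OF M.comm_group_axioms G_group f cocycle]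
  let ?F = "cocycle_extension M G f"
  obtain h where h: "h \<in> hom E ?F" "\<And>x. x \<in> carrier E \<Longrightarrow> snd (h x) = \<pi> x"
    using univ[OF F(1)] by blast
  define \<alpha> where "\<alpha> x = fst (h x)" for x
  have \<alpha>: "\<alpha> x \<in> carrier M" if "x \<in> carrier E" for x
    using hom_in_carrier[OF h(1) that] by (auto simp: \<alpha>_def cocycle_extension_def)
  have \<alpha>_mult: "\<alpha> (x \<otimes> y) = \<alpha> x \<otimes>\<^bsub>M\<^esub> \<alpha> y \<otimes>\<^bsub>M\<^esub> f (\<pi> x) (\<pi> y)" if "x \<in> carrier E" "y \<in> carrier E" for x y
    using hom_mult[OF h(1) that] h(2) that
    by (simp add: \<alpha>_def cocycle_extension_def case_prod_beta)
  \<comment> \<open>On the kernel \<alpha> is multiplicative only up to the constant f(1,1), which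
    this normalisation absorbs.\<close>
  define \<nu> where "\<nu> z = \<alpha> z \<otimes>\<^bsub>M\<^esub> f \<one>\<^bsub>G\<^esub> \<one>\<^bsub>G\<^esub>" for z
  have f11: "f \<one>\<^bsub>G\<^esub> \<one>\<^bsub>G\<^esub> \<in> carrier M" using f by simp
  have \<nu>_hom: "\<nu> \<in> hom K M"
  proof (rule homI)
    fix y assume "y \<in> carrier K"
    then have y: "y \<in> carrier E" "\<pi> y = \<one>\<^bsub>G\<^esub>" using kerD by (auto simp: K_simps)
    then show "\<nu> y \<in> carrier M" using \<alpha> f11 by (simp add: \<nu>_def)
    fix z assume "z \<in> carrier K"
    then have z: "z \<in> carrier E" "\<pi> z = \<one>\<^bsub>G\<^esub>" using kerD by (auto simp: K_simps)
    show "\<nu> (y \<otimes>\<^bsub>K\<^esub> z) = \<nu> y \<otimes>\<^bsub>M\<^esub> \<nu> z"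
      using y z \<alpha> f11 by (simp add: \<nu>_def K_simps \<alpha>_mult M.m_ac)
  qed
  \<comment> \<open>\<alpha> o s is extended to 1-chains, so that its contribution becomes a
    function of the boundary and disappears on cycles.\<close>
  define \<mu> where "\<mu> xs = \<alpha> (s (xs ! 0))" for xs
  have "\<mu> ` bar_basis G (Suc 0) \<subseteq> carrier M" using \<alpha> s by (auto simp: \<mu>_def bar_basis_1)
  then obtain m where m: "m \<in> hom (free_Abelian_group (bar_basis G (Suc 0))) M"
    "\<And>xs. xs \<in> bar_basis G (Suc 0) \<Longrightarrow> m (frag_of xs) = \<mu> xs"
    by (rule M.free_Abelian_group_universal) blast
  note m_add = free_Abelian_hom_additive[OF m(1) M.comm_group_axioms]
  have ma: "m (frag_of [a]) = \<alpha> (s a)" if "a \<in> carrier G" for a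
    using m(2)[of "[a]"] that by (simp add: bar_basis_1 \<mu>_def)
  have hom1: "\<nu> \<circ> \<Psi> \<in> hom (free_Abelian_group (bar_basis G 2)) M"
    using hom_compose[OF \<Psi>_hom \<nu>_hom] by (simp add: bar_chains_basis)
  have hom2: "(\<lambda>c. cl c \<otimes>\<^bsub>M\<^esub> m (bar_boundary G c)) \<in> hom (free_Abelian_group (bar_basis G 2)) M"
  proof (rule homI)
    fix c assume "c \<in> carrier (free_Abelian_group (bar_basis G 2))"
    then have c: "Poly_Mapping.keys c \<subseteq> bar_basis G 2" by simp
    note bc = boundary_2_chain[OF c]
    show "cl c \<otimes>\<^bsub>M\<^esub> m (bar_boundary G c) \<in> carrier M"
      using cl_add(5)[OF c c] m_add(5)[OF bc bc] by simp
    fix d assume "d \<in> carrier (free_Abelian_group (bar_basis G 2))"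
    then have d: "Poly_Mapping.keys d \<subseteq> bar_basis G 2" by simp
    note bd = boundary_2_chain[OF d]
    show "cl (c \<otimes>\<^bsub>free_Abelian_group (bar_basis G 2)\<^esub> d) \<otimes>\<^bsub>M\<^esub> m (bar_boundary G (c \<otimes>\<^bsub>free_Abelian_group (bar_basis G 2)\<^esub> d)) =
      cl c \<otimes>\<^bsub>M\<^esub> m (bar_boundary G c) \<otimes>\<^bsub>M\<^esub> (cl d \<otimes>\<^bsub>M\<^esub> m (bar_boundary G d))"
      using cl_add(5)[OF c c] m_add(5)[OF bc bc] cl_add(5)[OF d d] m_add(5)[OF bd bd]
      by (simp add: bar_boundary_add cl_add(1)[OF c d] m_add(1)[OF bc bd] M.m_ac)
  qed
  have c': "Poly_Mapping.keys c \<subseteq> bar_basis G 2" "bar_boundary G c = 0"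
    using c(1) by (auto simp: bar_cycles_def bar_chains_basis)
  have "(\<nu> \<circ> \<Psi>) c = cl c \<otimes>\<^bsub>M\<^esub> m (bar_boundary G c)"
  proof (rule free_Abelian_hom_eq[OF hom1 hom2 M.comm_group_axioms _ c'(1)])
    fix xs assume "xs \<in> bar_basis G 2"
    then obtain a b where xs: "xs = [a, b]" and ab: "a \<in> carrier G" "b \<in> carrier G" by (auto simp: bar_basis_2)
    have k1: "Poly_Mapping.keys (frag_of [x]) \<subseteq> bar_basis G (Suc 0)" if "x \<in> carrier G" for x
      using that by (auto simp: keys_frag_of bar_basis_1)
    have kd: "Poly_Mapping.keys (frag_of [b] - frag_of [a \<otimes>\<^bsub>G\<^esub> b]) \<subseteq> bar_basis G (Suc 0)"
      using keys_diff k1 ab by (meson G.m_closed Un_least subset_trans)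
    have sc: "\<alpha> (s a) \<in> carrier M" "\<alpha> (s b) \<in> carrier M" "\<alpha> (s (a \<otimes>\<^bsub>G\<^esub> b)) \<in> carrier M" "\<alpha> (\<psi> [a, b]) \<in> carrier M" "f a b \<in> carrier M"
      using \<alpha> s ab f kerD(1)[OF \<psi>[OF ab]] by auto
    have "\<alpha> (s a \<otimes> s b) = \<alpha> (\<psi> [a, b] \<otimes> s (a \<otimes>\<^bsub>G\<^esub> b))" using s_mult[OF ab] by simp
    then have "\<alpha> (s a) \<otimes>\<^bsub>M\<^esub> \<alpha> (s b) \<otimes>\<^bsub>M\<^esub> f a b = \<alpha> (\<psi> [a, b]) \<otimes>\<^bsub>M\<^esub> \<alpha> (s (a \<otimes>\<^bsub>G\<^esub> b)) \<otimes>\<^bsub>M\<^esub> f \<one>\<^bsub>G\<^esub> \<one>\<^bsub>G\<^esub>"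
      using ab s kerD[OF \<psi>[OF ab]] F(2)[of "a \<otimes>\<^bsub>G\<^esub> b"] by (simp add: \<alpha>_mult)
    then have e: "\<nu> (\<psi> [a, b]) \<otimes>\<^bsub>M\<^esub> \<alpha> (s (a \<otimes>\<^bsub>G\<^esub> b)) = \<alpha> (s a) \<otimes>\<^bsub>M\<^esub> \<alpha> (s b) \<otimes>\<^bsub>M\<^esub> f a b"
      using sc f11 by (simp add: \<nu>_def M.m_ac)
    have nc: "\<nu> (\<psi> [a, b]) \<in> carrier M" using sc f11 by (simp add: \<nu>_def)
    have "\<nu> (\<psi> [a, b]) = \<nu> (\<psi> [a, b]) \<otimes>\<^bsub>M\<^esub> \<alpha> (s (a \<otimes>\<^bsub>G\<^esub> b)) \<otimes>\<^bsub>M\<^esub> inv\<^bsub>M\<^esub> \<alpha> (s (a \<otimes>\<^bsub>G\<^esub> b))"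
      using nc sc by (simp add: M.m_assoc)
    also have "\<dots> = f a b \<otimes>\<^bsub>M\<^esub> (\<alpha> (s b) \<otimes>\<^bsub>M\<^esub> inv\<^bsub>M\<^esub> \<alpha> (s (a \<otimes>\<^bsub>G\<^esub> b)) \<otimes>\<^bsub>M\<^esub> \<alpha> (s a))"
      unfolding e using sc by (simp add: M.m_ac)
    also have "\<alpha> (s b) \<otimes>\<^bsub>M\<^esub> inv\<^bsub>M\<^esub> \<alpha> (s (a \<otimes>\<^bsub>G\<^esub> b)) \<otimes>\<^bsub>M\<^esub> \<alpha> (s a) = m (bar_boundary G (frag_of [a, b]))"
      using ab by (simp add: bar_boundary_2 m_add(1)[OF kd k1] m_add(2)[OF k1 k1] ma)
    finally show "(\<nu> \<circ> \<Psi>) (frag_of xs) = cl (frag_of xs) \<otimes>\<^bsub>M\<^esub> m (bar_boundary G (frag_of xs))"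
      using ab by (simp add: xs \<Psi>_generator f_def)
  qed
  moreover have "\<nu> \<one> = \<one>\<^bsub>M\<^esub>"
    using hom_one[OF \<nu>_hom K.group_axioms M.group_axioms] by (simp add: K_simps)
  ultimately have "cl c = \<one>\<^bsub>M\<^esub>"
    using c(2) c'(2) m_add(4)[of 0 0] cl_add(5)[OF c'(1) c'(1)] by simp
  then show ?thesis using cl_B[of c] c'(1) by (simp add: bar_chains_basis)
qed

text \<open>Elements e for which s(\<pi>(e)) e^-1 is \<Psi> of a chain with boundary [\<pi>(e)] form
  a subgroup. Every element of the extension is a central multiple of one of them, so the subgroup
  contains all commutators and is everything. For z in the kernel, the chain found for z is compared
  with [1|1], which also has boundary [1].\<close>

lemma homology_onto_kernel:
  assumes perfect: "\<And>D. subgroup D E \<Longrightarrow>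
      (\<And>a b. a \<in> carrier E \<Longrightarrow> b \<in> carrier E \<Longrightarrow> a \<otimes> b \<otimes> inv a \<otimes> inv b \<in> D) \<Longrightarrow> carrier E \<subseteq> D"
    and z: "z \<in> ker"
  shows "\<exists>c\<in>bar_cycles G 2. \<Psi> c = z"
proof -
  define chain where "chain c \<longleftrightarrow> Poly_Mapping.keys c \<subseteq> bar_basis G 2" for c :: "'a list \<Rightarrow>\<^sub>0 int"
  have ch: "chain (c + d)" "chain (c - d)" "chain (- c)" if "chain c" "chain d" for c d
    using that keys_add[of c d] keys_diff[of c d] by (auto simp: chain_def)
  have chg: "chain (frag_of [a, b])" if "a \<in> carrier G" "b \<in> carrier G" for a b
    using that by (simp add: chain_def keys_frag_of bar_basis_2)
  have \<Psi>k: "\<Psi> c \<in> ker" if "chain c" for c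
    using \<Psi>_additive(5)[of c c] that by (simp add: chain_def K_simps)
  have \<Psi>a: "\<Psi> (c + d) = \<Psi> c \<otimes> \<Psi> d" "\<Psi> (c - d) = \<Psi> c \<otimes> inv \<Psi> d" "\<Psi> (- c) = inv \<Psi> c"
    if "chain c" "chain d" for c d
    using \<Psi>_additive(1,2,3)[of c d] that \<Psi>k K_inv by (simp_all add: chain_def K_simps)
  have s1: "\<Psi> (frag_of [\<one>\<^bsub>G\<^esub>, \<one>\<^bsub>G\<^esub>]) = s \<one>\<^bsub>G\<^esub>" "bar_boundary G (frag_of [\<one>\<^bsub>G\<^esub>, \<one>\<^bsub>G\<^esub>]) = frag_of [\<one>\<^bsub>G\<^esub>]"
    using s[of "\<one>\<^bsub>G\<^esub>"] by (simp_all add: \<Psi>_generator \<psi>_def E.m_assoc bar_boundary_2)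
  \<comment> \<open>The 1-chains that bound. That every [g] bounds is the vanishing of H_1, obtained
    from perfectness because commutators have this property.\<close>
  define L where "L = {c. \<exists>d. chain d \<and> bar_boundary G d = c}"
  have L_diff: "c - d \<in> L" if cd: "c \<in> L" "d \<in> L" for c d
  proof -
    obtain c' d' where "chain c'" "bar_boundary G c' = c" "chain d'" "bar_boundary G d' = d" using cd unfolding L_def by blast
    then have "chain (c' - d')" "bar_boundary G (c' - d') = c - d" using ch by (simp_all add: bar_boundary_diff)
    then show ?thesis unfolding L_def by blast
  qed
  have L_gen: "frag_of [b] - frag_of [a \<otimes>\<^bsub>G\<^esub> b] + frag_of [a] \<in> L" if "a \<in> carrier G" "b \<in> carrier G" for a b
    unfolding L_def using chg[OF that] bar_boundary_2[of G a b] by blast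
  have L0: "0 \<in> L" using L_diff[OF L_gen L_gen, of "\<one>\<^bsub>G\<^esub>" "\<one>\<^bsub>G\<^esub>" "\<one>\<^bsub>G\<^esub>" "\<one>\<^bsub>G\<^esub>"] by simp
  have L_minus: "- c \<in> L" if "c \<in> L" for c using L_diff[OF L0 that] by simp
  have L_add: "c + d \<in> L" if "c \<in> L" "d \<in> L" for c d using L_diff[OF that(1) L_minus[OF that(2)]] by simp
  have L1: "frag_of [\<one>\<^bsub>G\<^esub>] \<in> L" using L_gen[of "\<one>\<^bsub>G\<^esub>" "\<one>\<^bsub>G\<^esub>"] by simp
  have L_mult: "frag_of [a \<otimes>\<^bsub>G\<^esub> b] - frag_of [a] - frag_of [b] \<in> L" if "a \<in> carrier G" "b \<in> carrier G" for a b
    using L_minus[OF L_gen[OF that]] by (simp add: algebra_simps)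
  have L_inv: "frag_of [inv\<^bsub>G\<^esub> a] + frag_of [a] \<in> L" if "a \<in> carrier G" for a
    using L_add[OF L_gen[of a "inv\<^bsub>G\<^esub> a"] L1] that by simp
  have Lall: "frag_of [\<pi> e] \<in> L" if "e \<in> carrier E" for e
  proof -
    let ?D = "{e \<in> carrier E. frag_of [\<pi> e] \<in> L}"
    have "carrier E \<subseteq> ?D"
    proof (rule perfect)
      show "subgroup ?D E"
      proof (rule E.subgroupI)
        have "\<one> \<in> ?D" using L1 by simp
        then show "?D \<noteq> {}" by blast
        show "inv e \<in> ?D" if "e \<in> ?D" for e
          using L_diff[OF L_inv[of "\<pi> e"], of "frag_of [\<pi> e]"] that by simp
        show "e \<otimes> e' \<in> ?D" if "e \<in> ?D" "e' \<in> ?D" for e e'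
        proof -
          have "(frag_of [\<pi> e \<otimes>\<^bsub>G\<^esub> \<pi> e'] - frag_of [\<pi> e] - frag_of [\<pi> e']) + frag_of [\<pi> e] + frag_of [\<pi> e'] \<in> L"
            using that by (intro L_add L_mult) auto
          then show ?thesis using that by simp
        qed
      qed auto
      fix a b assume ab: "a \<in> carrier E" "b \<in> carrier E"
      define A B where "A = \<pi> a" and "B = \<pi> b"
      have AB: "A \<in> carrier G" "B \<in> carrier G" using ab by (auto simp: A_def B_def)
      have "frag_of [A \<otimes>\<^bsub>G\<^esub> B \<otimes>\<^bsub>G\<^esub> inv\<^bsub>G\<^esub> A \<otimes>\<^bsub>G\<^esub> inv\<^bsub>G\<^esub> B] =
          (frag_of [A \<otimes>\<^bsub>G\<^esub> B \<otimes>\<^bsub>G\<^esub> inv\<^bsub>G\<^esub> A \<otimes>\<^bsub>G\<^esub> inv\<^bsub>G\<^esub> B] - frag_of [A \<otimes>\<^bsub>G\<^esub> B \<otimes>\<^bsub>G\<^esub> inv\<^bsub>G\<^esub> A] - frag_of [inv\<^bsub>G\<^esub> B])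
        + (frag_of [A \<otimes>\<^bsub>G\<^esub> B \<otimes>\<^bsub>G\<^esub> inv\<^bsub>G\<^esub> A] - frag_of [A \<otimes>\<^bsub>G\<^esub> B] - frag_of [inv\<^bsub>G\<^esub> A])
        + (frag_of [A \<otimes>\<^bsub>G\<^esub> B] - frag_of [A] - frag_of [B])
        + (frag_of [inv\<^bsub>G\<^esub> A] + frag_of [A]) + (frag_of [inv\<^bsub>G\<^esub> B] + frag_of [B])"
        by simp
      also have "\<dots> \<in> L" using AB by (intro L_add L_mult L_inv) auto
      finally show "a \<otimes> b \<otimes> inv a \<otimes> inv b \<in> ?D"
        using ab by (simp add: A_def B_def)
    qed
    then show ?thesis using that by blast
  qed
  define D where "D = {e \<in> carrier E. \<exists>c. chain c \<and> bar_boundary G c = frag_of [\<pi> e] \<and> s (\<pi> e) = \<Psi> c \<otimes> e}"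
  have D_mult: "e \<otimes> e' \<in> D" if De: "e \<in> D" "e' \<in> D" for e e'
  proof -
    obtain c c' where c: "chain c" "bar_boundary G c = frag_of [\<pi> e]" "s (\<pi> e) = \<Psi> c \<otimes> e"
      and c': "chain c'" "bar_boundary G c' = frag_of [\<pi> e']" "s (\<pi> e') = \<Psi> c' \<otimes> e'"
      using De by (auto simp: D_def)
    have e: "e \<in> carrier E" "e' \<in> carrier E" using De by (auto simp: D_def)
    \<comment> \<open>Subtracting the boundary of [a|b], which is [b] - [ab] + [a], turns [a] + [b]
      into [ab].\<close>
    define d where "d = c + c' - frag_of [\<pi> e, \<pi> e']"
    have g: "chain (frag_of [\<pi> e, \<pi> e'])" using e by (intro chg) auto
    have d: "chain d" unfolding d_def using ch c c' g by blast
    have bd: "bar_boundary G d = frag_of [\<pi> (e \<otimes> e')]"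
      using e by (simp add: d_def bar_boundary_add bar_boundary_diff bar_boundary_2 c c')
    have k: "\<Psi> c \<in> carrier E" "\<Psi> c' \<in> carrier E" "\<psi> [\<pi> e, \<pi> e'] \<in> carrier E"
      using \<Psi>k kerD c c' \<psi> e by auto
    have "\<psi> [\<pi> e, \<pi> e'] \<otimes> s (\<pi> (e \<otimes> e')) = \<Psi> c \<otimes> e \<otimes> (\<Psi> c' \<otimes> e')"
      using s_mult[of "\<pi> e" "\<pi> e'"] e c c' by simp
    also have "\<dots> = \<Psi> c \<otimes> (e \<otimes> \<Psi> c') \<otimes> e'" using k e by (simp add: E.m_assoc)
    also have "\<dots> = (\<Psi> c \<otimes> \<Psi> c') \<otimes> (e \<otimes> e')"
      unfolding central[OF \<Psi>k[OF c'(1)] e(1), symmetric] using k e by (simp add: E.m_assoc)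
    finally have "s (\<pi> (e \<otimes> e')) = inv \<psi> [\<pi> e, \<pi> e'] \<otimes> (\<Psi> c \<otimes> \<Psi> c' \<otimes> (e \<otimes> e'))"
      using k e s[of "\<pi> (e \<otimes> e')"] by (metis E.inv_solve_left E.m_closed \<pi>.hom_closed)
    also have "\<dots> = \<Psi> d \<otimes> (e \<otimes> e')"
      using k e c c' g ch central[OF ker_closed(2)[OF \<psi>[of "\<pi> e" "\<pi> e'"]], of "\<Psi> c \<otimes> \<Psi> c'"]
      by (simp add: d_def \<Psi>a \<Psi>_generator E.m_assoc[symmetric])
    finally show ?thesis using e d bd unfolding D_def by blast
  qed
  have D1: "\<one> \<in> D"
    unfolding D_def using s1 chg[of "\<one>\<^bsub>G\<^esub>" "\<one>\<^bsub>G\<^esub>"] s(1)[of "\<one>\<^bsub>G\<^esub>"] by (auto intro!: exI[of _ "frag_of [\<one>\<^bsub>G\<^esub>, \<one>\<^bsub>G\<^esub>]"])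
  have s1k: "s \<one>\<^bsub>G\<^esub> \<in> ker" using s[of "\<one>\<^bsub>G\<^esub>"] by (simp add: kernel_def)
  have D_inv: "inv e \<in> D" if De: "e \<in> D" for e
  proof -
    obtain c where c: "chain c" "bar_boundary G c = frag_of [\<pi> e]" "s (\<pi> e) = \<Psi> c \<otimes> e" and e: "e \<in> carrier E"
      using De by (auto simp: D_def)
    let ?X = "\<pi> e" and ?Y = "inv\<^bsub>G\<^esub> \<pi> e"
    \<comment> \<open>The boundary is [1] - [X] + ([Y] - [1] + [X]) = [Y]; the term [1|1] supplies
      the [1].\<close>
    define d where "d = frag_of [\<one>\<^bsub>G\<^esub>, \<one>\<^bsub>G\<^esub>] - c + frag_of [?X, ?Y]"
    have X: "?X \<in> carrier G" "?Y \<in> carrier G" using e by auto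
    have d: "chain d" unfolding d_def using ch chg c X by (meson G.one_closed)
    have "chain (frag_of [\<one>\<^bsub>G\<^esub>, \<one>\<^bsub>G\<^esub>] - c)" using ch chg c by (meson G.one_closed)
    note g = this chg[OF X] chg[OF G.one_closed G.one_closed]
    have bd: "bar_boundary G d = frag_of [\<pi> (inv e)]"
      using e by (simp add: d_def bar_boundary_add bar_boundary_diff bar_boundary_2 c)
    have k: "\<Psi> c \<in> carrier E" "\<psi> [?X, ?Y] \<in> carrier E" "s \<one>\<^bsub>G\<^esub> \<in> carrier E" "s ?Y \<in> carrier E"
      using \<Psi>k kerD c \<psi> X s by auto
    have "\<psi> [?X, ?Y] \<otimes> s \<one>\<^bsub>G\<^esub> = \<Psi> c \<otimes> e \<otimes> s ?Y"
      using s_mult[OF X] X c by simp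
    then have "inv \<Psi> c \<otimes> (\<psi> [?X, ?Y] \<otimes> s \<one>\<^bsub>G\<^esub>) = e \<otimes> s ?Y"
      using k e by (simp add: E.m_assoc E.inv_solve_left')
    moreover have "\<Psi> d = inv \<Psi> c \<otimes> (\<psi> [?X, ?Y] \<otimes> s \<one>\<^bsub>G\<^esub>)"
    proof -
      have "\<Psi> d = s \<one>\<^bsub>G\<^esub> \<otimes> (inv \<Psi> c \<otimes> \<psi> [?X, ?Y])"
        using g c X k by (simp add: d_def \<Psi>a \<Psi>_generator[OF X] s1 E.m_assoc)
      also have "\<dots> = (inv \<Psi> c \<otimes> \<psi> [?X, ?Y]) \<otimes> s \<one>\<^bsub>G\<^esub>"
        using central[OF s1k] k by simp
      finally show ?thesis using k by (simp add: E.m_assoc)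
    qed
    ultimately have "\<Psi> d = e \<otimes> s ?Y" by simp
    then have "inv e \<otimes> \<Psi> d = s ?Y" using e k by (simp add: E.m_assoc[symmetric])
    then have "s (\<pi> (inv e)) = \<Psi> d \<otimes> inv e" using central[OF \<Psi>k[OF d]] e by simp
    then show ?thesis using e d bd unfolding D_def by blast
  qed
  have D_lift: "\<exists>y\<in>ker. y \<otimes> a \<in> D" if a: "a \<in> carrier E" for a
  proof -
    obtain c where c: "chain c" "bar_boundary G c = frag_of [\<pi> a]" using Lall[OF a] by (auto simp: L_def)
    define y where "y = inv \<Psi> c \<otimes> (s (\<pi> a) \<otimes> inv a)"
    have k: "\<Psi> c \<in> carrier E" "\<pi> (\<Psi> c) = \<one>\<^bsub>G\<^esub>" "s (\<pi> a) \<in> carrier E" using \<Psi>k[OF c(1)] kerD s a by auto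
    have y: "y \<in> ker" using k a s by (simp add: y_def kernel_def)
    have "\<Psi> c \<otimes> (y \<otimes> a) = s (\<pi> a)" using k a by (simp add: y_def E.m_assoc) (simp add: E.m_assoc[symmetric])
    moreover have "\<pi> (y \<otimes> a) = \<pi> a" using y a kerD by simp
    ultimately have "y \<otimes> a \<in> D" unfolding D_def using y a kerD c by auto
    then show ?thesis using y by blast
  qed
  have "carrier E \<subseteq> D"
  proof (rule perfect)
    show "subgroup D E"
    proof (rule E.subgroupI)
      show "D \<subseteq> carrier E" by (auto simp: D_def)
      show "D \<noteq> {}" using D1 by blast
    qed (use D_mult D_inv in blast)+
    fix a b assume ab: "a \<in> carrier E" "b \<in> carrier E"
    obtain y y' where y: "y \<in> ker" "y \<otimes> a \<in> D" "y' \<in> ker" "y' \<otimes> b \<in> D" using D_lift ab by meson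
    have c: "y \<in> carrier E" "y' \<in> carrier E" using y kerD by auto
    \<comment> \<open>The central factors drop out, so the commutator of a and b is a commutator of
      elements of \<open>D\<close>.\<close>
    have "(y \<otimes> a) \<otimes> (y' \<otimes> b) \<otimes> inv (y \<otimes> a) \<otimes> inv (y' \<otimes> b) \<in> D"
      by (rule D_mult[OF D_mult[OF D_mult[OF y(2) y(4)] D_inv[OF y(2)]] D_inv[OF y(4)]])
    also have "(y \<otimes> a) \<otimes> (y' \<otimes> b) \<otimes> inv (y \<otimes> a) \<otimes> inv (y' \<otimes> b) =
        a \<otimes> b \<otimes> inv a \<otimes> inv b"
    proof -
      have m: "a \<otimes> y' = y' \<otimes> a" using central[OF y(3) ab(1)] by simp
      have "(y \<otimes> a) \<otimes> (y' \<otimes> b) = y \<otimes> (a \<otimes> y') \<otimes> b" using c ab by (simp add: E.m_assoc)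
      also have "\<dots> = (y \<otimes> y') \<otimes> (a \<otimes> b)" unfolding m using c ab by (simp add: E.m_assoc)
      also have "\<dots> = (a \<otimes> b) \<otimes> (y \<otimes> y')" using central[OF ker_closed(1)[OF y(1,3)]] ab by simp
      finally have 1: "(y \<otimes> a) \<otimes> (y' \<otimes> b) = (a \<otimes> b) \<otimes> (y \<otimes> y')" .
      have 2: "(y' \<otimes> b) \<otimes> (y \<otimes> a) = (b \<otimes> a) \<otimes> (y \<otimes> y')"
      proof -
        have m': "b \<otimes> y = y \<otimes> b" using central[OF y(1) ab(2)] by simp
        have "(y' \<otimes> b) \<otimes> (y \<otimes> a) = y' \<otimes> (b \<otimes> y) \<otimes> a" using c ab by (simp add: E.m_assoc)
        also have "\<dots> = (y' \<otimes> y) \<otimes> (b \<otimes> a)" unfolding m' using c ab by (simp add: E.m_assoc)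
        also have "y' \<otimes> y = y \<otimes> y'" using central[OF y(3) c(1)] .
        also have "y \<otimes> y' \<otimes> (b \<otimes> a) = (b \<otimes> a) \<otimes> (y \<otimes> y')" using central[OF ker_closed(1)[OF y(1,3)]] ab by simp
        finally show ?thesis .
      qed
      have "(y \<otimes> a) \<otimes> (y' \<otimes> b) \<otimes> inv (y \<otimes> a) \<otimes> inv (y' \<otimes> b) =
          (y \<otimes> a) \<otimes> (y' \<otimes> b) \<otimes> inv ((y' \<otimes> b) \<otimes> (y \<otimes> a))"
        using c ab by (simp add: E.inv_mult_group E.m_assoc)
      also have "\<dots> = (a \<otimes> b) \<otimes> ((y \<otimes> y') \<otimes> inv (y \<otimes> y')) \<otimes> inv (b \<otimes> a)"
        unfolding 1 2 using c ab by (simp add: E.inv_mult_group E.m_assoc)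
      also have "\<dots> = a \<otimes> b \<otimes> inv a \<otimes> inv b"
        unfolding E.r_inv[OF E.m_closed[OF c]] using ab by (simp add: E.inv_mult_group E.m_assoc)
      finally show ?thesis .
    qed
    finally show "a \<otimes> b \<otimes> inv a \<otimes> inv b \<in> D" .
  qed
  then have "z \<in> D" using z kerD by blast
  then obtain c where c: "chain c" "bar_boundary G c = frag_of [\<one>\<^bsub>G\<^esub>]" "s \<one>\<^bsub>G\<^esub> = \<Psi> c \<otimes> z"
    using kerD[OF z] by (auto simp: D_def)
  \<comment> \<open>Both chains have boundary [1], so the difference is a cycle; its image is s(1)
    times the inverse of \<open>\<Psi> c\<close>, which is z.\<close>
  define d where "d = frag_of [\<one>\<^bsub>G\<^esub>, \<one>\<^bsub>G\<^esub>] - c"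
  have o: "chain (frag_of [\<one>\<^bsub>G\<^esub>, \<one>\<^bsub>G\<^esub>])" by (rule chg) auto
  have "chain d" unfolding d_def using ch o c by blast
  moreover have "bar_boundary G d = 0" by (simp add: d_def bar_boundary_diff c s1)
  moreover have "\<Psi> d = z"
  proof -
    have k: "\<Psi> c \<in> carrier E" "z \<in> carrier E" using \<Psi>k[OF c(1)] kerD z by auto
    have "\<Psi> d = \<Psi> c \<otimes> z \<otimes> inv \<Psi> c" using \<Psi>a(2)[OF o c(1)] s1 c by (simp add: d_def)
    also have "\<dots> = z" using central[OF z k(1)] k by (simp add: E.m_assoc flip: central[OF z k(1)])
    finally show ?thesis .
  qed
  ultimately show ?thesis unfolding bar_cycles_def chain_def bar_chains_basis by auto
qed

text \<open>The first isomorphism theorem for \<Psi> restricted to cycles: it maps onto the kernel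
  of the extension, and its own kernel consists of the boundaries.\<close>

theorem H2_natural_map_iso:
  assumes univ: "\<And>(F :: (('a list \<Rightarrow>\<^sub>0 int) set \<times> 'a) monoid) \<rho>. central_extension F G \<rho> \<Longrightarrow>
      \<exists>h\<in>hom E F. \<forall>x\<in>carrier E. \<rho> (h x) = \<pi> x"
    and perfect: "\<And>D. subgroup D E \<Longrightarrow>
      (\<And>a b. a \<in> carrier E \<Longrightarrow> b \<in> carrier E \<Longrightarrow> a \<otimes> b \<otimes> inv a \<otimes> inv b \<in> D) \<Longrightarrow> carrier E \<subseteq> D"
  shows "H2_natural_map E G \<pi> s \<in> iso (group_homology 2 G) K"
proof -
  interpret C: comm_group C by (rule C2)
  have Z: "group Z2" using subgroup.subgroup_is_group[OF cycles_subgroup C.group_axioms] .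
  have "\<Psi> \<in> hom Z2 K"
    using \<Psi>_hom subgroup.subset[OF cycles_subgroup] by (auto simp: hom_def Pi_iff)
  then interpret \<Psi>: group_hom Z2 K \<Psi>
    using Z K.group_axioms by (simp add: group_hom_def group_hom_axioms_def)
  have "\<Psi> ` carrier Z2 = carrier K"
    using \<Psi>.hom_closed homology_onto_kernel[OF perfect] by (fastforce simp: K_simps)
  from \<Psi>.FactGroup_iso_set[OF this]
  have "(\<lambda>Q. the_elem (\<Psi> ` Q)) \<in> iso (Z2 Mod kernel Z2 K \<Psi>) K" .
  moreover have "kernel Z2 K \<Psi> = bar_boundaries G 2"
  proof
    show "kernel Z2 K \<Psi> \<subseteq> bar_boundaries G 2"
      using homology_kernel_le[OF univ] by (auto simp: kernel_def K_simps)
    show "bar_boundaries G 2 \<subseteq> kernel Z2 K \<Psi>"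
    proof
      fix b assume "b \<in> bar_boundaries G 2"
      then obtain c where "b = bar_boundary G c" "Poly_Mapping.keys c \<subseteq> bar_basis G 3"
        by (auto simp: bar_boundaries_def bar_chains_basis)
      then show "b \<in> kernel Z2 K \<Psi>"
        using boundary_3_chain[of c] by (simp add: kernel_def K_simps bar_cycles_def bar_chains_basis del: Suc_numeral)
    qed
  qed
  moreover have "H2_natural_map E G \<pi> s = (\<lambda>Q. the_elem (\<Psi> ` Q))"
    by (simp add: H2_natural_map_def fun_eq_iff)
  ultimately show ?thesis by (simp add: group_homology_def)
qed

end

theorem proposition6p13:
  fixes S :: "nat set"
  assumes "(\<exists>n\<ge>2. S = first_primes n) \<or>
    S \<in> {{2, 3, 7}, {2, 3, 11}, {2, 3, 5, 11}, {2, 3, 13}, {2, 3, 7, 13}, {2, 3, 17}, {2, 3, 5, 19}}"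
  defines "A \<equiv> Z_loc S"
  shows "(\<forall>s. set_section (St2 A) (SL2 A) (steinberg_map A) s \<longrightarrow>
            H2_natural_map (St2 A) (SL2 A) (steinberg_map A) s
              \<in> iso (group_homology 2 (SL2 A)) (K2_2 A)) \<and>
         universal_central_extension TYPE('f) (St2 A) (SL2 A) (steinberg_map A)"
proof -
  have S: "admissible S" and S23: "{2, 3} \<subseteq> S"
    using assms(1) admissible_first_primes admissible_exceptional first_primes_2 by auto
  have A: "A = S_integers S"
    unfolding A_def by (rule Z_loc_eq) (rule admissible_prime[OF S])
  interpret rat_subring A unfolding A by (rule S_int.rat_subring_axioms)
  have "smooth S 2" "smooth S 3"
    using S23 by (auto simp: smooth_def dest: primes_dvd_imp_eq[rotated 2])
  then have units: "2 \<in> units" "3 \<in> units"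
    using smooth_unit[of S 2] smooth_unit[of S 3] unfolding A by simp_all
  have divisor: "\<exists>r\<in>A. \<exists>m n. s = of_int m * r \<and> t = of_int n * r" if "s \<in> A" "t \<in> A" for s t
    using that S_integers_common_divisor unfolding A by blast
  have ext: "central_extension (St2 A) (SL2 A) (steinberg_map A)"
    unfolding A by (rule steinberg_central_extension[OF S])
  \<comment> \<open>Left general in the type of the competing extension: it is used for
    \<open>'f\<close> and for the extension by 2-chains modulo boundaries.\<close>
  note universal = St_universal[OF units divisor]
  have "H2_natural_map (St2 A) (SL2 A) (steinberg_map A) s \<in> iso (group_homology 2 (SL2 A)) (K2_2 A)"
    if "set_section (St2 A) (SL2 A) (steinberg_map A) s" for s
  proof -
    interpret central_extension_section "St2 A" "SL2 A" "steinberg_map A" s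
      using ext that by unfold_locales
    show ?thesis
      unfolding K2_2_def
    proof (rule H2_natural_map_iso)
      show "\<exists>h\<in>hom (St2 A) F. \<forall>x\<in>carrier (St2 A). \<rho> (h x) = steinberg_map A x"
        if "central_extension F (SL2 A) \<rho>" for F :: "(((rat^2^2) list \<Rightarrow>\<^sub>0 int) set \<times> (rat^2^2)) monoid" and \<rho>
        using universal[OF _ _ that] by blast
    qed (rule St_perfect[OF units])
  qed
  moreover have "universal_central_extension TYPE('f) (St2 A) (SL2 A) (steinberg_map A)"
    unfolding universal_central_extension_def using ext universal by blast
  ultimately show ?thesis by blast
qed

end
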